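(* Let $F:\hat\Omega\to\overline\Omega$ be a polar mapping which has a first order polar singularity, and let $W^0_h,W^1_h,W^2_h$ be the pushforward tensor-product spline spaces on $\Omega$ with bases $T^0_{ij}$, $\{\boldsymbol T^s_{ij},\boldsymbol T^\theta_{ij}\}$, $T^2_{ij}$ (all defined in the context). Define $$V^0_h := W^0_h\cap H^1(\Omega),\qquad V^1_h := W^1_h\cap H(\mathrm{curl};\Omega),\qquad V^2_h := W^2_h\cap L^2(\Omega).$$ Then $$V^0_h=\Big\{\phi=\sum_{i,j}\phi_{ij}T^0_{ij}\in W^0_h:\ \phi_{0j}=\gamma_0\ \text{ for all } j\Big\},$$ $$V^1_h=\Big\{\boldsymbol v=\sum_{i,j}v^s_{ij}\boldsymbol T^s_{ij}+\sum_{i,j}v^\theta_{ij}\boldsymbol T^\theta_{ij}\in W^1_h:\ v^\theta_{0j}=0\ \text{ and }\ v^\theta_{1j}=v^s_{0(j+1)}-v^s_{0j}\ \text{ for all } j\Big\},$$ $$V^2_h=\Big\{f=\sum_{i,j}f_{ij}T^2_{ij}\in W^2_h:\ f_{0j}=0\ \text{ for all } j\Big\},$$ where $\gamma_0$ is a real parameter that may differ for each $\phi\in V^0_h$ and that corresponds to its value at the pole, $\phi(\boldsymbol x_0)=\gamma_0$. Moreover $V^0_h=W^0_h\cap C^0(\Omega)$.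
   Context: **Polar mapping.** Let $L>0$ and $\hat\Omega=[0,L]\times(\mathbb R/2\pi\mathbb Z)$ with coordinates $(s,\theta)$. A polar mapping is a surjective $C^1$ map $F:\hat\Omega\to\overline\Omega$, with $\Omega\subset\mathbb R^2$ a bounded open domain, which collapses the edge $\{s=0\}$ to a single point $\boldsymbol x_0\in\Omega$ (the pole) and restricts to a $C^1$ diffeomorphism from $\hat\Omega_0=\hat\Omega\setminus\{s=0\}$ onto $\overline\Omega\setminus\{\boldsymbol x_0\}$; moreover $\Omega=F(\{s<L\})$. $J_F$ denotes the Jacobian matrix of $F=(F_1,F_2)$ in the variables $(s,\theta)$. **First order polar singularity.** $F$ has a first order polar singularity if: (i) $$J_F(s,\theta)=\begin{pmatrix}C(\theta)+\mathcal O(s)& s(C'(\theta)+\mathcal O(s))\\ S(\theta)+\mathcal O(s)& s(S'(\theta)+\mathcal O(s))\end{pmatrix},\qquad \det J_F(s,\theta)=s(D(\theta)+\mathcal O(s)),$$ where $C,S$ are $C^1$ ($2\pi$-periodic) functions, $D=CS'-SC'$ satisfies $D(\theta)>0$ for all $\theta$, and $\mathcal O(s)$ denotes generic functions of $(s,\theta)$ (possibly different at each occurrence) with $|\mathcal O(s)|\le c\,s$ for some constant $c>0$; (ii) $sD_*\le\det J_F(s,\theta)$ for some constant $D_*>0$, and $(\det J_F)^{-1}(s,\theta)=\frac{1+\mathcal O(s)}{sD(\theta)}$. **Splines.** Let $p\ge1$. $B_i$, $0\le i<n_s$, are the normalized (partition of unity) B-splines of degree $p$ on $[0,L]$ for the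 open knot sequence $0=s_0=\dots=s_p<s_{p+1}<\dots<s_{n_s-1}<s_{n_s}=\dots=s_{n_s+p}=L$. $M_i$, $0\le i<n_s-1$, is $\frac{p}{s_{i+p+1}-s_{i+1}}$ times the normalized B-spline of degree $p-1$ with knots $s_{i+1},\dots,s_{i+p+1}$, so $B_i'=M_{i-1}-M_i$ with $M_{-1}=M_{n_s-1}=0$. In the angle, $\theta_j=j\Delta\theta$, $\Delta\theta=2\pi/n_\theta$, $n_\theta\ge p+1$, and the index $j$ is understood modulo $n_\theta$. $\mathring B_j$ is the $2\pi$-periodic normalized B-spline of degree $p$ with knots $\theta_j,\dots,\theta_{j+p+1}$, and $\mathring M_j$ is $\frac1{\Delta\theta}$ times the $2\pi$-periodic normalized B-spline of degree $p-1$ with knots $\theta_{j+1},\dots,\theta_{j+p+1}$, so $\mathring B_j'=\mathring M_{j-1}-\mathring M_j$. **Pushforward spaces.** With $\boldsymbol x=F(s,\theta)$, $s>0$, define functions a.e. on $\Omega$ by $T^0_{ij}(\boldsymbol x)=B_i(s)\mathring B_j(\theta)$ ($0\le i<n_s$); $\boldsymbol T^s_{ij}(\boldsymbol x)=J_F^{-T}(s,\theta)\,(M_i(s)\mathring B_j(\theta),\,0)^T$ ($0\le i<n_s-1$); $\boldsymbol T^\theta_{ij}(\boldsymbol x)=J_F^{-T}(s,\theta)\,(0,\,B_i(s)\mathring M_j(\theta))^T$ ($0\le i<n_s$); $T^2_{ij}(\boldsymbol x)=(\det J_F(s,\theta))^{-1}M_i(s)\mathring M_j(\theta)$ ($0\le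 i<n_s-1$); always $0\le j<n_\theta$. $W^0_h=\mathrm{Span}\{T^0_{ij}\}$, $W^1_h=\mathrm{Span}(\{\boldsymbol T^s_{ij}\}\cup\{\boldsymbol T^\theta_{ij}\})$, $W^2_h=\mathrm{Span}\{T^2_{ij}\}$. Intersections with $H^1$, $H(\mathrm{curl})$, $L^2$, $C^0$ are understood for functions up to a.e. equality (i.e. up to the value at the pole). For a vector field, $\mathrm{curl}\,\boldsymbol v=\partial_1v_2-\partial_2v_1$ and $H(\mathrm{curl};\Omega)=\{\boldsymbol v\in L^2(\Omega)^2:\mathrm{curl}\,\boldsymbol v\in L^2(\Omega)\}$. *)

theory Defs
  imports "HOL-Analysis.Analysis"
begin

section \<open>Sobolev spaces\<close>

text \<open>The spaces below are sets of representatives: membership of a function depends only on its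
  a.e. equivalence class on \<open>\<Omega>\<close>.\<close>

definition partial :: "'n::finite \<Rightarrow> (real^'n \<Rightarrow> real) \<Rightarrow> real^'n \<Rightarrow> real" where
  "partial i f x = frechet_derivative f (at x) (axis i 1)"

primrec Ck :: "nat \<Rightarrow> (real^'n::finite \<Rightarrow> real) \<Rightarrow> bool" where
  "Ck 0 f \<longleftrightarrow> continuous_on UNIV f"
| "Ck (Suc k) f \<longleftrightarrow> (\<forall>x. f differentiable (at x)) \<and> (\<forall>i. Ck k (partial i f))"

definition test_functions :: "(real^'n::finite) set \<Rightarrow> (real^'n \<Rightarrow> real) set" where
  "test_functions \<Omega> = {\<phi>. (\<forall>k. Ck k \<phi>) \<and> compact (closure {x. \<phi> x \<noteq> 0})
     \<and> closure {x. \<phi> x \<noteq> 0} \<subseteq> \<Omega>}"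

definition L2 :: "'a::euclidean_space set \<Rightarrow> ('a \<Rightarrow> 'b::euclidean_space) set" where
  "L2 \<Omega> = {f. f \<in> borel_measurable (lebesgue_on \<Omega>)
     \<and> integrable (lebesgue_on \<Omega>) (\<lambda>x. (norm (f x))\<^sup>2)}"

definition weak_partial ::
    "(real^'n::finite) set \<Rightarrow> 'n \<Rightarrow> (real^'n \<Rightarrow> real) \<Rightarrow> (real^'n \<Rightarrow> real) \<Rightarrow> bool" where
  "weak_partial \<Omega> i u g \<longleftrightarrow> (\<forall>\<phi>\<in>test_functions \<Omega>.
     (LINT x|lebesgue_on \<Omega>. u x * partial i \<phi> x) = - (LINT x|lebesgue_on \<Omega>. g x * \<phi> x))"

definition H1 :: "(real^'n::finite) set \<Rightarrow> (real^'n \<Rightarrow> real) set" where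
  "H1 \<Omega> = {u \<in> L2 \<Omega>. \<forall>i. \<exists>g\<in>L2 \<Omega>. weak_partial \<Omega> i u g}"

text \<open>The distributional curl \<open>\<partial>\<^sub>1 v\<^sub>2 - \<partial>\<^sub>2 v\<^sub>1\<close>; both derivatives are moved onto the test function.\<close>

definition weak_curl :: "(real^2) set \<Rightarrow> (real^2 \<Rightarrow> real^2) \<Rightarrow> (real^2 \<Rightarrow> real) \<Rightarrow> bool" where
  "weak_curl \<Omega> v w \<longleftrightarrow> (\<forall>\<phi>\<in>test_functions \<Omega>.
     - (LINT x|lebesgue_on \<Omega>. v x $ 2 * partial 1 \<phi> x - v x $ 1 * partial 2 \<phi> x)
     = (LINT x|lebesgue_on \<Omega>. w x * \<phi> x))"

definition Hcurl :: "(real^2) set \<Rightarrow> (real^2 \<Rightarrow> real^2) set" where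
  "Hcurl \<Omega> = {v \<in> L2 \<Omega>. \<exists>w\<in>L2 \<Omega>. weak_curl \<Omega> v w}"

definition continuous_representative ::
    "(real^2) set \<Rightarrow> (real^2 \<Rightarrow> real) \<Rightarrow> (real^2 \<Rightarrow> real) \<Rightarrow> bool" where
  "continuous_representative \<Omega> f g \<longleftrightarrow>
     continuous_on \<Omega> g \<and> (AE x in lebesgue_on \<Omega>. f x = g x)"

definition C0 :: "(real^2) set \<Rightarrow> (real^2 \<Rightarrow> real) set" where
  "C0 \<Omega> = {f. \<exists>g. continuous_representative \<Omega> f g}"


section \<open>Polar mappings\<close>

text \<open>A point \<open>(s, \<theta>)\<close> of \<open>[0,L] \<times> (\<real>/2\<pi>\<int>)\<close> is represented by vectors \<open>z\<close> with \<open>z $ 1 = s\<close> and with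
  \<open>z $ 2\<close> a real lift of \<open>\<theta>\<close>; maps on this set are maps on the strip that are \<open>2\<pi>\<close>-periodic in
  \<open>z $ 2\<close>.\<close>

definition strip :: "real \<Rightarrow> (real^2) set" where
  "strip L = {z. 0 \<le> z $ 1 \<and> z $ 1 \<le> L}"

definition strip0 :: "real \<Rightarrow> (real^2) set" where
  "strip0 L = {z. 0 < z $ 1 \<and> z $ 1 \<le> L}"

definition C1_map_on :: "(real^'m::finite) set \<Rightarrow> (real^'m \<Rightarrow> real^'n::finite) \<Rightarrow> bool" where
  "C1_map_on X f \<longleftrightarrow> (\<exists>A. (\<forall>x\<in>X. (f has_derivative (\<lambda>h. A x *v h)) (at x within X))
     \<and> continuous_on X A)"

text \<open>\<open>F\<close> induces a \<open>C\<^sup>1\<close> diffeomorphism from \<open>(0,L] \<times> (\<real>/2\<pi>\<int>)\<close> onto \<open>Y\<close>. Its inverse takes values in a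
  quotient, so being \<open>C\<^sup>1\<close> is expressed through local lifts \<open>G\<close> of the inverse to the strip.\<close>

definition polar_diffeo :: "real \<Rightarrow> (real^2 \<Rightarrow> real^2) \<Rightarrow> (real^2) set \<Rightarrow> bool" where
  "polar_diffeo L F Y \<longleftrightarrow>
     C1_map_on (strip0 L) F \<and>
     F ` strip0 L = Y \<and>
     (\<forall>z\<in>strip0 L. \<forall>w\<in>strip0 L. F z = F w \<longrightarrow>
        z $ 1 = w $ 1 \<and> (\<exists>k::int. z $ 2 = w $ 2 + 2 * pi * of_int k)) \<and>
     (\<forall>y\<in>Y. \<exists>U G. open U \<and> y \<in> U \<and> C1_map_on (U \<inter> Y) G \<and>
        G ` (U \<inter> Y) \<subseteq> strip0 L \<and> (\<forall>x\<in>U \<inter> Y. F (G x) = x))"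

definition polar_mapping ::
    "real \<Rightarrow> (real^2) set \<Rightarrow> real^2 \<Rightarrow> (real^2 \<Rightarrow> real^2) \<Rightarrow> bool" where
  "polar_mapping L \<Omega> x0 F \<longleftrightarrow>
     0 < L \<and> open \<Omega> \<and> bounded \<Omega> \<and> connected \<Omega> \<and> x0 \<in> \<Omega> \<and>
     (\<forall>z\<in>strip L. F (z + vector [0, 2 * pi]) = F z) \<and>
     C1_map_on (strip L) F \<and>
     F ` strip L = closure \<Omega> \<and>
     (\<forall>z\<in>strip L. z $ 1 = 0 \<longrightarrow> F z = x0) \<and>
     polar_diffeo L F (closure \<Omega> - {x0}) \<and>
     F ` {z \<in> strip L. z $ 1 < L} = \<Omega>"

definition JF :: "real \<Rightarrow> (real^2 \<Rightarrow> real^2) \<Rightarrow> real^2 \<Rightarrow> real^2^2" where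
  "JF L F z = jacobian F (at z within strip L)"

definition Os :: "real \<Rightarrow> (real^2 \<Rightarrow> real) \<Rightarrow> bool" where
  "Os L r \<longleftrightarrow> (\<exists>c>0. \<forall>z\<in>strip L. \<bar>r z\<bar> \<le> c * z $ 1)"

definition C1_periodic :: "(real \<Rightarrow> real) \<Rightarrow> (real \<Rightarrow> real) \<Rightarrow> bool" where
  "C1_periodic f f' \<longleftrightarrow> (\<forall>t. (f has_real_derivative f' t) (at t)) \<and> continuous_on UNIV f' \<and>
     (\<forall>t. f (t + 2 * pi) = f t)"

definition first_order_polar_singularity :: "real \<Rightarrow> (real^2 \<Rightarrow> real^2) \<Rightarrow> bool" where
  "first_order_polar_singularity L F \<longleftrightarrow>
     (\<exists>C C' S S' D. C1_periodic C C' \<and> C1_periodic S S' \<and>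
        (\<forall>t. D t = C t * S' t - S t * C' t) \<and> (\<forall>t. 0 < D t) \<and>
        (\<exists>r11 r12 r21 r22. Os L r11 \<and> Os L r12 \<and> Os L r21 \<and> Os L r22 \<and>
           (\<forall>z\<in>strip L. JF L F z =
              vector [vector [C (z $ 2) + r11 z, z $ 1 * (C' (z $ 2) + r12 z)],
                      vector [S (z $ 2) + r21 z, z $ 1 * (S' (z $ 2) + r22 z)]])) \<and>
        (\<exists>r. Os L r \<and> (\<forall>z\<in>strip L. det (JF L F z) = z $ 1 * (D (z $ 2) + r z))) \<and>
        (\<exists>Dmin>0. \<forall>z\<in>strip L. z $ 1 * Dmin \<le> det (JF L F z)) \<and>
        (\<exists>r. Os L r \<and>
           (\<forall>z\<in>strip0 L. inverse (det (JF L F z)) = (1 + r z) / (z $ 1 * D (z $ 2)))))"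


section \<open>Splines\<close>

text \<open>Cox--de Boor recursion. Terms with coinciding knots vanish since \<open>x / 0 = 0\<close>. The half-open
  convention makes every spline vanish at the last knot \<open>L\<close>; this affects only the boundary of the
  domain.\<close>

fun bspline :: "(nat \<Rightarrow> real) \<Rightarrow> nat \<Rightarrow> nat \<Rightarrow> real \<Rightarrow> real" where
  "bspline t 0 i x = (if t i \<le> x \<and> x < t (i + 1) then 1 else 0)"
| "bspline t (Suc p) i x =
     (x - t i) / (t (i + p + 1) - t i) * bspline t p i x +
     (t (i + p + 2) - x) / (t (i + p + 2) - t (i + 1)) * bspline t p (i + 1) x"

definition open_knots :: "real \<Rightarrow> nat \<Rightarrow> nat \<Rightarrow> (nat \<Rightarrow> real) \<Rightarrow> bool" where
  "open_knots L p ns s \<longleftrightarrow> p < ns \<and> (\<forall>k\<le>p. s k = 0) \<and> strict_mono_on {p..ns} s \<and>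
     (\<forall>k. ns \<le> k \<and> k \<le> ns + p \<longrightarrow> s k = L)"

definition Bs :: "nat \<Rightarrow> (nat \<Rightarrow> real) \<Rightarrow> nat \<Rightarrow> real \<Rightarrow> real" where
  "Bs p s i x = bspline s p i x"

definition Ms :: "nat \<Rightarrow> (nat \<Rightarrow> real) \<Rightarrow> nat \<Rightarrow> real \<Rightarrow> real" where
  "Ms p s i x = real p / (s (i + p + 1) - s (i + 1)) * bspline s (p - 1) (i + 1) x"

definition dtheta :: "nat \<Rightarrow> real" where
  "dtheta nt = 2 * pi / real nt"

text \<open>For each argument only finitely many terms of the sum are nonzero.\<close>

definition periodic_bspline :: "nat \<Rightarrow> nat \<Rightarrow> nat \<Rightarrow> real \<Rightarrow> real" where
  "periodic_bspline nt p j x =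
     (\<Sum>\<^sub>\<infinity>k::int. bspline (\<lambda>m. real m * dtheta nt) p j (x + 2 * pi * of_int k))"

definition Bt :: "nat \<Rightarrow> nat \<Rightarrow> nat \<Rightarrow> real \<Rightarrow> real" where
  "Bt p nt j x = periodic_bspline nt p j x"

definition Mt :: "nat \<Rightarrow> nat \<Rightarrow> nat \<Rightarrow> real \<Rightarrow> real" where
  "Mt p nt j x = 1 / dtheta nt * periodic_bspline nt (p - 1) (j + 1) x"


section \<open>Pushforward spline spaces\<close>

text \<open>Polar coordinates of a point of \<open>\<Omega>\<close> other than the pole; at the pole and outside the range of
  \<open>F\<close> the value is unspecified and irrelevant.\<close>

definition polar_coords :: "real \<Rightarrow> (real^2 \<Rightarrow> real^2) \<Rightarrow> real^2 \<Rightarrow> real^2" where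
  "polar_coords L F = inv_into {z \<in> strip0 L. 0 \<le> z $ 2 \<and> z $ 2 < 2 * pi} F"

definition T0 :: "real \<Rightarrow> (real^2 \<Rightarrow> real^2) \<Rightarrow> nat \<Rightarrow> (nat \<Rightarrow> real) \<Rightarrow> nat
    \<Rightarrow> nat \<Rightarrow> nat \<Rightarrow> real^2 \<Rightarrow> real" where
  "T0 L F p s nt i j x =
     (let z = polar_coords L F x in Bs p s i (z $ 1) * Bt p nt j (z $ 2))"

definition T1s :: "real \<Rightarrow> (real^2 \<Rightarrow> real^2) \<Rightarrow> nat \<Rightarrow> (nat \<Rightarrow> real) \<Rightarrow> nat
    \<Rightarrow> nat \<Rightarrow> nat \<Rightarrow> real^2 \<Rightarrow> real^2" where
  "T1s L F p s nt i j x =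
     (let z = polar_coords L F x in
        transpose (matrix_inv (JF L F z)) *v vector [Ms p s i (z $ 1) * Bt p nt j (z $ 2), 0])"

definition T1t :: "real \<Rightarrow> (real^2 \<Rightarrow> real^2) \<Rightarrow> nat \<Rightarrow> (nat \<Rightarrow> real) \<Rightarrow> nat
    \<Rightarrow> nat \<Rightarrow> nat \<Rightarrow> real^2 \<Rightarrow> real^2" where
  "T1t L F p s nt i j x =
     (let z = polar_coords L F x in
        transpose (matrix_inv (JF L F z)) *v vector [0, Bs p s i (z $ 1) * Mt p nt j (z $ 2)])"

definition T2 :: "real \<Rightarrow> (real^2 \<Rightarrow> real^2) \<Rightarrow> nat \<Rightarrow> (nat \<Rightarrow> real) \<Rightarrow> nat
    \<Rightarrow> nat \<Rightarrow> nat \<Rightarrow> real^2 \<Rightarrow> real" where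
  "T2 L F p s nt i j x =
     (let z = polar_coords L F x in
        inverse (det (JF L F z)) * (Ms p s i (z $ 1) * Mt p nt j (z $ 2)))"

definition comb0 :: "real \<Rightarrow> (real^2 \<Rightarrow> real^2) \<Rightarrow> nat \<Rightarrow> nat \<Rightarrow> (nat \<Rightarrow> real) \<Rightarrow> nat
    \<Rightarrow> (nat \<Rightarrow> nat \<Rightarrow> real) \<Rightarrow> real^2 \<Rightarrow> real" where
  "comb0 L F p ns s nt c = (\<lambda>x. \<Sum>i<ns. \<Sum>j<nt. c i j * T0 L F p s nt i j x)"

definition comb1 :: "real \<Rightarrow> (real^2 \<Rightarrow> real^2) \<Rightarrow> nat \<Rightarrow> nat \<Rightarrow> (nat \<Rightarrow> real) \<Rightarrow> nat
    \<Rightarrow> (nat \<Rightarrow> nat \<Rightarrow> real) \<Rightarrow> (nat \<Rightarrow> nat \<Rightarrow> real) \<Rightarrow> real^2 \<Rightarrow> real^2" where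
  "comb1 L F p ns s nt cs ct = (\<lambda>x.
     (\<Sum>i<ns - 1. \<Sum>j<nt. cs i j *\<^sub>R T1s L F p s nt i j x) +
     (\<Sum>i<ns. \<Sum>j<nt. ct i j *\<^sub>R T1t L F p s nt i j x))"

definition comb2 :: "real \<Rightarrow> (real^2 \<Rightarrow> real^2) \<Rightarrow> nat \<Rightarrow> nat \<Rightarrow> (nat \<Rightarrow> real) \<Rightarrow> nat
    \<Rightarrow> (nat \<Rightarrow> nat \<Rightarrow> real) \<Rightarrow> real^2 \<Rightarrow> real" where
  "comb2 L F p ns s nt c = (\<lambda>x. \<Sum>i<ns - 1. \<Sum>j<nt. c i j * T2 L F p s nt i j x)"

text \<open>The spans of the finite families, as sets of all linear combinations.\<close>

definition W0 where "W0 L F p ns s nt = range (comb0 L F p ns s nt)"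
definition W1 where "W1 L F p ns s nt = {comb1 L F p ns s nt cs ct | cs ct. True}"
definition W2 where "W2 L F p ns s nt = range (comb2 L F p ns s nt)"

definition V0 where "V0 L \<Omega> F p ns s nt = W0 L F p ns s nt \<inter> H1 \<Omega>"
definition V1 where "V1 L \<Omega> F p ns s nt = W1 L F p ns s nt \<inter> Hcurl \<Omega>"
definition V2 where "V2 L \<Omega> F p ns s nt = W2 L F p ns s nt \<inter> L2 \<Omega>"

end

(*
  Away from the pole x0 the splines are locally Lipschitz and their gradients and curls exist almost
  everywhere; by integration by parts these are weak derivatives on the punctured domain. By the
  du Bois-Reymond lemma every weak derivative on the whole domain agrees with them, so membership in
  H^1 or H(curl) forces them to be square integrable. Conversely, a point is removable in dimension
  two: fields that are bounded together with their weak divergence on the punctured domain have the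
  same weak divergence on the whole domain, as the gradient of a cutoff at scale e has integral O(e).

  It remains to decide boundedness and square integrability by the behaviour at the pole. The gradient
  of the angle and the inverse Jacobian determinant are comparable to 1/s, while only the radial
  splines of index 0 are nonzero at s = 0. Hence the derivatives are bounded if the angular splines
  formed by the coefficients of index 0 vanish. Otherwise they are at least c/s on a sector, and 1/s^2
  is not integrable against the area element s ds dtheta. By linear independence of the angular
  splines, all this amounts to the stated conditions on the coefficients.
*)

theory Submission
  imports Defs
begin

section \<open>Locally Lipschitz functions\<close>

lemma lipschitz_on_mult_bounded:
  fixes f g :: "'a::metric_space \<Rightarrow> real"
  assumes f: "C-lipschitz_on X f" and g: "D-lipschitz_on X g"
    and "bounded (f ` X)" "bounded (g ` X)"
  obtains E where "E-lipschitz_on X (\<lambda>x. f x * g x)"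
proof -
  obtain A B where A: "\<And>x. x \<in> X \<Longrightarrow> \<bar>f x\<bar> \<le> A" "A > 0" and B: "\<And>x. x \<in> X \<Longrightarrow> \<bar>g x\<bar> \<le> B" "B > 0"
    using assms(3,4) unfolding bounded_pos by auto
  have "(A * D + B * C)-lipschitz_on X (\<lambda>x. f x * g x)"
  proof (rule lipschitz_onI)
    fix x y assume xy: "x \<in> X" "y \<in> X"
    have "f x * g x - f y * g y = f x * (g x - g y) + g y * (f x - f y)"
      by (simp add: algebra_simps)
    then have "dist (f x * g x) (f y * g y) \<le> \<bar>f x\<bar> * dist (g x) (g y) + \<bar>g y\<bar> * dist (f x) (f y)"
      unfolding dist_real_def by (metis abs_mult abs_triangle_ineq)
    also have "\<dots> \<le> A * (D * dist x y) + B * (C * dist x y)"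
      using xy A B lipschitz_onD[OF f xy] lipschitz_onD[OF g xy] by (intro add_mono mult_mono) auto
    finally show "dist (f x * g x) (f y * g y) \<le> (A * D + B * C) * dist x y"
      by (simp add: algebra_simps)
  qed (use A(2) B(2) lipschitz_on_nonneg[OF f] lipschitz_on_nonneg[OF g] in auto)
  then show thesis by (rule that)
qed

lemma lipschitz_on_bounded_image:
  fixes f :: "'a::heine_borel \<Rightarrow> 'b::heine_borel"
  shows "C-lipschitz_on X f \<Longrightarrow> bounded X \<Longrightarrow> bounded (f ` X)"
  by (rule bounded_uniformly_continuous_image[OF lipschitz_on_uniformly_continuous])

lemma lipschitz_on_max:
  fixes f g :: "'a::metric_space \<Rightarrow> real"
  assumes f: "C-lipschitz_on X f" and g: "C-lipschitz_on X g"
  shows "C-lipschitz_on X (\<lambda>x. max (f x) (g x))"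
proof (rule lipschitz_onI)
  fix x y assume xy: "x \<in> X" "y \<in> X"
  show "dist (max (f x) (g x)) (max (f y) (g y)) \<le> C * dist x y"
    using lipschitz_onD[OF f xy] lipschitz_onD[OF g xy] unfolding dist_real_def by linarith
qed (rule lipschitz_on_nonneg[OF f])

lemma lipschitz_on_cones_le:
  fixes f :: "'a::metric_space \<Rightarrow> real"
  assumes f: "C-lipschitz_on S f" and "y \<in> S" "z \<in> S"
  shows "f z - C * dist x z \<le> f y + C * dist x y"
proof -
  have "f z - f y \<le> C * dist z y" using lipschitz_onD[OF f assms(3,2)] by (simp add: dist_real_def)
  also have "\<dots> \<le> C * (dist x z + dist x y)"
    using lipschitz_on_nonneg[OF f] dist_triangle[of z y x]
    by (intro mult_left_mono) (auto simp: dist_commute)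
  finally show ?thesis by (simp add: algebra_simps)
qed

text \<open>McShane's extension is the infimum of the upper cones \<open>f y + C * dist x y\<close>.\<close>

lemma lipschitz_on_extend:
  fixes f :: "'a::metric_space \<Rightarrow> real"
  assumes f: "C-lipschitz_on S f"
  obtains g where "C-lipschitz_on UNIV g" "\<And>x. x \<in> S \<Longrightarrow> g x = f x"
proof (cases "S = {}")
  case True
  then show thesis
    using that[of "\<lambda>_. 0"] lipschitz_on_nonneg[OF f] by (simp add: lipschitz_on_def)
next
  case False
  have C: "C \<ge> 0" by (rule lipschitz_on_nonneg[OF f])
  note cones = lipschitz_on_cones_le[OF f]
  define g where "g x = (INF y\<in>S. f y + C * dist x y)" for x
  have bdd: "bdd_below ((\<lambda>y. f y + C * dist x y) ` S)" for x
  proof -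
    obtain z where "z \<in> S" using False by blast
    then show ?thesis using cones by (intro bdd_belowI2[where m = "f z - C * dist x z"]) blast
  qed
  have growth: "g x \<le> g x' + C * dist x x'" for x x'
  proof -
    have "g x - C * dist x x' \<le> g x'"
      unfolding g_def[of x']
    proof (rule cINF_greatest[OF False])
      fix y assume "y \<in> S"
      then have "g x \<le> f y + C * dist x y" unfolding g_def by (intro cINF_lower bdd)
      also have "\<dots> \<le> f y + C * (dist x x' + dist x' y)"
        using C dist_triangle[of x y x'] by (intro add_left_mono mult_left_mono) auto
      finally show "g x - C * dist x x' \<le> f y + C * dist x' y" by (simp add: algebra_simps)
    qed
    then show ?thesis by simp
  qed
  have "C-lipschitz_on UNIV g"
  proof (rule lipschitz_onI)
    fix x y
    show "dist (g x) (g y) \<le> C * dist x y"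
      using growth[of x y] growth[of y x] unfolding dist_real_def dist_commute[of y x] by linarith
  qed (rule C)
  moreover have "g x = f x" if "x \<in> S" for x
  proof (rule antisym)
    show "g x \<le> f x" unfolding g_def using cINF_lower[OF bdd that, of x] by simp
    show "f x \<le> g x" unfolding g_def
      using cones[OF _ that, of _ x] by (intro cINF_greatest[OF False]) simp
  qed
  ultimately show thesis by (rule that)
qed

text \<open>The library notion has an additional parameter, which is trivial here.\<close>

definition loc_lipschitz :: "'a::metric_space set \<Rightarrow> ('a \<Rightarrow> 'b::metric_space) \<Rightarrow> bool" where
  "loc_lipschitz X f \<longleftrightarrow> local_lipschitz {0::real} X (\<lambda>_. f)"

lemma loc_lipschitz_iff:
  "loc_lipschitz X f \<longleftrightarrow> (\<forall>x\<in>X. \<exists>r>0. \<exists>C. C-lipschitz_on (cball x r \<inter> X) f)"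
  unfolding loc_lipschitz_def local_lipschitz_def by (auto; fastforce)

lemma loc_lipschitz_subset: "loc_lipschitz X f \<Longrightarrow> Y \<subseteq> X \<Longrightarrow> loc_lipschitz Y f"
  unfolding loc_lipschitz_def by (rule local_lipschitz_subset) auto

lemma loc_lipschitz_continuous_on: "loc_lipschitz X f \<Longrightarrow> continuous_on X f"
  unfolding loc_lipschitz_def by (rule local_lipschitz_continuous_on) auto

lemma loc_lipschitz_compact:
  assumes "loc_lipschitz X f" "compact K" "K \<subseteq> X"
  obtains C where "C-lipschitz_on K f"
  using local_lipschitz_compact_implies_lipschitz[of "{0::real}" K "\<lambda>_. f"] assms(2)
    loc_lipschitz_subset[OF assms(1,3)] unfolding loc_lipschitz_def by auto

lemma lipschitz_on_imp_loc_lipschitz: "C-lipschitz_on X f \<Longrightarrow> loc_lipschitz X f"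
  unfolding loc_lipschitz_iff by (meson Int_lower2 lipschitz_on_subset zero_less_one)

lemma loc_lipschitz_const: "loc_lipschitz X (\<lambda>x. c)"
  by (rule lipschitz_on_imp_loc_lipschitz[OF lipschitz_on_constant])

lemma loc_lipschitz_cong:
  assumes "loc_lipschitz X f" "\<And>x. x \<in> X \<Longrightarrow> f x = g x"
  shows "loc_lipschitz X g"
  using assms unfolding loc_lipschitz_iff lipschitz_on_def by simp

lemma loc_lipschitz_locallyI:
  assumes "\<And>x. x \<in> X \<Longrightarrow> \<exists>Y. open Y \<and> x \<in> Y \<and> loc_lipschitz Y f"
  shows "loc_lipschitz X f"
  unfolding loc_lipschitz_iff
proof
  fix x assume x: "x \<in> X"
  then obtain Y where Y: "open Y" "x \<in> Y" "loc_lipschitz Y f" using assms by blast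
  then obtain r C where r: "r > 0" "C-lipschitz_on (cball x r \<inter> Y) f"
    unfolding loc_lipschitz_iff by blast
  obtain q where "q > 0" "cball x q \<subseteq> Y" using Y open_contains_cball by blast
  then show "\<exists>r>0. \<exists>C. C-lipschitz_on (cball x r \<inter> X) f"
    using r by (intro exI[of _ "min r q"] conjI exI[of _ C]) (auto elim!: lipschitz_on_subset)
qed

lemma loc_lipschitz_compose:
  assumes f: "loc_lipschitz X f" and g: "loc_lipschitz Y g" and "f ` X \<subseteq> Y"
  shows "loc_lipschitz X (\<lambda>x. g (f x))"
  unfolding loc_lipschitz_iff
proof
  fix x assume x: "x \<in> X"
  obtain r C where r: "r > 0" "C-lipschitz_on (cball x r \<inter> X) f"
    using f x unfolding loc_lipschitz_iff by blast
  obtain q D where q: "q > 0" "D-lipschitz_on (cball (f x) q \<inter> Y) g"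
    using g x assms(3) unfolding loc_lipschitz_iff by blast
  obtain d where d: "d > 0" "\<And>y. y \<in> X \<Longrightarrow> dist y x < d \<Longrightarrow> dist (f y) (f x) < q"
    using loc_lipschitz_continuous_on[OF f] x q(1) unfolding continuous_on_iff by metis
  define \<rho> where "\<rho> = min r (d / 2)"
  have "C-lipschitz_on (cball x \<rho> \<inter> X) f"
    by (rule lipschitz_on_subset[OF r(2)]) (auto simp: \<rho>_def)
  moreover have "f ` (cball x \<rho> \<inter> X) \<subseteq> cball (f x) q \<inter> Y"
  proof clarify
    fix y assume y: "y \<in> cball x \<rho>" "y \<in> X"
    then have "dist y x < d" using d(1) by (auto simp: \<rho>_def dist_commute)
    then show "f y \<in> cball (f x) q \<inter> Y"
      using d(2)[of y] y assms(3) by (auto simp: dist_commute)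
  qed
  then have "D-lipschitz_on (f ` (cball x \<rho> \<inter> X)) g" by (rule lipschitz_on_subset[OF q(2)])
  ultimately have "(D * C)-lipschitz_on (cball x \<rho> \<inter> X) (\<lambda>x. g (f x))"
    by (rule lipschitz_on_compose2)
  moreover have "\<rho> > 0" using r d by (simp add: \<rho>_def)
  ultimately show "\<exists>r>0. \<exists>C. C-lipschitz_on (cball x r \<inter> X) (\<lambda>x. g (f x))" by blast
qed

lemma loc_lipschitz_common_nbhd:
  assumes "loc_lipschitz X f" "loc_lipschitz X g" "x \<in> X"
  obtains r C D where "r > 0" "C-lipschitz_on (cball x r \<inter> X) f" "D-lipschitz_on (cball x r \<inter> X) g"
proof -
  obtain r q C D where "r > 0" "C-lipschitz_on (cball x r \<inter> X) f"
      "q > 0" "D-lipschitz_on (cball x q \<inter> X) g"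
    using assms unfolding loc_lipschitz_iff by meson
  moreover have "cball x (min r q) \<inter> X \<subseteq> cball x r \<inter> X" "cball x (min r q) \<inter> X \<subseteq> cball x q \<inter> X"
    by auto
  ultimately show thesis
    using that[of "min r q" C D] lipschitz_on_subset by (metis min_less_iff_conj)
qed

lemma loc_lipschitz_add:
  fixes f g :: "'a::metric_space \<Rightarrow> 'b::real_normed_vector"
  assumes "loc_lipschitz X f" "loc_lipschitz X g"
  shows "loc_lipschitz X (\<lambda>x. f x + g x)"
  unfolding loc_lipschitz_iff
proof
  fix x assume "x \<in> X"
  then obtain r C D where "r > 0" "C-lipschitz_on (cball x r \<inter> X) f"
    "D-lipschitz_on (cball x r \<inter> X) g"
    by (rule loc_lipschitz_common_nbhd[OF assms])
  then show "\<exists>r>0. \<exists>C. C-lipschitz_on (cball x r \<inter> X) (\<lambda>x. f x + g x)"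
    using lipschitz_on_add by blast
qed

lemma loc_lipschitz_mult:
  fixes f g :: "'a::heine_borel \<Rightarrow> real"
  assumes "loc_lipschitz X f" "loc_lipschitz X g"
  shows "loc_lipschitz X (\<lambda>x. f x * g x)"
  unfolding loc_lipschitz_iff
proof
  fix x assume "x \<in> X"
  then obtain r C D where r: "r > 0"
    and f: "C-lipschitz_on (cball x r \<inter> X) f" and g: "D-lipschitz_on (cball x r \<inter> X) g"
    by (rule loc_lipschitz_common_nbhd[OF assms])
  have b: "bounded (cball x r \<inter> X)" by (rule bounded_subset[OF bounded_cball Int_lower1])
  from r show "\<exists>r>0. \<exists>C. C-lipschitz_on (cball x r \<inter> X) (\<lambda>x. f x * g x)"
    using lipschitz_on_mult_bounded[OF f g lipschitz_on_bounded_image[OF f b]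
        lipschitz_on_bounded_image[OF g b]]
    by blast
qed

lemma loc_lipschitz_sum:
  fixes f :: "'i \<Rightarrow> 'a::metric_space \<Rightarrow> 'b::real_normed_vector"
  shows "(\<And>i. i \<in> I \<Longrightarrow> loc_lipschitz X (f i)) \<Longrightarrow> loc_lipschitz X (\<lambda>x. \<Sum>i\<in>I. f i x)"
  by (induction I rule: infinite_finite_induct)
    (auto intro: loc_lipschitz_add loc_lipschitz_const)

lemma loc_lipschitz_max:
  fixes f g :: "'a::metric_space \<Rightarrow> real"
  assumes "loc_lipschitz X f" "loc_lipschitz X g"
  shows "loc_lipschitz X (\<lambda>x. max (f x) (g x))"
  unfolding loc_lipschitz_iff
proof
  fix x assume "x \<in> X"
  then obtain r C D where r: "r > 0" "C-lipschitz_on (cball x r \<inter> X) f"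
    "D-lipschitz_on (cball x r \<inter> X) g"
    by (rule loc_lipschitz_common_nbhd[OF assms])
  then have "(max C D)-lipschitz_on (cball x r \<inter> X) (\<lambda>x. max (f x) (g x))"
    by (intro lipschitz_on_max) (auto elim: lipschitz_on_le)
  then show "\<exists>r>0. \<exists>C. C-lipschitz_on (cball x r \<inter> X) (\<lambda>x. max (f x) (g x))" using r(1) by blast
qed

lemma loc_lipschitz_min:
  fixes f g :: "'a::heine_borel \<Rightarrow> real"
  assumes "loc_lipschitz X f" "loc_lipschitz X g"
  shows "loc_lipschitz X (\<lambda>x. min (f x) (g x))"
proof -
  have minus: "loc_lipschitz X (\<lambda>x. - 1 * h x)" if "loc_lipschitz X h" for h :: "'a \<Rightarrow> real"
    by (rule loc_lipschitz_mult[OF loc_lipschitz_const that])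
  show ?thesis
    using minus[OF loc_lipschitz_max[OF minus[OF assms(1)] minus[OF assms(2)]]]
    by (rule loc_lipschitz_cong) auto
qed

definition compact_support_in :: "'a::topological_space set \<Rightarrow> ('a \<Rightarrow> 'b::zero) \<Rightarrow> bool" where
  "compact_support_in U f \<longleftrightarrow> (\<exists>K. compact K \<and> K \<subseteq> U \<and> (\<forall>x. x \<notin> K \<longrightarrow> f x = 0))"

lemma compact_support_inE:
  assumes "compact_support_in U f"
  obtains K where "compact K" "K \<subseteq> U" "\<And>x. x \<notin> K \<Longrightarrow> f x = 0"
  using assms unfolding compact_support_in_def by blast

lemma compact_cball_nbhd:
  fixes K :: "'a::euclidean_space set"
  assumes "compact K" "open U" "K \<subseteq> U"
  obtains e where "e > 0" "compact (\<Union>x\<in>K. cball x e)" "(\<Union>x\<in>K. cball x e) \<subseteq> U"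
  by (metis assms compact_minkowski_sum_cball compact_subset_open_imp_cball_epsilon_subset)

lemma lipschitz_on_UNIV_if_zero_outside:
  fixes f :: "'a::metric_space \<Rightarrow> real"
  assumes C: "C-lipschitz_on (\<Union>x\<in>K. cball x e) f" and "e > 0"
    and B: "\<And>x. \<bar>f x\<bar> \<le> B" and zero: "\<And>x. x \<notin> K \<Longrightarrow> f x = 0"
  shows "(C + B / e)-lipschitz_on UNIV f"
proof (rule lipschitz_onI)
  have "B \<ge> 0" using B[of undefined] by linarith
  note nonneg = \<open>e > 0\<close> \<open>B \<ge> 0\<close> lipschitz_on_nonneg[OF C]
  have from_K: "dist (f x) (f y) \<le> (C + B / e) * dist x y" if x: "x \<in> K" for x y
  proof (cases "y \<in> K \<or> dist x y \<le> e")
    case True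
    then have "x \<in> (\<Union>x\<in>K. cball x e)" "y \<in> (\<Union>x\<in>K. cball x e)" using x \<open>e > 0\<close> by force+
    then have "dist (f x) (f y) \<le> C * dist x y" by (rule lipschitz_onD[OF C])
    also have "\<dots> \<le> (C + B / e) * dist x y" using nonneg by (intro mult_right_mono) auto
    finally show ?thesis .
  next
    case False
    then have "dist (f x) (f y) \<le> B" using zero[of y] B[of x] by (simp add: dist_real_def)
    also have "\<dots> = B / e * e" using \<open>e > 0\<close> by simp
    also have "\<dots> \<le> (C + B / e) * dist x y" using False nonneg by (intro mult_mono) auto
    finally show ?thesis .
  qed
  fix x y
  consider (left) "x \<in> K" | (right) "y \<in> K" | (outside) "x \<notin> K" "y \<notin> K" by blast
  then show "dist (f x) (f y) \<le> (C + B / e) * dist x y"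
  proof cases
    case left
    then show ?thesis by (rule from_K)
  next
    case right
    then show ?thesis using from_K[of y x] by (simp add: dist_commute)
  next
    case outside
    then show ?thesis using zero nonneg by simp
  qed
qed (use \<open>e > 0\<close> B[of undefined] lipschitz_on_nonneg[OF C] in auto)

lemma loc_lipschitz_compact_support:
  fixes f :: "'a::euclidean_space \<Rightarrow> real"
  assumes "open U" "loc_lipschitz U f" "compact_support_in U f"
  obtains C where "C-lipschitz_on UNIV f"
proof -
  obtain K where K: "compact K" "K \<subseteq> U" "\<And>x. x \<notin> K \<Longrightarrow> f x = 0"
    using assms(3) by (rule compact_support_inE) blast
  obtain e where e: "e > 0" "compact (\<Union>x\<in>K. cball x e)" "(\<Union>x\<in>K. cball x e) \<subseteq> U"
    by (rule compact_cball_nbhd[OF K(1) assms(1) K(2)])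
  obtain C where C: "C-lipschitz_on (\<Union>x\<in>K. cball x e) f"
    by (rule loc_lipschitz_compact[OF assms(2) e(2,3)])
  have "bounded (f ` K)"
    using K continuous_on_subset[OF loc_lipschitz_continuous_on[OF assms(2)]]
    by (intro compact_imp_bounded compact_continuous_image) auto
  then obtain B where B: "B > 0" "\<And>x. x \<in> K \<Longrightarrow> \<bar>f x\<bar> \<le> B" unfolding bounded_pos by auto
  then have "\<bar>f x\<bar> \<le> B" for x using K(3) by (cases "x \<in> K") auto
  then show thesis by (rule that[OF lipschitz_on_UNIV_if_zero_outside[OF C e(1) _ K(3)]])
qed

section \<open>Integrals over open sets\<close>

lemma lebesgue_on_AE_iff:
  "U \<in> sets lebesgue \<Longrightarrow> (AE x in lebesgue_on U. P x) \<longleftrightarrow> (AE x in lebesgue. x \<in> U \<longrightarrow> P x)"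
  by (simp add: AE_restrict_space_iff)

lemma AE_not_negligible: "negligible N \<Longrightarrow> AE x in lebesgue. x \<notin> N"
  by (simp add: AE_not_in negligible_iff_null_sets)

lemma lebesgue_on_AE_subset:
  assumes "AE x in lebesgue_on U. P x" "V \<subseteq> U" "U \<in> sets lebesgue" "V \<in> sets lebesgue"
  shows "AE x in lebesgue_on V. P x"
  using assms by (auto simp: lebesgue_on_AE_iff elim: eventually_mono)

lemma borel_measurable_lebesgue_on_cong_AE:
  fixes f g :: "'a::euclidean_space \<Rightarrow> 'b::euclidean_space"
  assumes U: "U \<in> sets lebesgue" and "f \<in> borel_measurable (lebesgue_on U)"
    "AE x in lebesgue_on U. f x = g x"
  shows "g \<in> borel_measurable (lebesgue_on U)"
proof -
  have "AE x in lebesgue. indicator U x *\<^sub>R f x = indicator U x *\<^sub>R g x"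
    using assms(3)[unfolded lebesgue_on_AE_iff[OF U]] by eventually_elim (auto simp: indicator_def)
  moreover have "(\<lambda>x. indicator U x *\<^sub>R f x) \<in> borel_measurable lebesgue"
    using assms(1,2) by (simp add: borel_measurable_restrict_space_iff)
  ultimately have "(\<lambda>x. indicator U x *\<^sub>R g x) \<in> borel_measurable lebesgue"
    by (rule borel_measurable_AE[rotated])
  then show ?thesis using U by (simp add: borel_measurable_restrict_space_iff)
qed

lemma integrable_lebesgue_on_cong_AE:
  fixes f g :: "'a::euclidean_space \<Rightarrow> 'b::euclidean_space"
  assumes "U \<in> sets lebesgue" "integrable (lebesgue_on U) f" "AE x in lebesgue_on U. f x = g x"
  shows "integrable (lebesgue_on U) g" "integral\<^sup>L (lebesgue_on U) g = integral\<^sup>L (lebesgue_on U) f"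
proof -
  have f: "f \<in> borel_measurable (lebesgue_on U)" using assms(2) by simp
  note g = borel_measurable_lebesgue_on_cong_AE[OF assms(1) f assms(3)]
  show "integrable (lebesgue_on U) g" using integrable_cong_AE[OF f g assms(3)] assms(2) by simp
  show "integral\<^sup>L (lebesgue_on U) g = integral\<^sup>L (lebesgue_on U) f"
    using integral_cong_AE[OF f g assms(3)] by simp
qed

lemma lebesgue_on_supported:
  fixes f :: "'a::euclidean_space \<Rightarrow> 'b::euclidean_space"
  assumes "U \<in> sets lebesgue" "\<And>x. x \<notin> U \<Longrightarrow> f x = 0"
  shows "integrable (lebesgue_on U) f \<longleftrightarrow> integrable lebesgue f"
    and "integral\<^sup>L (lebesgue_on U) f = integral\<^sup>L lebesgue f"
proof -
  have "(\<lambda>x. indicator U x *\<^sub>R f x) = f" using assms(2) by (auto simp: indicator_def fun_eq_iff)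
  then show "integrable (lebesgue_on U) f \<longleftrightarrow> integrable lebesgue f"
    "integral\<^sup>L (lebesgue_on U) f = integral\<^sup>L lebesgue f"
    using assms(1) by (simp_all add: integrable_restrict_space integral_restrict_space)
qed

context
  fixes U \<Omega> :: "'a::euclidean_space set"
  assumes sets: "U \<in> sets lebesgue" "\<Omega> \<in> sets lebesgue"
    and sub: "U \<subseteq> \<Omega>" and neg: "negligible (\<Omega> - U)"
begin

lemma lebesgue_on_negligible_AE:
  "(AE x in lebesgue_on U. P x) \<longleftrightarrow> (AE x in lebesgue_on \<Omega>. P x)"
proof -
  have N: "AE x in lebesgue. x \<notin> \<Omega> - U" by (rule AE_not_negligible[OF neg])
  have "AE x in lebesgue. x \<in> \<Omega> \<longrightarrow> P x" if "AE x in lebesgue. x \<in> U \<longrightarrow> P x"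
    using that N by eventually_elim auto
  moreover have "AE x in lebesgue. x \<in> U \<longrightarrow> P x" if "AE x in lebesgue. x \<in> \<Omega> \<longrightarrow> P x"
    using that by eventually_elim (use sub in auto)
  ultimately show ?thesis
    unfolding lebesgue_on_AE_iff[OF sets(1)] lebesgue_on_AE_iff[OF sets(2)] by blast
qed

lemma lebesgue_on_negligible_indicator:
  "AE x in lebesgue. indicator U x *\<^sub>R f x = indicator \<Omega> x *\<^sub>R (f x :: 'b::euclidean_space)"
proof -
  from AE_not_negligible[OF neg] show ?thesis
    by eventually_elim (use sub in \<open>auto simp: indicator_def\<close>)
qed

lemma lebesgue_on_negligible_measurable:
  fixes f :: "'a \<Rightarrow> 'b::euclidean_space"
  shows "f \<in> borel_measurable (lebesgue_on U) \<longleftrightarrow> f \<in> borel_measurable (lebesgue_on \<Omega>)"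
proof -
  note ind = lebesgue_on_negligible_indicator[of f]
  have "(\<lambda>x. indicator U x *\<^sub>R f x) \<in> borel_measurable lebesgue \<longleftrightarrow>
      (\<lambda>x. indicator \<Omega> x *\<^sub>R f x) \<in> borel_measurable lebesgue"
    by (rule iffI; erule borel_measurable_AE[OF _ ind]
        borel_measurable_AE[OF _ AE_symmetric[OF ind]])
  then show ?thesis using sets by (simp add: borel_measurable_restrict_space_iff)
qed

lemma lebesgue_on_negligible_integral:
  fixes f :: "'a \<Rightarrow> 'b::euclidean_space"
  shows "integrable (lebesgue_on U) f \<longleftrightarrow> integrable (lebesgue_on \<Omega>) f"
    and "integral\<^sup>L (lebesgue_on U) f = integral\<^sup>L (lebesgue_on \<Omega>) f"
proof -
  note ind = lebesgue_on_negligible_indicator[of f]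
  have measurable_iff: "(\<lambda>x. indicator U x *\<^sub>R f x) \<in> borel_measurable lebesgue \<longleftrightarrow>
      (\<lambda>x. indicator \<Omega> x *\<^sub>R f x) \<in> borel_measurable lebesgue"
    using lebesgue_on_negligible_measurable[of f] sets
    by (simp add: borel_measurable_restrict_space_iff)
  have integrable_iff: "integrable lebesgue (\<lambda>x. indicator U x *\<^sub>R f x) \<longleftrightarrow>
      integrable lebesgue (\<lambda>x. indicator \<Omega> x *\<^sub>R f x)"
    using integrable_cong_AE[OF _ _ ind] measurable_iff borel_measurable_integrable by blast
  then show "integrable (lebesgue_on U) f \<longleftrightarrow> integrable (lebesgue_on \<Omega>) f"
    using sets by (simp add: integrable_restrict_space)
  have "integral\<^sup>L lebesgue (\<lambda>x. indicator U x *\<^sub>R f x) =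
      integral\<^sup>L lebesgue (\<lambda>x. indicator \<Omega> x *\<^sub>R f x)"
    using integral_cong_AE[OF _ _ ind] measurable_iff integrable_iff not_integrable_integral_eq
        borel_measurable_integrable
    by metis
  then show "integral\<^sup>L (lebesgue_on U) f = integral\<^sup>L (lebesgue_on \<Omega>) f"
    using sets by (simp add: integral_restrict_space)
qed

end

lemma borel_measurable_continuous_lebesgue_on:
  fixes f :: "'a::euclidean_space \<Rightarrow> 'b::euclidean_space"
  assumes "continuous_on UNIV f" "open U"
  shows "f \<in> borel_measurable (lebesgue_on U)"
  by (rule continuous_imp_measurable_on_sets_lebesgue[OF continuous_on_subset[OF assms(1)]])
    (use assms(2) in auto)

lemma integrable_continuous_mult:
  fixes f g :: "'a::euclidean_space \<Rightarrow> real"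
  assumes U: "open U" and f: "continuous_on U f" and K: "compact K" "K \<subseteq> U"
    and g: "integrable (lebesgue_on U) g" "AE x in lebesgue_on U. x \<notin> K \<longrightarrow> g x = 0"
  shows "integrable (lebesgue_on U) (\<lambda>x. f x * g x)"
proof -
  have "bounded (f ` K)"
    using continuous_on_subset[OF f K(2)] K(1)
    by (intro compact_imp_bounded compact_continuous_image)
  then obtain B where B: "\<And>x. x \<in> K \<Longrightarrow> \<bar>f x\<bar> \<le> B" unfolding bounded_iff by auto
  have [measurable]: "f \<in> borel_measurable (lebesgue_on U)" "g \<in> borel_measurable (lebesgue_on U)"
    using g(1) U f by (auto intro: continuous_imp_measurable_on_sets_lebesgue)
  show ?thesis
  proof (rule Bochner_Integration.integrable_bound)
    show "integrable (lebesgue_on U) (\<lambda>x. B * g x)" using g(1) by simp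
    show "AE x in lebesgue_on U. norm (f x * g x) \<le> norm (B * g x)"
      using g(2)
    proof eventually_elim
      case (elim x)
      show ?case
      proof (cases "x \<in> K")
        case True
        then have "\<bar>f x\<bar> \<le> \<bar>B\<bar>" using B by fastforce
        then show ?thesis by (auto simp: abs_mult intro: mult_right_mono)
      qed (use elim in simp)
    qed
  qed measurable
qed

lemma integrable_bounded_compact_support:
  fixes f :: "'a::euclidean_space \<Rightarrow> real"
  assumes U: "open U" and K: "compact K" "K \<subseteq> U"
    and f: "f \<in> borel_measurable (lebesgue_on U)" "AE x in lebesgue_on U. \<bar>f x\<bar> \<le> B * indicator K x"
  shows "integrable (lebesgue_on U) f"
proof (rule Bochner_Integration.integrable_bound[OF _ f(1)])
  have "integrable lebesgue (indicat_real K)"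
    using lmeasurable_compact[OF K(1)] by (simp add: lmeasurable_iff_integrable)
  moreover have "integrable (lebesgue_on U) (indicat_real K) \<longleftrightarrow> integrable lebesgue (indicat_real K)"
    using K(2) U by (intro lebesgue_on_supported) (auto simp: indicator_def)
  ultimately show "integrable (lebesgue_on U) (\<lambda>x. B * indicator K x)" by simp
  show "AE x in lebesgue_on U. norm (f x) \<le> norm (B * indicator K x)"
    using f(2) by eventually_elim auto
qed

section \<open>Gradients that exist almost everywhere\<close>

lemma GDERIV_unique: "GDERIV f x :> D \<Longrightarrow> GDERIV f x :> E \<Longrightarrow> D = E"
  unfolding gderiv_def using has_derivative_unique vector_eq_ldot by metis

lemma GDERIV_transform_open:
  assumes "GDERIV f x :> D" "open S" "x \<in> S" "\<And>y. y \<in> S \<Longrightarrow> f y = g y"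
  shows "GDERIV g x :> D"
  using assms unfolding gderiv_def by (metis has_derivative_transform_within_open)

lemma GDERIV_difference_quotient:
  fixes f :: "'a::real_inner \<Rightarrow> real"
  assumes "GDERIV f x :> D" "h \<longlonglongrightarrow> 0" "\<And>n. h n \<noteq> 0"
  shows "(\<lambda>n. (f (x + h n *\<^sub>R u) - f x) / h n) \<longlonglongrightarrow> D \<bullet> u"
proof -
  have line: "((\<lambda>t. x + t *\<^sub>R u) has_derivative (\<lambda>t. t *\<^sub>R u)) (at 0)"
    by (auto intro!: derivative_eq_intros)
  have "((\<lambda>t. f (x + t *\<^sub>R u)) has_derivative (\<lambda>t. (t *\<^sub>R u) \<bullet> D)) (at 0)"
    by (rule has_derivative_compose[OF line]) (use assms(1) in \<open>simp add: gderiv_def\<close>)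
  then have "((\<lambda>t. f (x + t *\<^sub>R u)) has_real_derivative D \<bullet> u) (at 0)"
    by (simp add: has_field_derivative_def inner_commute mult_commute_abs)
  then have "((\<lambda>t. (f (x + t *\<^sub>R u) - f x) / t) \<longlongrightarrow> D \<bullet> u) (at 0)" by (simp add: DERIV_def)
  moreover have "filterlim h (at 0) sequentially" using assms by (simp add: filterlim_at)
  ultimately show ?thesis by (rule filterlim_compose)
qed

lemma norm_GDERIV_le:
  fixes f :: "'a::real_inner \<Rightarrow> real"
  assumes "C-lipschitz_on UNIV f" "GDERIV f x :> D"
  shows "norm D \<le> C"
proof -
  let ?h = "\<lambda>n. 1 / real (Suc n)"
  have "(\<lambda>n. \<bar>(f (x + ?h n *\<^sub>R D) - f x) / ?h n\<bar>) \<longlonglongrightarrow> \<bar>D \<bullet> D\<bar>"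
    by (intro tendsto_rabs GDERIV_difference_quotient[OF assms(2)] LIMSEQ_Suc[OF lim_1_over_n]) simp
  moreover have "\<bar>(f (x + ?h n *\<^sub>R D) - f x) / ?h n\<bar> \<le> C * norm D" for n
  proof -
    have "\<bar>f (x + ?h n *\<^sub>R D) - f x\<bar> \<le> C * (?h n * norm D)"
      using lipschitz_onD[OF assms(1), of "x + ?h n *\<^sub>R D" x] by (simp add: dist_norm)
    moreover have "?h n > 0" by simp
    ultimately show ?thesis by (simp only: abs_divide abs_of_pos pos_divide_le_eq mult_ac)
  qed
  ultimately have "\<bar>D \<bullet> D\<bar> \<le> C * norm D" by (intro LIMSEQ_le_const2) auto
  then have "norm D * norm D \<le> C * norm D" by (simp add: dot_square_norm power2_eq_square)
  then show ?thesis using lipschitz_on_nonneg[OF assms(1)] by (cases "D = 0") auto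
qed

lemma C1_imp_loc_lipschitz:
  fixes f :: "'a::euclidean_space \<Rightarrow> real"
  assumes "open U" "\<And>x. x \<in> U \<Longrightarrow> GDERIV f x :> g x" "continuous_on U g"
  shows "loc_lipschitz U f"
  unfolding loc_lipschitz_iff
proof
  fix x assume "x \<in> U"
  then obtain r where r: "r > 0" "cball x r \<subseteq> U" using assms(1) open_contains_cball by blast
  have "bounded (g ` cball x r)"
    by (intro compact_imp_bounded compact_continuous_image continuous_on_subset[OF assms(3)] r
        compact_cball)
  then obtain B where B: "B > 0" "\<And>y. y \<in> cball x r \<Longrightarrow> norm (g y) \<le> B" unfolding bounded_pos by blast
  have "B-lipschitz_on (cball x r) f"
  proof (rule bounded_derivative_imp_lipschitz[OF _ convex_cball])
    fix y assume y: "y \<in> cball x r"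
    show "(f has_derivative (\<lambda>h. h \<bullet> g y)) (at y within cball x r)"
      using assms(2)[of y] y r unfolding gderiv_def by (blast intro: has_derivative_at_withinI)
    show "onorm (\<lambda>h. h \<bullet> g y) \<le> B"
    proof (rule onorm_le)
      fix h
      have "norm (h \<bullet> g y) \<le> norm h * norm (g y)" using Cauchy_Schwarz_ineq2 by simp
      also have "\<dots> \<le> B * norm h"
        using B(2)[OF y] by (metis mult.commute mult_left_mono norm_ge_zero)
      finally show "norm (h \<bullet> g y) \<le> B * norm h" .
    qed
  qed (use B(1) in simp)
  moreover have "cball x r \<inter> U = cball x r" using r(2) by blast
  ultimately show "\<exists>r>0. \<exists>C. C-lipschitz_on (cball x r \<inter> U) f" using r(1) by metis
qed

definition has_ae_gradient :: "'a::euclidean_space set \<Rightarrow> ('a \<Rightarrow> real) \<Rightarrow> ('a \<Rightarrow> 'a) \<Rightarrow> bool" where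
  "has_ae_gradient U f g \<longleftrightarrow> loc_lipschitz U f \<and> (AE x in lebesgue_on U. GDERIV f x :> g x)"

lemma has_ae_gradientD:
  assumes "has_ae_gradient U f g"
  shows "loc_lipschitz U f" "AE x in lebesgue_on U. GDERIV f x :> g x"
  using assms by (auto simp: has_ae_gradient_def)

lemma has_ae_gradient_C1:
  assumes "open U" "\<And>x. x \<in> U \<Longrightarrow> GDERIV f x :> g x" "continuous_on U g"
  shows "has_ae_gradient U f g"
  using C1_imp_loc_lipschitz[OF assms] assms by (auto simp: has_ae_gradient_def lebesgue_on_AE_iff)

lemma has_ae_gradient_subset:
  assumes "has_ae_gradient U f g" "V \<subseteq> U" "open U" "open V"
  shows "has_ae_gradient V f g"
  using has_ae_gradientD[OF assms(1)] loc_lipschitz_subset[OF _ assms(2)]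
    lebesgue_on_AE_subset[OF _ assms(2)] assms(3,4)
  by (auto simp: has_ae_gradient_def)

lemma has_ae_gradient_add:
  assumes "has_ae_gradient U f f'" "has_ae_gradient U g g'"
  shows "has_ae_gradient U (\<lambda>x. f x + g x) (\<lambda>x. f' x + g' x)"
proof -
  have "AE x in lebesgue_on U. GDERIV (\<lambda>x. f x + g x) x :> f' x + g' x"
    using has_ae_gradientD(2)[OF assms(1)] has_ae_gradientD(2)[OF assms(2)]
    by eventually_elim (rule GDERIV_add)
  then show ?thesis using assms by (simp add: has_ae_gradient_def loc_lipschitz_add)
qed

lemma has_ae_gradient_mult:
  assumes "has_ae_gradient U f f'" "has_ae_gradient U g g'"
  shows "has_ae_gradient U (\<lambda>x. f x * g x) (\<lambda>x. f x *\<^sub>R g' x + g x *\<^sub>R f' x)"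
proof -
  have "AE x in lebesgue_on U. GDERIV (\<lambda>x. f x * g x) x :> f x *\<^sub>R g' x + g x *\<^sub>R f' x"
    using has_ae_gradientD(2)[OF assms(1)] has_ae_gradientD(2)[OF assms(2)]
    by eventually_elim (rule GDERIV_mult)
  then show ?thesis using assms by (simp add: has_ae_gradient_def loc_lipschitz_mult)
qed

lemma has_ae_gradient_const: "has_ae_gradient U (\<lambda>x. c) (\<lambda>x. 0)"
  by (simp add: has_ae_gradient_def GDERIV_const loc_lipschitz_const)

lemma has_ae_gradient_cmult:
  "has_ae_gradient U f g \<Longrightarrow> has_ae_gradient U (\<lambda>x. c * f x) (\<lambda>x. c *\<^sub>R g x)"
  using has_ae_gradient_mult[OF has_ae_gradient_const[of U c], of f g] by simp

lemma has_ae_gradient_sum: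
  "(\<And>i. i \<in> I \<Longrightarrow> has_ae_gradient U (f i) (g i)) \<Longrightarrow>
     has_ae_gradient U (\<lambda>x. \<Sum>i\<in>I. f i x) (\<lambda>x. \<Sum>i\<in>I. g i x)"
  by (induction I rule: infinite_finite_induct)
    (auto intro: has_ae_gradient_add has_ae_gradient_const)

lemma has_ae_gradient_inner: "open U \<Longrightarrow> has_ae_gradient U (\<lambda>x. x \<bullet> b) (\<lambda>x. b)"
  by (rule has_ae_gradient_C1) (auto simp: gderiv_def intro!: derivative_eq_intros)

lemma has_ae_gradient_extend_zero:
  assumes "open U" "has_ae_gradient U f g" "compact_support_in U f"
  shows "has_ae_gradient UNIV f (\<lambda>x. if x \<in> U then g x else 0)"
proof -
  obtain K where K: "compact K" "K \<subseteq> U" "\<And>x. x \<notin> K \<Longrightarrow> f x = 0"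
    using assms(3) by (rule compact_support_inE) blast
  have out: "GDERIV f x :> 0" if "x \<notin> K" for x
    by (rule GDERIV_transform_open[OF GDERIV_const[of 0], of "- K"])
      (use K that in \<open>auto simp: compact_imp_closed open_Compl\<close>)
  have "AE x in lebesgue. x \<in> U \<longrightarrow> GDERIV f x :> g x"
    using has_ae_gradientD(2)[OF assms(2)] assms(1) by (simp add: lebesgue_on_AE_iff)
  then have "AE x in lebesgue_on UNIV. GDERIV f x :> (if x \<in> U then g x else 0)"
    unfolding lebesgue_on_UNIV_eq
    by eventually_elim (use K(2) out in auto)
  moreover obtain C where "C-lipschitz_on UNIV f"
    by (rule loc_lipschitz_compact_support[OF assms(1) has_ae_gradientD(1)[OF assms(2)] assms(3)])
  ultimately show ?thesis by (simp add: has_ae_gradient_def lipschitz_on_imp_loc_lipschitz)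
qed

lemma gradient_zero_off_support:
  assumes "open U" "has_ae_gradient U f g" "compact K" "\<And>x. x \<notin> K \<Longrightarrow> f x = 0"
  shows "AE x in lebesgue_on U. x \<notin> K \<longrightarrow> g x = 0"
  using has_ae_gradientD(2)[OF assms(2)]
proof eventually_elim
  case (elim x)
  show ?case
  proof
    assume "x \<notin> K"
    then have "GDERIV f x :> 0"
      using assms by (intro GDERIV_transform_open[OF GDERIV_const[of 0], of "- K"])
        (auto simp: compact_imp_closed open_Compl)
    then show "g x = 0" by (rule GDERIV_unique[OF elim])
  qed
qed

section \<open>Integration by parts for Lipschitz functions\<close>

lemma integral_translate_lborel:
  fixes f :: "'a::euclidean_space \<Rightarrow> real"
  assumes [measurable]: "f \<in> borel_measurable borel"
  shows "(LINT x|lborel. f (x + c)) = (LINT x|lborel. f x)"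
  using integral_distr[of "(+) c" lborel borel f] by (simp add: lborel_distr_plus add.commute)

text \<open>By translation invariance the formula is exact for difference quotients.\<close>

lemma discrete_integration_by_parts:
  fixes \<psi> \<alpha> :: "'a::euclidean_space \<Rightarrow> real"
  assumes [measurable]: "\<psi> \<in> borel_measurable borel" "\<alpha> \<in> borel_measurable borel"
    and int: "\<And>a b. integrable lborel (\<lambda>x. \<psi> (x + a) * \<alpha> (x + b))"
  shows "(LINT x|lborel. (\<psi> (x + u) - \<psi> x) * (\<alpha> (x + v) - \<alpha> x)) =
         (LINT x|lborel. (\<psi> (x - v) - \<psi> x) * (\<alpha> (x - u) - \<alpha> x))"
proof -
  define T where "T c = (LINT x|lborel. \<psi> x * \<alpha> (x + c))" for c
  have shift: "(LINT x|lborel. \<psi> (x + a) * \<alpha> (x + b)) = T (b - a)" for a b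
    unfolding T_def using integral_translate_lborel[of "\<lambda>x. \<psi> x * \<alpha> (x + (b - a))" a] by simp
  have expand: "(LINT x|lborel. (\<psi> (x + a) - \<psi> x) * (\<alpha> (x + b) - \<alpha> x)) =
      T (b - a) - T (- a) - T b + T 0" for a b
  proof -
    have "(LINT x|lborel. (\<psi> (x + a) - \<psi> x) * (\<alpha> (x + b) - \<alpha> x)) =
      (LINT x|lborel. \<psi> (x + a) * \<alpha> (x + b) - \<psi> (x + a) * \<alpha> (x + 0)
        - \<psi> (x + 0) * \<alpha> (x + b) + \<psi> (x + 0) * \<alpha> (x + 0))"
      by (simp add: algebra_simps)
    also have "\<dots> = T (b - a) - T (0 - a) - T (b - 0) + T (0 - 0)"
      by (simp only: Bochner_Integration.integral_add Bochner_Integration.integral_diff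
          Bochner_Integration.integrable_diff int shift)
    finally show ?thesis by simp
  qed
  show ?thesis using expand[of u v] expand[of "- v" "- u"] by simp
qed

context
  fixes \<psi> \<alpha> :: "'a::euclidean_space \<Rightarrow> real" and \<psi>' \<alpha>' :: "'a \<Rightarrow> 'a" and C D :: real and K :: "'a set"
  assumes \<psi>: "C-lipschitz_on UNIV \<psi>" and \<alpha>: "D-lipschitz_on UNIV \<alpha>"
    and K: "compact K" and supp: "\<And>x. x \<notin> K \<Longrightarrow> \<psi> x = 0"
    and d\<psi>: "AE x in lebesgue. GDERIV \<psi> x :> \<psi>' x"
    and d\<alpha>: "AE x in lebesgue. x \<in> K \<longrightarrow> GDERIV \<alpha> x :> \<alpha>' x"
begin

lemma continuous_factors: "continuous_on UNIV \<psi>" "continuous_on UNIV \<alpha>"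
  using \<psi> \<alpha> by (auto intro: lipschitz_on_continuous_on)

lemma borel_measurable_factors [measurable]:
  "\<psi> \<in> borel_measurable borel" "\<alpha> \<in> borel_measurable borel"
  using continuous_factors by (auto intro: borel_measurable_continuous_onI)

lemma integrable_translates: "integrable lborel (\<lambda>x. \<psi> (x + a) * \<alpha> (x + b))"
proof -
  let ?K = "(\<lambda>x. x - a) ` K"
  have cont: "continuous_on UNIV (\<lambda>x. f (x + c))" if "continuous_on UNIV f"
    for f :: "'a \<Rightarrow> real" and c
    by (rule continuous_on_compose2[OF that]) (auto intro: continuous_intros)
  have "integrable lborel (\<lambda>x. indicator ?K x *\<^sub>R (\<psi> (x + a) * \<alpha> (x + b)))"
    using continuous_on_subset[OF cont[OF continuous_factors(1)]]
        continuous_on_subset[OF cont[OF continuous_factors(2)]]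
    by (intro borel_integrable_compact compact_continuous_image K continuous_intros) auto
  moreover have "indicator ?K x *\<^sub>R (\<psi> (x + a) * \<alpha> (x + b)) = \<psi> (x + a) * \<alpha> (x + b)" for x
  proof (cases "x \<in> ?K")
    case False
    then have "x + a \<notin> K" by (metis add_diff_cancel imageI)
    then show ?thesis using supp by simp
  qed simp
  ultimately show ?thesis by (simp only:)
qed

definition quotient_product :: "real \<Rightarrow> 'a \<Rightarrow> 'a \<Rightarrow> 'a \<Rightarrow> real" where
  "quotient_product h u v x = (\<psi> (x + h *\<^sub>R u) - \<psi> x) / h * ((\<alpha> (x + h *\<^sub>R v) - \<alpha> x) / h)"

lemma borel_measurable_quotient_product [measurable]:
  "quotient_product h u v \<in> borel_measurable borel"
  unfolding quotient_product_def[abs_def] by measurable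

lemma quotient_product_tendsto:
  assumes h: "h \<longlonglongrightarrow> 0" "\<And>n. h n \<noteq> 0"
  shows "AE x in lebesgue. (\<lambda>n. quotient_product (h n) u v x) \<longlonglongrightarrow> (\<psi>' x \<bullet> u) * (\<alpha>' x \<bullet> v)"
  using d\<psi> d\<alpha>
proof eventually_elim
  case (elim x)
  have quot\<psi>: "(\<lambda>n. (\<psi> (x + h n *\<^sub>R u) - \<psi> x) / h n) \<longlonglongrightarrow> \<psi>' x \<bullet> u"
    by (rule GDERIV_difference_quotient[OF elim(1) h])
  show ?case
  proof (cases "x \<in> K")
    case True
    then show ?thesis unfolding quotient_product_def
      using elim(2) by (intro tendsto_mult quot\<psi> GDERIV_difference_quotient h) blast
  next
    case False
    have "(\<lambda>n. x + h n *\<^sub>R u) \<longlonglongrightarrow> x + 0 *\<^sub>R u" by (intro tendsto_intros h)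
    then have "\<forall>\<^sub>F n in sequentially. x + h n *\<^sub>R u \<in> - K"
      using False K by (intro topological_tendstoD) (auto simp: compact_imp_closed open_Compl)
    then have zero: "\<forall>\<^sub>F n in sequentially. (\<psi> (x + h n *\<^sub>R u) - \<psi> x) / h n = 0"
      by eventually_elim (use supp False in simp)
    have "\<psi>' x \<bullet> u = 0"
      using LIMSEQ_unique[OF quot\<psi> tendsto_eventually[OF zero]] .
    moreover have "\<forall>\<^sub>F n in sequentially. quotient_product (h n) u v x = 0"
      using zero by eventually_elim (simp only: quotient_product_def mult_zero_left)
    ultimately show ?thesis by (auto intro: tendsto_eventually)
  qed
qed

lemma quotient_product_bound:
  assumes h: "h \<noteq> 0" "\<bar>h\<bar> \<le> 1"
  shows "\<bar>quotient_product h u v x\<bar> \<le>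
      C * norm u * (D * norm v) * indicator (\<Union>x\<in>K. cball x (norm u)) x"
proof (cases "x \<in> (\<Union>x\<in>K. cball x (norm u))")
  case True
  have quot: "\<bar>(f (x + h *\<^sub>R w) - f x) / h\<bar> \<le> M * norm w" if "M-lipschitz_on UNIV f"
    for f :: "'a \<Rightarrow> real" and M w
    using lipschitz_onD[OF that, of "x + h *\<^sub>R w" x] h(1)
    by (simp add: dist_norm field_simps)
  have "\<bar>quotient_product h u v x\<bar> \<le> C * norm u * (D * norm v)"
    unfolding quotient_product_def abs_mult using lipschitz_on_nonneg[OF \<psi>]
    by (intro mult_mono quot \<psi> \<alpha>) auto
  then show ?thesis using True by simp
next
  case False
  have "x + h *\<^sub>R u \<notin> K"
  proof
    assume "x + h *\<^sub>R u \<in> K"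
    moreover have "dist (x + h *\<^sub>R u) x \<le> norm u"
      using h(2) mult_right_mono[of "\<bar>h\<bar>" 1 "norm u"] by (simp add: dist_norm)
    ultimately show False using False by auto
  qed
  moreover have "x \<notin> K" using False by auto
  ultimately show ?thesis using False supp by (simp add: quotient_product_def)
qed

lemma quotient_product_integral_tendsto:
  assumes h: "h \<longlonglongrightarrow> 0" "\<And>n. h n \<noteq> 0" "\<And>n. \<bar>h n\<bar> \<le> 1"
  shows "integrable lebesgue (\<lambda>x. (\<psi>' x \<bullet> u) * (\<alpha>' x \<bullet> v))"
    and "(\<lambda>n. LINT x|lborel. quotient_product (h n) u v x) \<longlonglongrightarrow>
        (LINT x|lebesgue. (\<psi>' x \<bullet> u) * (\<alpha>' x \<bullet> v))"
proof -
  let ?q = "\<lambda>n. quotient_product (h n) u v" and ?f = "\<lambda>x. (\<psi>' x \<bullet> u) * (\<alpha>' x \<bullet> v)"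
  let ?w = "\<lambda>x. C * norm u * (D * norm v) * indicator (\<Union>x\<in>K. cball x (norm u)) x"
  have K': "compact (\<Union>x\<in>K. cball x (norm u))" by (rule compact_minkowski_sum_cball[OF K])
  have lim: "AE x in lebesgue. (\<lambda>n. ?q n x) \<longlonglongrightarrow> ?f x" by (rule quotient_product_tendsto[OF h(1,2)])
  have q: "?q n \<in> borel_measurable lebesgue" for n by (rule measurable_completion) measurable
  have f: "?f \<in> borel_measurable lebesgue"
  proof (rule borel_measurable_AE)
    show "(\<lambda>x. lim (\<lambda>n. ?q n x)) \<in> borel_measurable lebesgue"
      using q by (rule borel_measurable_lim_metric)
    show "AE x in lebesgue. lim (\<lambda>n. ?q n x) = ?f x" using lim by eventually_elim (rule limI)
  qed
  have w: "integrable lebesgue ?w"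
    using lmeasurable_compact[OF K'] by (simp add: lmeasurable_iff_integrable)
  have bound: "AE x in lebesgue. norm (?q n x) \<le> ?w x" for n
    unfolding real_norm_def by (rule AE_I2) (rule quotient_product_bound[OF h(2,3)])
  show "integrable lebesgue ?f" by (rule integrable_dominated_convergence[OF f q w lim bound])
  have "(\<lambda>n. LINT x|lebesgue. ?q n x) \<longlonglongrightarrow> (LINT x|lebesgue. ?f x)"
    by (rule integral_dominated_convergence[OF f q w lim bound])
  then show "(\<lambda>n. LINT x|lborel. ?q n x) \<longlonglongrightarrow> (LINT x|lebesgue. ?f x)"
    by (simp add: integral_completion)
qed

lemma lipschitz_integration_by_parts:
  "integrable lebesgue (\<lambda>x. (\<psi>' x \<bullet> u) * (\<alpha>' x \<bullet> v))"
  "(LINT x|lebesgue. (\<psi>' x \<bullet> u) * (\<alpha>' x \<bullet> v)) = (LINT x|lebesgue. (\<psi>' x \<bullet> v) * (\<alpha>' x \<bullet> u))"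
proof -
  define h where "h n = 1 / real (Suc n)" for n
  have h: "h \<longlonglongrightarrow> 0" "h n \<noteq> 0" "\<bar>h n\<bar> \<le> 1" for n
    unfolding h_def by (auto intro: LIMSEQ_Suc[OF lim_1_over_n] simp del: of_nat_Suc)
  then have h': "(\<lambda>n. - h n) \<longlonglongrightarrow> 0" "- h n \<noteq> 0" "\<bar>- h n\<bar> \<le> 1" for n
    using tendsto_minus[OF h(1)] by auto
  show "integrable lebesgue (\<lambda>x. (\<psi>' x \<bullet> u) * (\<alpha>' x \<bullet> v))"
    by (rule quotient_product_integral_tendsto(1)[OF h])
  have "(LINT x|lborel. quotient_product (h n) u v x) =
      (LINT x|lborel. quotient_product (- h n) v u x)" for n
  proof -
    have "(LINT x|lborel. quotient_product (h n) u v x) =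
        (LINT x|lborel. (\<psi> (x + h n *\<^sub>R u) - \<psi> x) * (\<alpha> (x + h n *\<^sub>R v) - \<alpha> x)) / (h n)\<^sup>2"
      by (simp add: quotient_product_def power2_eq_square)
    also have "(LINT x|lborel. (\<psi> (x + h n *\<^sub>R u) - \<psi> x) * (\<alpha> (x + h n *\<^sub>R v) - \<alpha> x)) =
        (LINT x|lborel. (\<psi> (x - h n *\<^sub>R v) - \<psi> x) * (\<alpha> (x - h n *\<^sub>R u) - \<alpha> x))"
      by (intro discrete_integration_by_parts integrable_translates) measurable
    also have "\<dots> / (h n)\<^sup>2 = (LINT x|lborel. quotient_product (- h n) v u x)"
      by (simp add: quotient_product_def power2_eq_square)
    finally show ?thesis .
  qed
  then show "(LINT x|lebesgue. (\<psi>' x \<bullet> u) * (\<alpha>' x \<bullet> v)) =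
      (LINT x|lebesgue. (\<psi>' x \<bullet> v) * (\<alpha>' x \<bullet> u))"
    using quotient_product_integral_tendsto(2)[OF h, of u v]
        quotient_product_integral_tendsto(2)[OF h', of v u]
    by (simp add: LIMSEQ_unique)
qed

end

lemma has_ae_gradient_lipschitz_near_compact:
  assumes U: "open U" and f: "has_ae_gradient U f f'" and K: "compact K" "K \<subseteq> U"
  obtains D h where "D-lipschitz_on UNIV h" "AE x in lebesgue. x \<in> K \<longrightarrow> GDERIV h x :> f' x"
proof -
  obtain e where e: "e > 0" "compact (\<Union>x\<in>K. cball x e)" "(\<Union>x\<in>K. cball x e) \<subseteq> U"
    by (rule compact_cball_nbhd[OF K(1) U K(2)])
  obtain D where "D-lipschitz_on (\<Union>x\<in>K. cball x e) f"
    by (rule loc_lipschitz_compact[OF has_ae_gradientD(1)[OF f] e(2,3)])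
  then obtain h where h: "D-lipschitz_on UNIV h" "\<And>x. x \<in> (\<Union>x\<in>K. cball x e) \<Longrightarrow> h x = f x"
    by (rule lipschitz_on_extend) blast
  have "GDERIV h x :> f' x" if x: "x \<in> K" and D: "GDERIV f x :> f' x" for x
  proof (rule GDERIV_transform_open[OF D])
    show "f y = h y" if "y \<in> ball x e" for y
    proof (rule h(2)[symmetric])
      show "y \<in> (\<Union>x\<in>K. cball x e)" using that x by (intro UN_I[of x]) auto
    qed
  qed (use e(1) in auto)
  moreover have "AE x in lebesgue. x \<in> U \<longrightarrow> GDERIV f x :> f' x"
    using has_ae_gradientD(2)[OF f] U by (simp add: lebesgue_on_AE_iff)
  ultimately have "AE x in lebesgue. x \<in> K \<longrightarrow> GDERIV h x :> f' x"
    using K(2) by (auto elim!: eventually_mono)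
  then show thesis by (rule that[OF h(1)])
qed

lemma has_ae_gradient_integration_by_parts:
  assumes U: "open U" and \<psi>: "has_ae_gradient U \<psi> \<psi>'" and \<alpha>: "has_ae_gradient U \<alpha> \<alpha>'"
    and supp: "compact_support_in U \<psi>"
  shows "integrable (lebesgue_on U) (\<lambda>x. (\<psi>' x \<bullet> u) * (\<alpha>' x \<bullet> v))"
    and "(LINT x|lebesgue_on U. (\<psi>' x \<bullet> u) * (\<alpha>' x \<bullet> v)) =
        (LINT x|lebesgue_on U. (\<psi>' x \<bullet> v) * (\<alpha>' x \<bullet> u))"
proof -
  define \<Psi>' where "\<Psi>' x = (if x \<in> U then \<psi>' x else 0)" for x
  obtain K where K: "compact K" "K \<subseteq> U" "\<And>x. x \<notin> K \<Longrightarrow> \<psi> x = 0"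
    using supp by (rule compact_support_inE) blast
  obtain C where C: "C-lipschitz_on UNIV \<psi>"
    by (rule loc_lipschitz_compact_support[OF U has_ae_gradientD(1)[OF \<psi>] supp])
  obtain D \<beta> where \<beta>: "D-lipschitz_on UNIV \<beta>" "AE x in lebesgue. x \<in> K \<longrightarrow> GDERIV \<beta> x :> \<alpha>' x"
    by (rule has_ae_gradient_lipschitz_near_compact[OF U \<alpha> K(1,2)])
  have d\<psi>: "AE x in lebesgue. GDERIV \<psi> x :> \<Psi>' x"
    using has_ae_gradientD(2)[OF has_ae_gradient_extend_zero[OF U \<psi> supp]]
    unfolding lebesgue_on_UNIV_eq \<Psi>'_def .
  note ibp = lipschitz_integration_by_parts[OF C \<beta>(1) K(1,3) d\<psi> \<beta>(2)]
  have restrict: "integrable (lebesgue_on U) (\<lambda>x. (\<psi>' x \<bullet> a) * (\<alpha>' x \<bullet> b)) \<longleftrightarrow>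
        integrable lebesgue (\<lambda>x. (\<Psi>' x \<bullet> a) * (\<alpha>' x \<bullet> b))"
      "(LINT x|lebesgue_on U. (\<psi>' x \<bullet> a) * (\<alpha>' x \<bullet> b)) = (LINT x|lebesgue. (\<Psi>' x \<bullet> a) * (\<alpha>' x \<bullet> b))"
        for a b
  proof -
    have "(\<lambda>x. indicator U x *\<^sub>R ((\<psi>' x \<bullet> a) * (\<alpha>' x \<bullet> b))) = (\<lambda>x. (\<Psi>' x \<bullet> a) * (\<alpha>' x \<bullet> b))"
      by (auto simp: \<Psi>'_def indicator_def)
    then show "integrable (lebesgue_on U) (\<lambda>x. (\<psi>' x \<bullet> a) * (\<alpha>' x \<bullet> b)) \<longleftrightarrow>
        integrable lebesgue (\<lambda>x. (\<Psi>' x \<bullet> a) * (\<alpha>' x \<bullet> b))"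
      "(LINT x|lebesgue_on U. (\<psi>' x \<bullet> a) * (\<alpha>' x \<bullet> b)) = (LINT x|lebesgue. (\<Psi>' x \<bullet> a) * (\<alpha>' x \<bullet> b))"
      using U by (simp_all add: integrable_restrict_space integral_restrict_space)
  qed
  show "integrable (lebesgue_on U) (\<lambda>x. (\<psi>' x \<bullet> u) * (\<alpha>' x \<bullet> v))"
    unfolding restrict by (rule ibp(1))
  show "(LINT x|lebesgue_on U. (\<psi>' x \<bullet> u) * (\<alpha>' x \<bullet> v)) =
      (LINT x|lebesgue_on U. (\<psi>' x \<bullet> v) * (\<alpha>' x \<bullet> u))"
    unfolding restrict by (rule ibp(2))
qed

lemma has_ae_gradient_integral_eq_0:
  fixes \<psi> :: "'a::euclidean_space \<Rightarrow> real"
  assumes "open U" "has_ae_gradient U \<psi> \<psi>'" "compact_support_in U \<psi>" and dim: "2 \<le> DIM('a)"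
  shows "integrable (lebesgue_on U) (\<lambda>x. \<psi>' x \<bullet> u)" "(LINT x|lebesgue_on U. \<psi>' x \<bullet> u) = 0"
proof -
  obtain v where v: "v \<noteq> 0" "orthogonal u v" using orthogonal_to_vector_exists[OF dim] by blast
  note ibp = has_ae_gradient_integration_by_parts[OF assms(1,2)
      has_ae_gradient_inner[OF assms(1), of v] assms(3)]
  show "integrable (lebesgue_on U) (\<lambda>x. \<psi>' x \<bullet> u)"
    using ibp(1)[of u v] v(1) by simp
  have "(LINT x|lebesgue_on U. (\<psi>' x \<bullet> u)) * (v \<bullet> v) = 0"
    using ibp(2)[of u v] v(2) by (simp add: orthogonal_def inner_commute)
  then show "(LINT x|lebesgue_on U. \<psi>' x \<bullet> u) = 0" using v(1) by simp
qed

section \<open>Weak divergences\<close>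

text \<open>Testing with Lipschitz functions makes products with the cutoff functions below admissible.\<close>

definition weak_div :: "'a::euclidean_space set \<Rightarrow> ('a \<Rightarrow> 'a) \<Rightarrow> ('a \<Rightarrow> real) \<Rightarrow> bool" where
  "weak_div U V w \<longleftrightarrow> (\<forall>\<eta> \<eta>'. has_ae_gradient U \<eta> \<eta>' \<longrightarrow> compact_support_in U \<eta> \<longrightarrow>
     integrable (lebesgue_on U) (\<lambda>x. V x \<bullet> \<eta>' x) \<and> integrable (lebesgue_on U) (\<lambda>x. w x * \<eta> x) \<and>
     (LINT x|lebesgue_on U. V x \<bullet> \<eta>' x) = - (LINT x|lebesgue_on U. w x * \<eta> x))"

lemma weak_divD:
  assumes "weak_div U V w" "has_ae_gradient U \<eta> \<eta>'" "compact_support_in U \<eta>"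
  shows "integrable (lebesgue_on U) (\<lambda>x. V x \<bullet> \<eta>' x)" "integrable (lebesgue_on U) (\<lambda>x. w x * \<eta> x)"
    "(LINT x|lebesgue_on U. V x \<bullet> \<eta>' x) = - (LINT x|lebesgue_on U. w x * \<eta> x)"
  using assms unfolding weak_div_def by blast+

lemma weak_div_zero: "weak_div U (\<lambda>x. 0) (\<lambda>x. 0)"
  by (simp add: weak_div_def)

lemma weak_div_add:
  assumes "weak_div U V w" "weak_div U V' w'"
  shows "weak_div U (\<lambda>x. V x + V' x) (\<lambda>x. w x + w' x)"
  unfolding weak_div_def
proof (intro allI impI)
  fix \<eta> \<eta>' assume "has_ae_gradient U \<eta> \<eta>'" "compact_support_in U \<eta>"
  note D = weak_divD[OF assms(1) this] weak_divD[OF assms(2) this]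
  show "integrable (lebesgue_on U) (\<lambda>x. (V x + V' x) \<bullet> \<eta>' x) \<and>
      integrable (lebesgue_on U) (\<lambda>x. (w x + w' x) * \<eta> x) \<and>
      (LINT x|lebesgue_on U. (V x + V' x) \<bullet> \<eta>' x) = - (LINT x|lebesgue_on U. (w x + w' x) * \<eta> x)"
    unfolding inner_add_left distrib_right by (simp add: D)
qed

lemma weak_div_sum:
  "(\<And>i. i \<in> I \<Longrightarrow> weak_div U (V i) (w i)) \<Longrightarrow> weak_div U (\<lambda>x. \<Sum>i\<in>I. V i x) (\<lambda>x. \<Sum>i\<in>I. w i x)"
  by (induction I rule: infinite_finite_induct) (auto intro: weak_div_add weak_div_zero)

lemma weak_div_cong_AE:
  assumes U: "U \<in> sets lebesgue" and "weak_div U V w"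
    and V: "AE x in lebesgue_on U. V x = V' x" and w: "AE x in lebesgue_on U. w x = w' x"
  shows "weak_div U V' w'"
  unfolding weak_div_def
proof (intro allI impI)
  fix \<eta> \<eta>' assume "has_ae_gradient U \<eta> \<eta>'" "compact_support_in U \<eta>"
  note D = weak_divD[OF assms(2) this]
  have V': "AE x in lebesgue_on U. V x \<bullet> \<eta>' x = V' x \<bullet> \<eta>' x" using V by eventually_elim simp
  have w': "AE x in lebesgue_on U. w x * \<eta> x = w' x * \<eta> x" using w by eventually_elim simp
  show "integrable (lebesgue_on U) (\<lambda>x. V' x \<bullet> \<eta>' x) \<and> integrable (lebesgue_on U) (\<lambda>x. w' x * \<eta> x) \<and>
      (LINT x|lebesgue_on U. V' x \<bullet> \<eta>' x) = - (LINT x|lebesgue_on U. w' x * \<eta> x)"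
    using integrable_lebesgue_on_cong_AE[OF U D(1) V'] integrable_lebesgue_on_cong_AE[OF U D(2) w']
        D(3) by simp
qed

lemma weak_div_scaleR_const:
  fixes f :: "'a::euclidean_space \<Rightarrow> real"
  assumes U: "open U" and f: "has_ae_gradient U f f'" and dim: "2 \<le> DIM('a)"
  shows "weak_div U (\<lambda>x. f x *\<^sub>R b) (\<lambda>x. f' x \<bullet> b)"
  unfolding weak_div_def
proof (intro allI impI)
  fix \<eta> \<eta>' assume \<eta>: "has_ae_gradient U \<eta> \<eta>'" and supp: "compact_support_in U \<eta>"
  obtain K where K: "compact K" "K \<subseteq> U" "\<And>x. x \<notin> K \<Longrightarrow> \<eta> x = 0"
    using supp by (rule compact_support_inE) blast
  have "compact_support_in U (\<lambda>x. f x * \<eta> x)" unfolding compact_support_in_def using K by auto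
  from has_ae_gradient_integral_eq_0[OF U has_ae_gradient_mult[OF f \<eta>] this dim, of b]
  have prod: "integrable (lebesgue_on U) (\<lambda>x. f x * (\<eta>' x \<bullet> b) + \<eta> x * (f' x \<bullet> b))"
      "(LINT x|lebesgue_on U. f x * (\<eta>' x \<bullet> b) + \<eta> x * (f' x \<bullet> b)) = 0"
    by (simp_all add: inner_add_left)
  have "AE x in lebesgue_on U. x \<notin> K \<longrightarrow> \<eta>' x = 0"
    by (rule gradient_zero_off_support[OF U \<eta> K(1)]) (rule K(3))
  then have "AE x in lebesgue_on U. x \<notin> K \<longrightarrow> \<eta>' x \<bullet> b = 0" by eventually_elim simp
  then have left: "integrable (lebesgue_on U) (\<lambda>x. f x * (\<eta>' x \<bullet> b))"
    by (rule integrable_continuous_mult[OF U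
        loc_lipschitz_continuous_on[OF has_ae_gradientD(1)[OF f]] K(1,2)
        has_ae_gradient_integral_eq_0(1)[OF U \<eta> supp dim]])
  from Bochner_Integration.integrable_diff[OF prod(1) left]
  have right: "integrable (lebesgue_on U) (\<lambda>x. \<eta> x * (f' x \<bullet> b))" by simp
  show "integrable (lebesgue_on U) (\<lambda>x. (f x *\<^sub>R b) \<bullet> \<eta>' x) \<and>
      integrable (lebesgue_on U) (\<lambda>x. (f' x \<bullet> b) * \<eta> x) \<and>
      (LINT x|lebesgue_on U. (f x *\<^sub>R b) \<bullet> \<eta>' x) = - (LINT x|lebesgue_on U. (f' x \<bullet> b) * \<eta> x)"
    using left right prod(2) Bochner_Integration.integral_add[OF left right]
    by (simp add: inner_commute mult.commute)
qed

definition rot :: "real^2 \<Rightarrow> real^2" where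
  "rot v = vector [v $ 2, - v $ 1]"

lemma rot_inner: "rot v \<bullet> w = v $ 2 * w $ 1 - v $ 1 * w $ 2"
  by (simp add: rot_def inner_vec_def sum_2)

lemma linear_rot: "linear rot"
  by (rule linearI) (simp_all add: rot_def vec_eq_iff forall_2)

lemma rot_inner_swap: "v \<bullet> rot w = - (rot v \<bullet> w)"
  by (simp add: rot_def inner_vec_def sum_2)

lemma norm_rot: "norm (rot v) = norm v"
  by (simp add: rot_def norm_eq_sqrt_inner inner_vec_def sum_2)

text \<open>In terms of differential forms, \<open>d(f dg) = df \<and> dg\<close>.\<close>

lemma weak_div_rot_gradient:
  assumes U: "open U" and f: "has_ae_gradient U f f'" and g: "has_ae_gradient U g g'"
  shows "weak_div U (\<lambda>x. rot (f x *\<^sub>R g' x)) (\<lambda>x. f' x \<bullet> rot (g' x))"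
  unfolding weak_div_def
proof (intro allI impI)
  fix \<eta> \<eta>' assume \<eta>: "has_ae_gradient U \<eta> \<eta>'" and supp: "compact_support_in U \<eta>"
  obtain K where K: "compact K" "K \<subseteq> U" "\<And>x. x \<notin> K \<Longrightarrow> \<eta> x = 0"
    using supp by (rule compact_support_inE) blast
  define A where "A i j x = f x * (\<eta>' x $ i * g' x $ j)" for i j x
  define B where "B i j x = \<eta> x * (f' x $ i * g' x $ j)" for i j x
  have "compact_support_in U (\<lambda>x. f x * \<eta> x)" unfolding compact_support_in_def using K by auto
  note ibp = has_ae_gradient_integration_by_parts[OF U has_ae_gradient_mult[OF f \<eta>] g this]
  have sum: "integrable (lebesgue_on U) (\<lambda>x. A i j x + B i j x)"
      "(LINT x|lebesgue_on U. A i j x + B i j x) = (LINT x|lebesgue_on U. A j i x + B j i x)"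
        for i j
    using ibp[of "axis i 1" "axis j 1"] by (simp_all add: A_def B_def inner_axis algebra_simps)
  have A: "integrable (lebesgue_on U) (A i j)" for i j
    unfolding A_def
  proof (rule integrable_continuous_mult[OF U
      loc_lipschitz_continuous_on[OF has_ae_gradientD(1)[OF f]] K(1,2)])
    show "integrable (lebesgue_on U) (\<lambda>x. \<eta>' x $ i * g' x $ j)"
      using has_ae_gradient_integration_by_parts(1)[OF U \<eta> g supp, of "axis i 1" "axis j 1"]
      by (simp add: inner_axis)
    have "AE x in lebesgue_on U. x \<notin> K \<longrightarrow> \<eta>' x = 0"
      by (rule gradient_zero_off_support[OF U \<eta> K(1)]) (rule K(3))
    then show "AE x in lebesgue_on U. x \<notin> K \<longrightarrow> \<eta>' x $ i * g' x $ j = 0" by eventually_elim simp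
  qed
  have B: "integrable (lebesgue_on U) (B i j)" for i j
    using Bochner_Integration.integrable_diff[OF sum(1) A, of i j i j] by simp
  have eq: "(\<lambda>x. rot (f x *\<^sub>R g' x) \<bullet> \<eta>' x) = (\<lambda>x. A 1 2 x - A 2 1 x)"
      "(\<lambda>x. (f' x \<bullet> rot (g' x)) * \<eta> x) = (\<lambda>x. B 1 2 x - B 2 1 x)"
    by (auto simp: rot_inner rot_inner_swap A_def B_def algebra_simps)
  have "integral\<^sup>L (lebesgue_on U) (A 1 2) + integral\<^sup>L (lebesgue_on U) (B 1 2) =
      integral\<^sup>L (lebesgue_on U) (A 2 1) + integral\<^sup>L (lebesgue_on U) (B 2 1)"
    using sum(2)[of 1 2] by (simp add: A B)
  then show "integrable (lebesgue_on U) (\<lambda>x. rot (f x *\<^sub>R g' x) \<bullet> \<eta>' x) \<and>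
      integrable (lebesgue_on U) (\<lambda>x. (f' x \<bullet> rot (g' x)) * \<eta> x) \<and>
      (LINT x|lebesgue_on U. rot (f x *\<^sub>R g' x) \<bullet> \<eta>' x) =
          - (LINT x|lebesgue_on U. (f' x \<bullet> rot (g' x)) * \<eta> x)"
    unfolding eq by (simp add: A B)
qed

subsection \<open>Removing a point\<close>

definition cutoff :: "'a::euclidean_space \<Rightarrow> real \<Rightarrow> 'a \<Rightarrow> real" where
  "cutoff a \<epsilon> x = max 0 (min 1 (dist x a / \<epsilon> - 1))"

definition cutoff_gradient :: "'a::euclidean_space \<Rightarrow> real \<Rightarrow> 'a \<Rightarrow> 'a" where
  "cutoff_gradient a \<epsilon> x = (if \<epsilon> < dist x a \<and> dist x a < 2 * \<epsilon> then (1 / \<epsilon>) *\<^sub>R sgn (x - a) else 0)"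

lemma cutoff_bounds: "0 \<le> cutoff a \<epsilon> x" "cutoff a \<epsilon> x \<le> 1"
  by (auto simp: cutoff_def)

lemma cutoff_eq_0: "\<epsilon> > 0 \<Longrightarrow> dist x a \<le> \<epsilon> \<Longrightarrow> cutoff a \<epsilon> x = 0"
  by (simp add: cutoff_def field_simps)

lemma cutoff_eq_1: "\<epsilon> > 0 \<Longrightarrow> 2 * \<epsilon> \<le> dist x a \<Longrightarrow> cutoff a \<epsilon> x = 1"
  by (simp add: cutoff_def field_simps)

lemma cutoff_lipschitz:
  assumes "\<epsilon> > 0"
  shows "(1 / \<epsilon>)-lipschitz_on UNIV (cutoff a \<epsilon>)"
proof (rule lipschitz_onI)
  fix x y
  have "\<bar>dist x a / \<epsilon> - dist y a / \<epsilon>\<bar> = \<bar>dist x a - dist y a\<bar> / \<epsilon>"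
    using assms by (simp add: diff_divide_distrib[symmetric])
  also have "\<dots> \<le> dist x y / \<epsilon>"
    using assms dist_triangle[of x a y] dist_triangle[of y a x]
    by (intro divide_right_mono) (auto simp: dist_commute abs_le_iff)
  finally have "\<bar>cutoff a \<epsilon> x - cutoff a \<epsilon> y\<bar> \<le> dist x y / \<epsilon>" unfolding cutoff_def by linarith
  then show "dist (cutoff a \<epsilon> x) (cutoff a \<epsilon> y) \<le> 1 / \<epsilon> * dist x y" by (simp add: dist_real_def)
qed (use assms in simp)

lemma cutoff_GDERIV:
  assumes \<epsilon>: "\<epsilon> > 0" and x: "dist x a \<noteq> \<epsilon>" "dist x a \<noteq> 2 * \<epsilon>"
  shows "GDERIV (cutoff a \<epsilon>) x :> cutoff_gradient a \<epsilon> x"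
proof -
  consider (inside) "dist x a < \<epsilon>" | (outside) "2 * \<epsilon> < dist x a"
    | (shell) "\<epsilon> < dist x a" "dist x a < 2 * \<epsilon>"
    using x by linarith
  then show ?thesis
  proof cases
    case inside
    then have "GDERIV (cutoff a \<epsilon>) x :> 0"
      using \<epsilon> by (intro GDERIV_transform_open[OF GDERIV_const[of 0], of "{x. dist x a < \<epsilon>}"])
        (auto simp: cutoff_eq_0 intro!: open_Collect_less continuous_intros)
    then show ?thesis using inside by (simp add: cutoff_gradient_def)
  next
    case outside
    then have "GDERIV (cutoff a \<epsilon>) x :> 0"
      using \<epsilon> by (intro GDERIV_transform_open[OF GDERIV_const[of 1], of "{x. 2 * \<epsilon> < dist x a}"])
        (auto simp: cutoff_eq_1 intro!: open_Collect_less continuous_intros)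
    then show ?thesis using outside by (simp add: cutoff_gradient_def)
  next
    case shell
    have "((\<lambda>x. norm (x - a)) has_derivative (\<lambda>h. h \<bullet> sgn (x - a))) (at x)"
      using shell \<epsilon> by (intro has_derivative_compose[OF _ has_derivative_norm, of "\<lambda>x. x -
          a" "\<lambda>h. h"])
        (auto intro!: derivative_eq_intros)
    then have "GDERIV (\<lambda>x. norm (x - a) * (1 / \<epsilon>) - 1) x :> (1 / \<epsilon>) *\<^sub>R sgn (x - a)"
      unfolding gderiv_def using \<epsilon> by (auto intro!: derivative_eq_intros)
    then have "GDERIV (cutoff a \<epsilon>) x :> (1 / \<epsilon>) *\<^sub>R sgn (x - a)"
      using shell \<epsilon> by (elim GDERIV_transform_open[where S = "{x. \<epsilon> < dist x a \<and>
          dist x a < 2 * \<epsilon>}"])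
        (auto simp: cutoff_def dist_norm field_simps intro!: open_Collect_conj open_Collect_less
            continuous_intros)
    then show ?thesis using shell by (simp add: cutoff_gradient_def)
  qed
qed

lemma cutoff_has_ae_gradient:
  assumes "\<epsilon> > 0" "open U"
  shows "has_ae_gradient U (cutoff a \<epsilon>) (cutoff_gradient a \<epsilon>)"
proof (rule has_ae_gradient_subset[of UNIV])
  have "AE x in lebesgue. x \<notin> sphere a \<epsilon> \<union> sphere a (2 * \<epsilon>)"
    by (intro AE_not_negligible negligible_Un negligible_sphere)
  then have "AE x in lebesgue. GDERIV (cutoff a \<epsilon>) x :> cutoff_gradient a \<epsilon> x"
    by eventually_elim (use assms in \<open>auto intro: cutoff_GDERIV simp: dist_commute\<close>)
  then show "has_ae_gradient UNIV (cutoff a \<epsilon>) (cutoff_gradient a \<epsilon>)"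
    using lipschitz_on_imp_loc_lipschitz[OF cutoff_lipschitz[OF assms(1)]]
    unfolding has_ae_gradient_def lebesgue_on_UNIV_eq by blast
qed (use assms in auto)

lemma norm_cutoff_gradient_le:
  "\<epsilon> > 0 \<Longrightarrow> norm (cutoff_gradient a \<epsilon> x) \<le> 1 / \<epsilon> * indicator (cball a (2 * \<epsilon>)) x"
  by (auto simp: cutoff_gradient_def norm_sgn dist_commute)

lemma cutoff_eventually_eq_1:
  assumes "x \<noteq> a"
  shows "\<forall>\<^sub>F n in sequentially. cutoff a (1 / real (Suc n)) x = 1"
proof -
  have "(\<lambda>n. 2 * (1 / real (Suc n))) \<longlonglongrightarrow> 2 * 0"
    by (intro tendsto_intros LIMSEQ_Suc[OF lim_1_over_n])
  then have "\<forall>\<^sub>F n in sequentially. 2 * (1 / real (Suc n)) < dist x a"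
    using assms by (intro order_tendstoD(2)) auto
  then show ?thesis by eventually_elim (auto intro!: cutoff_eq_1)
qed

lemma cutoff_mult_integral_tendsto:
  fixes f :: "'a::euclidean_space \<Rightarrow> real"
  assumes f: "integrable (lebesgue_on \<Omega>) f" and \<Omega>: "open \<Omega>"
  shows "integrable (lebesgue_on \<Omega>) (\<lambda>x. cutoff a \<epsilon> x * f x)"
    and "(\<lambda>n. LINT x|lebesgue_on \<Omega>. cutoff a (1 / real (Suc n)) x * f x) \<longlonglongrightarrow>
        (LINT x|lebesgue_on \<Omega>. f x)"
proof -
  have [measurable]: "f \<in> borel_measurable (lebesgue_on \<Omega>)" using f by simp
  have "continuous_on UNIV (cutoff a \<epsilon>)" for \<epsilon>
    unfolding cutoff_def[abs_def] by (cases "\<epsilon> = 0") (auto intro!: continuous_intros)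
  then have [measurable]: "cutoff a \<epsilon> \<in> borel_measurable (lebesgue_on \<Omega>)" for \<epsilon>
    by (rule borel_measurable_continuous_lebesgue_on[OF _ \<Omega>])
  have bound: "norm (cutoff a \<epsilon> x * f x) \<le> norm (f x)" for \<epsilon> x
    using cutoff_bounds[of a \<epsilon> x] by (simp add: abs_mult mult_left_le_one_le)
  show "integrable (lebesgue_on \<Omega>) (\<lambda>x. cutoff a \<epsilon> x * f x)"
    using bound by (intro Bochner_Integration.integrable_bound[OF f]) (auto intro: AE_I2)
  have "AE x in lebesgue_on \<Omega>. x \<noteq> a"
    using AE_not_negligible[OF negligible_sing[of a]] \<Omega>
    by (auto simp: lebesgue_on_AE_iff elim: eventually_mono)
  then have lim: "AE x in lebesgue_on \<Omega>. (\<lambda>n. cutoff a (1 / real (Suc n)) x * f x) \<longlonglongrightarrow> f x"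
  proof eventually_elim
    case (elim x)
    show ?case
      by (rule tendsto_eventually) (use cutoff_eventually_eq_1[OF elim] in eventually_elim, simp)
  qed
  show "(\<lambda>n. LINT x|lebesgue_on \<Omega>. cutoff a (1 / real (Suc n)) x * f x) \<longlonglongrightarrow>
      (LINT x|lebesgue_on \<Omega>. f x)"
    by (rule integral_dominated_convergence[OF _ _ integrable_norm[OF f] lim])
      (use bound in \<open>auto intro: AE_I2\<close>)
qed

lemma integral_indicator_cball_le:
  fixes a :: "'a::euclidean_space"
  assumes "open \<Omega>" "0 \<le> r" "0 \<le> c"
  shows "integrable (lebesgue_on \<Omega>) (\<lambda>x. c * indicator (cball a r) x)"
    and "(LINT x|lebesgue_on \<Omega>. c * indicator (cball a r) x) \<le>
        c * (unit_ball_vol (real DIM('a)) * r ^ DIM('a))"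
proof -
  let ?f = "\<lambda>x. c * indicat_real (cball a r) x"
  have int: "integrable lebesgue ?f"
    using lmeasurable_cball[of a r] by (simp add: lmeasurable_iff_integrable)
  then show "integrable (lebesgue_on \<Omega>) ?f"
    using assms(1) by (intro integrable_restrict_space[THEN iffD2] integrable_mult_indicator) auto
  have "(LINT x|lebesgue_on \<Omega>. ?f x) = (LINT x|lebesgue. indicator \<Omega> x *\<^sub>R ?f x)"
    using assms(1) by (intro integral_restrict_space) simp
  also have "\<dots> \<le> (LINT x|lebesgue. ?f x)"
  proof (rule integral_mono)
    show "integrable lebesgue (\<lambda>x. indicator \<Omega> x *\<^sub>R ?f x)"
      using assms(1) by (intro integrable_mult_indicator int) simp
  qed (use assms(3) int in \<open>auto simp: indicator_def\<close>)
  also have "\<dots> = c * (unit_ball_vol (real DIM('a)) * r ^ DIM('a))"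
    using content_cball[OF assms(2), of a] by simp
  finally show "(LINT x|lebesgue_on \<Omega>. ?f x) \<le> c * (unit_ball_vol (real DIM('a)) * r ^ DIM('a))" .
qed

text \<open>The gradient of the cutoff is \<open>O(1/\<epsilon>)\<close> on a ball of volume \<open>O(\<epsilon>\<^sup>2)\<close>.\<close>

lemma cutoff_gradient_integral_tendsto_0:
  fixes r :: "nat \<Rightarrow> 'a::euclidean_space \<Rightarrow> real"
  assumes dim: "2 \<le> DIM('a)" and "open \<Omega>" and r: "\<And>n. integrable (lebesgue_on \<Omega>) (r n)"
    and bound: "\<And>n. AE x in lebesgue_on \<Omega>. \<bar>r n x\<bar> \<le>
        B * norm (cutoff_gradient a (1 / real (Suc n)) x)"
    and "B \<ge> 0"
  shows "(\<lambda>n. integral\<^sup>L (lebesgue_on \<Omega>) (r n)) \<longlonglongrightarrow> 0"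
proof (rule Lim_null_comparison)
  define V where "V = unit_ball_vol (real DIM('a)) * 2 ^ DIM('a)"
  have "norm (integral\<^sup>L (lebesgue_on \<Omega>) (r n)) \<le> B * V * (1 / real (Suc n))" for n
  proof -
    define \<epsilon> where "\<epsilon> = 1 / real (Suc n)"
    have \<epsilon>: "0 < \<epsilon>" "\<epsilon> \<le> 1" by (auto simp: \<epsilon>_def)
    let ?w = "\<lambda>x. B / \<epsilon> * indicator (cball a (2 * \<epsilon>)) x"
    have "0 \<le> 2 * \<epsilon>" "0 \<le> B / \<epsilon>" using \<epsilon>(1) \<open>B \<ge> 0\<close> by simp_all
    note w = integral_indicator_cball_le[OF \<open>open \<Omega>\<close> this, of a]
    have "AE x in lebesgue_on \<Omega>. norm (r n x) \<le> ?w x"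
      using bound[of n]
    proof eventually_elim
      case (elim x)
      then have "\<bar>r n x\<bar> \<le> B * (1 / \<epsilon> * indicator (cball a (2 * \<epsilon>)) x)"
        using norm_cutoff_gradient_le[OF \<epsilon>(1), of a x] \<open>B \<ge> 0\<close>
        by (elim order_trans) (auto simp: \<epsilon>_def intro: mult_left_mono)
      then show ?case by simp
    qed
    then have "norm (integral\<^sup>L (lebesgue_on \<Omega>) (r n)) \<le> (LINT x|lebesgue_on \<Omega>. ?w x)"
      by (rule order_trans[OF integral_norm_bound integral_mono_AE[OF integrable_norm[OF r] w(1)]])
    also have "\<dots> \<le> B / \<epsilon> * (unit_ball_vol (real DIM('a)) * (2 * \<epsilon>) ^ DIM('a))" by (rule w(2))
    also have "\<dots> = B * V * (\<epsilon> ^ DIM('a) / \<epsilon>)" by (simp add: V_def power_mult_distrib)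
    also have "\<epsilon> ^ DIM('a) / \<epsilon> \<le> \<epsilon>\<^sup>2 / \<epsilon>"
      using \<epsilon> dim by (intro divide_right_mono power_decreasing) auto
    then have "B * V * (\<epsilon> ^ DIM('a) / \<epsilon>) \<le> B * V * \<epsilon>"
      using \<epsilon>(1) \<open>B \<ge> 0\<close> by (intro mult_left_mono) (auto simp: V_def power2_eq_square)
    finally show ?thesis by (simp add: \<epsilon>_def)
  qed
  then show "\<forall>\<^sub>F n in sequentially. norm (integral\<^sup>L (lebesgue_on \<Omega>) (r n)) \<le>
      B * V * (1 / real (Suc n))"
    by simp
  have "(\<lambda>n. B * V * (1 / real (Suc n))) \<longlonglongrightarrow> B * V * 0"
    by (intro tendsto_intros LIMSEQ_Suc[OF lim_1_over_n])
  then show "(\<lambda>n. B * V * (1 / real (Suc n))) \<longlonglongrightarrow> 0" by simp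
qed

lemma has_ae_gradient_compact_support_bounds:
  fixes \<eta> :: "'a::euclidean_space \<Rightarrow> real"
  assumes U: "open U" and \<eta>: "has_ae_gradient U \<eta> \<eta>'" and supp: "compact_support_in U \<eta>"
    and dim: "2 \<le> DIM('a)"
  obtains K C where "compact K" "K \<subseteq> U" "C \<ge> 0" "\<eta> \<in> borel_measurable (lebesgue_on U)"
    "\<eta>' \<in> borel_measurable (lebesgue_on U)" "\<And>x. \<bar>\<eta> x\<bar> \<le> C * indicator K x"
    "AE x in lebesgue_on U. norm (\<eta>' x) \<le> C * indicator K x"
proof -
  obtain K where K: "compact K" "K \<subseteq> U" and off: "\<And>x. x \<notin> K \<Longrightarrow> \<eta> x = 0"
    using supp by (rule compact_support_inE) blast
  obtain L where L: "L-lipschitz_on UNIV \<eta>"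
    by (rule loc_lipschitz_compact_support[OF U has_ae_gradientD(1)[OF \<eta>] supp])
  have cont: "continuous_on UNIV \<eta>" by (rule lipschitz_on_continuous_on[OF L])
  have "bounded (\<eta> ` K)"
    using K(1) continuous_on_subset[OF cont]
    by (intro compact_imp_bounded compact_continuous_image) auto
  then obtain B where B: "B > 0" "\<And>x. x \<in> K \<Longrightarrow> \<bar>\<eta> x\<bar> \<le> B" unfolding bounded_pos by auto
  have nonneg: "L \<ge> 0" by (rule lipschitz_on_nonneg[OF L])
  have zero: "AE x in lebesgue_on U. x \<notin> K \<longrightarrow> \<eta>' x = 0"
    by (rule gradient_zero_off_support[OF U \<eta> K(1)]) (rule off)
  show thesis
  proof (rule that[OF K, of "L + B"])
    show "\<bar>\<eta> x\<bar> \<le> (L + B) * indicator K x" for x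
      using B(2)[of x] off[of x] nonneg by (auto simp: indicator_def)
    show "AE x in lebesgue_on U. norm (\<eta>' x) \<le> (L + B) * indicator K x"
      using has_ae_gradientD(2)[OF \<eta>] zero
    proof eventually_elim
      case (elim x)
      then show ?case using norm_GDERIV_le[OF L, of x "\<eta>' x"] B(1) by (auto simp: indicator_def)
    qed
    show "\<eta> \<in> borel_measurable (lebesgue_on U)"
      by (rule borel_measurable_continuous_lebesgue_on[OF cont U])
    show "\<eta>' \<in> borel_measurable (lebesgue_on U)"
      unfolding borel_measurable_euclidean_space[where f = \<eta>']
      using has_ae_gradient_integral_eq_0(1)[OF U \<eta> supp dim] borel_measurable_integrable by blast
  qed (use nonneg B(1) in simp)
qed

lemma cutoff_mult_compact_support:
  assumes "compact_support_in \<Omega> f" "\<epsilon> > 0"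
  shows "compact_support_in (\<Omega> - {a}) (\<lambda>x. cutoff a \<epsilon> x * f x)"
proof -
  obtain K where K: "compact K" "K \<subseteq> \<Omega>" and off: "\<And>x. x \<notin> K \<Longrightarrow> f x = 0"
    using assms(1) by (rule compact_support_inE) blast
  have "compact (K \<inter> {x. \<epsilon> \<le> dist x a})"
    by (intro compact_Int_closed K closed_Collect_le continuous_intros)
  moreover have "K \<inter> {x. \<epsilon> \<le> dist x a} \<subseteq> \<Omega> - {a}" using K(2) assms(2) by auto
  moreover have "cutoff a \<epsilon> x * f x = 0" if "x \<notin> K \<inter> {x. \<epsilon> \<le> dist x a}" for x
    using that off[of x] cutoff_eq_0[OF assms(2), of x a] by auto
  ultimately show ?thesis unfolding compact_support_in_def by blast
qed

lemma punctured_domain: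
  fixes a :: "'a::euclidean_space"
  assumes "open \<Omega>"
  shows "open (\<Omega> - {a})" "\<Omega> - {a} \<in> sets lebesgue" "\<Omega> \<in> sets lebesgue" "\<Omega> - {a} \<subseteq> \<Omega>"
    "negligible (\<Omega> - (\<Omega> - {a}))"
  using assms open_delete[OF assms, of a]
  by (auto intro!: negligible_subset[OF negligible_sing[of a]])

lemma AE_in_punctured_domain:
  fixes a :: "'a::euclidean_space"
  assumes "open \<Omega>"
  shows "AE x in lebesgue_on \<Omega>. x \<in> \<Omega> - {a}"
  unfolding lebesgue_on_negligible_AE[OF punctured_domain(2)[OF assms, of a]
      punctured_domain(3-5)[OF assms], symmetric] by (rule AE_I2) simp

context
  fixes a :: "'a::euclidean_space" and \<Omega> :: "'a set" and V :: "'a \<Rightarrow> 'a" and w :: "'a \<Rightarrow> real"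
    and B :: real
  assumes dim: "2 \<le> DIM('a)" and \<Omega>: "open \<Omega>" and div: "weak_div (\<Omega> - {a}) V w"
    and V: "V \<in> borel_measurable (lebesgue_on \<Omega>)" and w: "w \<in> borel_measurable (lebesgue_on \<Omega>)"
    and VB: "\<And>x. x \<in> \<Omega> - {a} \<Longrightarrow> norm (V x) \<le> B" and wB: "\<And>x. x \<in> \<Omega> - {a} \<Longrightarrow> \<bar>w x\<bar> \<le> B"
begin

lemma integrable_inner_gradient:
  assumes \<eta>: "has_ae_gradient \<Omega> \<eta> \<eta>'" and supp: "compact_support_in \<Omega> \<eta>"
  shows "integrable (lebesgue_on \<Omega>) (\<lambda>x. V x \<bullet> \<eta>' x)"
proof -
  obtain K C where K: "compact K" "K \<subseteq> \<Omega>"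
    and [measurable]: "\<eta>' \<in> borel_measurable (lebesgue_on \<Omega>)"
    and \<eta>'C: "AE x in lebesgue_on \<Omega>. norm (\<eta>' x) \<le> C * indicator K x"
    by (rule has_ae_gradient_compact_support_bounds[OF \<Omega> \<eta> supp dim]) blast
  note [measurable] = V
  show ?thesis
  proof (rule integrable_bounded_compact_support[OF \<Omega> K, where B = "B * C"])
    show "AE x in lebesgue_on \<Omega>. \<bar>V x \<bullet> \<eta>' x\<bar> \<le> B * C * indicator K x"
      using \<eta>'C AE_in_punctured_domain[OF \<Omega>, of a]
    proof eventually_elim
      case (elim x)
      have "\<bar>V x \<bullet> \<eta>' x\<bar> \<le> norm (V x) * norm (\<eta>' x)" by (rule Cauchy_Schwarz_ineq2)
      also have "\<dots> \<le> B * (C * indicator K x)"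
        using VB[OF elim(2)] elim(1) by (intro mult_mono) (auto intro: order_trans[OF norm_ge_zero])
      finally show ?case by simp
    qed
  qed measurable
qed

lemma integrable_mult_test:
  assumes \<eta>: "has_ae_gradient \<Omega> \<eta> \<eta>'" and supp: "compact_support_in \<Omega> \<eta>"
  shows "integrable (lebesgue_on \<Omega>) (\<lambda>x. w x * \<eta> x)"
proof -
  obtain K C where K: "compact K" "K \<subseteq> \<Omega>"
    and [measurable]: "\<eta> \<in> borel_measurable (lebesgue_on \<Omega>)" and \<eta>C: "\<And>x. \<bar>\<eta> x\<bar> \<le> C * indicator K x"
    by (rule has_ae_gradient_compact_support_bounds[OF \<Omega> \<eta> supp dim]) blast
  note [measurable] = w
  show ?thesis
  proof (rule integrable_bounded_compact_support[OF \<Omega> K, where B = "B * C"])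
    show "AE x in lebesgue_on \<Omega>. \<bar>w x * \<eta> x\<bar> \<le> B * C * indicator K x"
      using AE_in_punctured_domain[OF \<Omega>, of a]
    proof eventually_elim
      case (elim x)
      have "\<bar>w x\<bar> * \<bar>\<eta> x\<bar> \<le> B * (C * indicator K x)"
        using wB[OF elim] \<eta>C[of x] by (intro mult_mono) (auto intro: order_trans[OF abs_ge_zero])
      then show ?case by (simp add: abs_mult)
    qed
  qed measurable
qed

lemma weak_div_cutoff_test:
  assumes \<eta>: "has_ae_gradient \<Omega> \<eta> \<eta>'" and supp: "compact_support_in \<Omega> \<eta>" and \<epsilon>: "\<epsilon> > 0"
  shows "integrable (lebesgue_on \<Omega>) (\<lambda>x. V x \<bullet> (\<eta> x *\<^sub>R cutoff_gradient a \<epsilon> x))"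
    and "(LINT x|lebesgue_on \<Omega>. V x \<bullet> (\<eta> x *\<^sub>R cutoff_gradient a \<epsilon> x)) =
      - (LINT x|lebesgue_on \<Omega>. cutoff a \<epsilon> x * (w x * \<eta> x)) -
        (LINT x|lebesgue_on \<Omega>. cutoff a \<epsilon> x * (V x \<bullet> \<eta>' x))"
proof -
  note int = cutoff_mult_integral_tendsto(1)[OF integrable_inner_gradient[OF \<eta> supp] \<Omega>, of a \<epsilon>]
  let ?r = "\<lambda>x. V x \<bullet> (\<eta> x *\<^sub>R cutoff_gradient a \<epsilon> x)"
  have "has_ae_gradient (\<Omega> - {a}) (\<lambda>x. cutoff a \<epsilon> x * \<eta> x)
      (\<lambda>x. cutoff a \<epsilon> x *\<^sub>R \<eta>' x + \<eta> x *\<^sub>R cutoff_gradient a \<epsilon> x)"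
    by (intro has_ae_gradient_mult cutoff_has_ae_gradient \<epsilon> punctured_domain(1)[OF \<Omega>]
        has_ae_gradient_subset[OF \<eta> punctured_domain(4)[OF \<Omega>] \<Omega>])
  from weak_divD[OF div this cutoff_mult_compact_support[OF supp \<epsilon>]]
  have test: "integrable (lebesgue_on \<Omega>) (\<lambda>x. cutoff a \<epsilon> x * (V x \<bullet> \<eta>' x) + ?r x)"
    "(LINT x|lebesgue_on \<Omega>. cutoff a \<epsilon> x * (V x \<bullet> \<eta>' x) + ?r x) =
        - (LINT x|lebesgue_on \<Omega>. cutoff a \<epsilon> x * (w x * \<eta> x))"
    unfolding lebesgue_on_negligible_integral[OF punctured_domain(2-)[OF \<Omega>]]
    by (simp_all add: inner_add_right mult_ac)
  show r: "integrable (lebesgue_on \<Omega>) ?r"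
    using Bochner_Integration.integrable_diff[OF test(1) int] by simp
  show "integral\<^sup>L (lebesgue_on \<Omega>) ?r =
      - (LINT x|lebesgue_on \<Omega>. cutoff a \<epsilon> x * (w x * \<eta> x)) -
        (LINT x|lebesgue_on \<Omega>. cutoff a \<epsilon> x * (V x \<bullet> \<eta>' x))"
    using test(2) Bochner_Integration.integral_add[OF int r] by simp
qed

lemma cutoff_test_error_tendsto_0:
  assumes \<eta>: "has_ae_gradient \<Omega> \<eta> \<eta>'" and supp: "compact_support_in \<Omega> \<eta>"
  shows "(\<lambda>n. LINT x|lebesgue_on \<Omega>. V x \<bullet> (\<eta> x *\<^sub>R cutoff_gradient a (1 / real (Suc n)) x)) \<longlonglongrightarrow> 0"
proof -
  obtain K C where C: "C \<ge> 0" and \<eta>C: "\<And>x. \<bar>\<eta> x\<bar> \<le> C * indicator K x"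
    by (rule has_ae_gradient_compact_support_bounds[OF \<Omega> \<eta> supp dim]) blast
  show ?thesis
  proof (rule cutoff_gradient_integral_tendsto_0[OF dim \<Omega>, where B = "\<bar>B\<bar> * C"])
    fix n
    let ?g = "cutoff_gradient a (1 / real (Suc n))"
    show "integrable (lebesgue_on \<Omega>) (\<lambda>x. V x \<bullet> (\<eta> x *\<^sub>R ?g x))"
      by (rule weak_div_cutoff_test(1)[OF \<eta> supp]) simp
    show "AE x in lebesgue_on \<Omega>. \<bar>V x \<bullet> (\<eta> x *\<^sub>R ?g x)\<bar> \<le> \<bar>B\<bar> * C * norm (?g x)"
      using AE_in_punctured_domain[OF \<Omega>, of a]
    proof eventually_elim
      case (elim x)
      have "\<bar>\<eta> x\<bar> \<le> C" using \<eta>C[of x] C by (cases "x \<in> K") auto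
      moreover have "norm (V x) \<le> \<bar>B\<bar>" using VB[OF elim] by linarith
      ultimately have "norm (V x) * (\<bar>\<eta> x\<bar> * norm (?g x)) \<le> \<bar>B\<bar> * (C * norm (?g x))"
        by (intro mult_mono mult_right_mono) auto
      then show ?case using Cauchy_Schwarz_ineq2[of "V x" "\<eta> x *\<^sub>R ?g x"] by simp
    qed
  qed (use C in simp)
qed

lemma weak_div_insert_point: "weak_div \<Omega> V w"
  unfolding weak_div_def
proof (intro allI impI)
  fix \<eta> \<eta>' assume \<eta>: "has_ae_gradient \<Omega> \<eta> \<eta>'" and supp: "compact_support_in \<Omega> \<eta>"
  note int = integrable_inner_gradient[OF \<eta> supp] integrable_mult_test[OF \<eta> supp]
  have "(\<lambda>n. LINT x|lebesgue_on \<Omega>. V x \<bullet> (\<eta> x *\<^sub>R cutoff_gradient a (1 / real (Suc n)) x)) \<longlonglongrightarrow>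
      - (LINT x|lebesgue_on \<Omega>. w x * \<eta> x) - (LINT x|lebesgue_on \<Omega>. V x \<bullet> \<eta>' x)"
    using weak_div_cutoff_test(2)[OF \<eta> supp]
    by (simp del: of_nat_Suc) (intro tendsto_intros cutoff_mult_integral_tendsto(2)[OF _ \<Omega>] int)
  then have "- (LINT x|lebesgue_on \<Omega>. w x * \<eta> x) - (LINT x|lebesgue_on \<Omega>. V x \<bullet> \<eta>' x) = 0"
    by (rule LIMSEQ_unique[OF _ cutoff_test_error_tendsto_0[OF \<eta> supp]])
  then show "integrable (lebesgue_on \<Omega>) (\<lambda>x. V x \<bullet> \<eta>' x) \<and>
      integrable (lebesgue_on \<Omega>) (\<lambda>x. w x * \<eta> x) \<and>
      (LINT x|lebesgue_on \<Omega>. V x \<bullet> \<eta>' x) = - (LINT x|lebesgue_on \<Omega>. w x * \<eta> x)"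
    using int by simp
qed

end

section \<open>Test functions\<close>

lemma partial_eq_gradient: "GDERIV f x :> D \<Longrightarrow> partial i f x = D $ i"
  unfolding partial_def gderiv_def by (simp add: frechet_derivative_at[symmetric] inner_axis')

lemma differentiable_imp_GDERIV:
  assumes "f differentiable (at x)"
  shows "GDERIV f x :> (\<chi> i. partial i f x)"
proof -
  obtain f' where f': "(f has_derivative f') (at x)"
    using assms unfolding differentiable_def by blast
  have lin: "linear f'" using f' by (rule has_derivative_linear)
  have "f' h = h \<bullet> (\<chi> i. f' (axis i 1))" for h
  proof -
    have "f' h = f' (\<Sum>i\<in>UNIV. h $ i *\<^sub>R axis i 1)"
      using basis_expansion[of h] by (simp add: scalar_mult_eq_scaleR)
    then show ?thesis by (simp add: linear_sum[OF lin] linear_scale[OF lin] inner_vec_def)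
  qed
  then have "f' = (\<lambda>h. h \<bullet> (\<chi> i. f' (axis i 1)))" by (rule ext)
  then have D: "GDERIV f x :> (\<chi> i. f' (axis i 1))" using f' unfolding gderiv_def by simp
  have "(\<chi> i. partial i f x) = (\<chi> i. f' (axis i 1))" by (simp add: partial_eq_gradient[OF D])
  then show ?thesis using D by simp
qed

lemma partial_add:
  assumes "f differentiable (at x)" "g differentiable (at x)"
  shows "partial i (\<lambda>x. f x + g x) x = partial i f x + partial i g x"
  using partial_eq_gradient[OF GDERIV_add[OF assms[THEN differentiable_imp_GDERIV]]] by simp

lemma partial_mult:
  assumes "f differentiable (at x)" "g differentiable (at x)"
  shows "partial i (\<lambda>x. f x * g x) x = f x * partial i g x + g x * partial i f x"
  using partial_eq_gradient[OF GDERIV_mult[OF assms[THEN differentiable_imp_GDERIV]]] by simp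

lemma partial_const: "partial i (\<lambda>x. c) x = 0"
  using partial_eq_gradient[OF GDERIV_const] by simp

lemma partial_nth: "partial i (\<lambda>x. x $ j) x = (if i = j then 1 else 0)"
proof -
  have "GDERIV (\<lambda>x. x $ j) x :> axis j 1"
    by (simp add: gderiv_def inner_axis bounded_linear_imp_has_derivative bounded_linear_vec_nth)
  then show ?thesis using partial_eq_gradient by (fastforce simp: axis_def)
qed

lemma Ck_const: "Ck k (\<lambda>x::real^'n::finite. c)"
proof (induction k arbitrary: c)
  case (Suc k)
  have "partial i (\<lambda>x::real^'n. c) = (\<lambda>x. 0)" for i by (rule ext) (rule partial_const)
  then show ?case using Suc by simp
qed simp

lemma Ck_Suc_imp: "Ck (Suc k) f \<Longrightarrow> Ck k f"
proof (induction k arbitrary: f)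
  case 0
  then show ?case
    by (auto intro!: continuous_at_imp_continuous_on differentiable_imp_continuous_within)
next
  case (Suc k)
  have "Ck k (partial i f)" for i using Suc by auto
  then show ?case using Suc.prems by simp
qed

lemma Ck_add: "Ck k f \<Longrightarrow> Ck k g \<Longrightarrow> Ck k (\<lambda>x. f x + g x)"
proof (induction k arbitrary: f g)
  case 0
  then show ?case by (auto intro: continuous_intros)
next
  case (Suc k)
  have "partial i (\<lambda>x. f x + g x) = (\<lambda>x. partial i f x + partial i g x)" for i
    using Suc.prems by (intro ext partial_add) auto
  then show ?case using Suc by auto
qed

lemma Ck_mult: "Ck k f \<Longrightarrow> Ck k g \<Longrightarrow> Ck k (\<lambda>x. f x * g x)"
proof (induction k arbitrary: f g)
  case 0
  then show ?case by (auto intro: continuous_intros)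
next
  case (Suc k)
  have "partial i (\<lambda>x. f x * g x) = (\<lambda>x. f x * partial i g x + g x * partial i f x)" for i
    using Suc.prems by (intro ext partial_mult) auto
  moreover have "Ck k (\<lambda>x. f x * partial i g x + g x * partial i f x)" for i
    using Suc.prems Ck_Suc_imp[OF Suc.prems(1)] Ck_Suc_imp[OF Suc.prems(2)]
    by (intro Ck_add Suc.IH) auto
  moreover have "(\<lambda>x. f x * g x) differentiable (at x)" for x
    using Suc.prems by (intro differentiable_mult) auto
  ultimately show ?case by simp
qed

lemma Ck_prod: "(\<And>i. i \<in> I \<Longrightarrow> Ck k (f i)) \<Longrightarrow> Ck k (\<lambda>x::real^'n::finite. \<Prod>i\<in>I. f i x)"
  by (induction I rule: infinite_finite_induct) (simp_all add: Ck_const Ck_mult)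

lemma Ck_nth: "Ck k (\<lambda>x::real^'n::finite. x $ i)"
proof (cases k)
  case 0
  then show ?thesis by (auto intro: continuous_intros)
next
  case (Suc m)
  have "partial j (\<lambda>x::real^'n. x $ i) = (\<lambda>x. if j = i then 1 else 0)" for j
    by (rule ext) (rule partial_nth)
  then show ?thesis
    by (auto simp: Suc Ck_const intro!: bounded_linear_imp_differentiable bounded_linear_vec_nth)
qed

text \<open>\<open>flat 0\<close> is the standard smooth function vanishing to infinite order at \<open>0\<close>; all its derivatives are
  combinations of the functions \<open>flat k\<close>.\<close>

definition flat :: "nat \<Rightarrow> real \<Rightarrow> real" where
  "flat k t = (if t > 0 then (1 / t) ^ k * exp (- 1 / t) else 0)"

lemma flat_tendsto_0: "(flat k \<longlongrightarrow> 0) (at 0)"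
proof (rule filterlim_split_at)
  have "\<forall>\<^sub>F t in at_left 0. flat k t = 0" by (auto simp: eventually_at_filter flat_def)
  then show "(flat k \<longlongrightarrow> 0) (at_left 0)" by (rule tendsto_eventually)
  have "((\<lambda>t. inverse t ^ k / exp (inverse t)) \<longlongrightarrow> (0::real)) (at_right 0)"
    by (rule filterlim_compose[OF tendsto_power_div_exp_0 filterlim_inverse_at_top_right])
  then show "(flat k \<longlongrightarrow> 0) (at_right 0)"
    by (rule Lim_transform_eventually)
      (auto simp: eventually_at_filter flat_def exp_minus divide_inverse)
qed

lemma flat_has_derivative:
  "(flat k has_real_derivative flat (k + 2) t - real k * flat (k + 1) t) (at t)"
proof -
  consider (pos) "t > 0" | (neg) "t < 0" | (zero) "t = 0" by linarith
  then show ?thesis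
  proof cases
    case pos
    have inv: "((\<lambda>t. 1 / t) has_real_derivative - ((1 / t)\<^sup>2)) (at t)"
      using pos by (auto intro!: derivative_eq_intros simp: power2_eq_square)
    have pow: "((\<lambda>t. (1 / t) ^ k) has_real_derivative - (real k * (1 / t) ^ (k + 1))) (at t)"
      by (rule DERIV_cong[OF DERIV_power[OF inv, of k]]) (cases k; simp add: power2_eq_square)
    have "((\<lambda>t. exp (- 1 / t)) has_real_derivative exp (- 1 / t) * (1 / t)\<^sup>2) (at t)"
      using DERIV_chain2[OF DERIV_exp DERIV_minus[OF inv]] by simp
    from DERIV_mult[OF pow this]
    have "((\<lambda>t. (1 / t) ^ k * exp (- 1 / t)) has_real_derivative
        flat (k + 2) t - real k * flat (k + 1) t) (at t)"
      using pos by (simp add: flat_def algebra_simps power_add power2_eq_square)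
    then show ?thesis
      by (rule has_field_derivative_transform_within_open[where S = "{0<..}"])
        (use pos in \<open>auto simp: flat_def\<close>)
  next
    case neg
    have "((\<lambda>t. 0) has_real_derivative flat (k + 2) t - real k * flat (k + 1) t) (at t)"
      using neg by (simp add: flat_def)
    then show ?thesis
      by (rule has_field_derivative_transform_within_open[where S = "{..<0}"])
        (use neg in \<open>auto simp: flat_def\<close>)
  next
    case zero
    have "((\<lambda>h. (flat k (0 + h) - flat k 0) / h) \<longlongrightarrow> 0) (at 0)"
      using flat_tendsto_0[of "k + 1"]
      by (rule Lim_transform_eventually) (auto simp: eventually_at_filter flat_def)
    then show ?thesis using zero by (simp add: DERIV_def flat_def)
  qed
qed

lemma Ck_flat_compose:
  assumes "\<And>m. Ck m g"
  shows "Ck m (\<lambda>x. flat k (g x))"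
proof (induction m arbitrary: k)
  case 0
  have "continuous_on UNIV (flat k)"
    using DERIV_isCont[OF flat_has_derivative] by (blast intro: continuous_at_imp_continuous_on)
  then show ?case
    using assms[of 0] continuous_on_compose2[of UNIV "flat k" UNIV g] by auto
next
  case (Suc m)
  have g: "g differentiable (at x)" "Ck m (partial i g)" for x i using assms[of "Suc m"] by auto
  have D: "GDERIV (\<lambda>x. flat k (g x)) x :>
      (flat (k + 2) (g x) - real k * flat (k + 1) (g x)) *\<^sub>R (\<chi> i. partial i g x)" for x
    by (rule GDERIV_DERIV_compose[OF differentiable_imp_GDERIV[OF g(1)] flat_has_derivative])
  have "partial i (\<lambda>x. flat k (g x)) =
      (\<lambda>x. (flat (k + 2) (g x) + (- real k) * flat (k + 1) (g x)) * partial i g x)" for i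
    by (rule ext) (simp add: partial_eq_gradient[OF D])
  moreover have "Ck m (\<lambda>x. (flat (k + 2) (g x) + (- real k) * flat (k + 1) (g x)) * partial i g x)"
    for i
    by (intro Ck_mult Ck_add Ck_const Suc g)
  moreover have "(\<lambda>x. flat k (g x)) differentiable (at x)" for x
    using D[of x] unfolding gderiv_def differentiable_def by blast
  ultimately show ?case by simp
qed

lemma test_functionD:
  assumes "\<phi> \<in> test_functions U"
  shows "Ck k \<phi>" "compact_support_in U \<phi>"
proof -
  show "Ck k \<phi>" using assms by (simp add: test_functions_def)
  have "\<phi> x = 0" if "x \<notin> closure {x. \<phi> x \<noteq> 0}" for x
    using that closure_subset[of "{x. \<phi> x \<noteq> 0}"] by blast
  then show "compact_support_in U \<phi>"
    using assms unfolding test_functions_def compact_support_in_def by blast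
qed

lemma test_functionI:
  assumes "\<And>k. Ck k \<phi>" "compact K" "K \<subseteq> U" "\<And>x. x \<notin> K \<Longrightarrow> \<phi> x = 0"
  shows "\<phi> \<in> test_functions U"
proof -
  have "{x. \<phi> x \<noteq> 0} \<subseteq> K" using assms(4) by blast
  then have "closure {x. \<phi> x \<noteq> 0} \<subseteq> K"
    using assms(2) by (simp add: closure_minimal compact_imp_closed)
  moreover from this have "compact (closure {x. \<phi> x \<noteq> 0})"
    using assms(2) by (metis closed_closure compact_Int_closed inf.absorb_iff2)
  ultimately show ?thesis using assms(1,3) by (auto simp: test_functions_def)
qed

lemma test_functions_mono: "U \<subseteq> V \<Longrightarrow> test_functions U \<subseteq> test_functions V"
  by (auto simp: test_functions_def)

lemma test_function_has_ae_gradient: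
  assumes "\<phi> \<in> test_functions \<Omega>" "open U"
  shows "has_ae_gradient U \<phi> (\<lambda>x. \<chi> i. partial i \<phi> x)"
proof (rule has_ae_gradient_C1[OF assms(2)])
  have "Ck (Suc 0) \<phi>" by (rule test_functionD(1)[OF assms(1)])
  then have \<phi>: "\<phi> differentiable (at x)" "continuous_on UNIV (partial i \<phi>)" for x i by auto
  show "GDERIV \<phi> x :> (\<chi> i. partial i \<phi> x)" for x by (rule differentiable_imp_GDERIV[OF \<phi>(1)])
  show "continuous_on U (\<lambda>x. \<chi> i. partial i \<phi> x)"
    by (intro continuous_on_vec_lambda continuous_on_subset[OF \<phi>(2)] subset_UNIV)
qed

definition box_bump :: "nat \<Rightarrow> real^'n::finite \<Rightarrow> real^'n \<Rightarrow> real^'n \<Rightarrow> real" where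
  "box_bump n a b x = (\<Prod>i\<in>UNIV. flat 0 (real (Suc n) * ((x $ i - a $ i) * (b $ i - x $ i))))"

lemma Ck_box_bump: "Ck m (box_bump n a b)"
proof -
  have "Ck m (\<lambda>x. real (Suc n) * ((x $ i + (- (a $ i))) * (b $ i + (- 1) * x $ i)))" for m i
    by (intro Ck_mult Ck_add Ck_const Ck_nth)
  then have "Ck m (\<lambda>x. \<Prod>i\<in>UNIV.
      flat 0 (real (Suc n) * ((x $ i + (- (a $ i))) * (b $ i + (- 1) * x $ i))))"
    by (intro Ck_prod Ck_flat_compose)
  then show ?thesis by (simp add: box_bump_def[abs_def])
qed

lemma box_bump_bounds: "0 \<le> box_bump n a b x" "box_bump n a b x \<le> 1"
  unfolding box_bump_def by (auto intro!: prod_nonneg prod_le_1 simp: flat_def)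

lemma factor_pos_iff: "(a::real) < b \<Longrightarrow> 0 < (t - a) * (b - t) \<longleftrightarrow> a < t \<and> t < b"
  by (auto simp: zero_less_mult_iff)

lemma box_bump_pos_iff:
  assumes "\<And>i. a $ i < b $ i"
  shows "box_bump n a b x > 0 \<longleftrightarrow> x \<in> box a b"
proof -
  have "flat 0 (real (Suc n) * ((x $ i - a $ i) * (b $ i - x $ i))) > 0 \<longleftrightarrow>
      a $ i < x $ i \<and> x $ i < b $ i" for i
    using factor_pos_iff[OF assms[of i], of "x $ i"]
    by (auto simp: flat_def zero_less_mult_iff simp del: of_nat_Suc)
  moreover have "(\<Prod>i\<in>UNIV. flat 0 (y i)) > 0 \<longleftrightarrow> (\<forall>i. flat 0 (y i) > 0)" for y :: "'a \<Rightarrow> real"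
  proof
    assume pos: "(\<Prod>i\<in>UNIV. flat 0 (y i)) > 0"
    then have "flat 0 (y i) \<noteq> 0" for i
      by (metis UNIV_I finite less_irrefl prod_zero)
    moreover have "0 \<le> flat 0 t" for t by (simp add: flat_def)
    ultimately show "\<forall>i. flat 0 (y i) > 0" by (simp add: order_less_le)
  qed (simp add: prod_pos)
  ultimately show ?thesis unfolding box_bump_def by (simp only: mem_box_cart)
qed

lemma box_bump_eq_0:
  assumes "\<And>i. a $ i < b $ i" "x \<notin> box a b"
  shows "box_bump n a b x = 0"
  using box_bump_pos_iff[OF assms(1), where n = n and x = x] box_bump_bounds(1)[of n a b x] assms(2)
  by linarith

lemma box_bump_tendsto:
  assumes "\<And>i. a $ i < b $ i"
  shows "(\<lambda>n. box_bump n a b x) \<longlonglongrightarrow> indicator (box a b) x"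
proof (cases "x \<in> box a b")
  case True
  have "(\<lambda>n. flat 0 (real (Suc n) * ((x $ i - a $ i) * (b $ i - x $ i)))) \<longlonglongrightarrow> 1" for i
  proof -
    define c where "c = (x $ i - a $ i) * (b $ i - x $ i)"
    have c: "c > 0" using True by (auto simp: c_def mem_box_cart)
    have "(\<lambda>n. exp (- (1 / c) * (1 / real (Suc n)))) \<longlonglongrightarrow> exp (- (1 / c) * 0)"
      by (intro tendsto_intros LIMSEQ_Suc[OF lim_1_over_n])
    then show ?thesis
      using c unfolding c_def[symmetric] by (simp add: flat_def mult.commute del: of_nat_Suc)
  qed
  then have "(\<lambda>n. box_bump n a b x) \<longlonglongrightarrow> (\<Prod>i\<in>(UNIV::'a set). 1)"
    unfolding box_bump_def by (intro tendsto_prod)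
  then show ?thesis using True by simp
qed (simp add: box_bump_eq_0[OF assms])

lemma nn_integral_pos_part_eq_neg_part:
  fixes f :: "'a \<Rightarrow> real"
  assumes "integrable M f" "integral\<^sup>L M f = 0"
  shows "(\<integral>\<^sup>+x. ennreal (f x) \<partial>M) = (\<integral>\<^sup>+x. ennreal (- f x) \<partial>M)"
proof -
  have "(\<integral>\<^sup>+x. ennreal (f x) \<partial>M) < \<infinity>" "(\<integral>\<^sup>+x. ennreal (- f x) \<partial>M) < \<infinity>"
    using assms(1) by (auto simp: real_integrable_def less_top)
  moreover have "enn2real (\<integral>\<^sup>+x. ennreal (f x) \<partial>M) = enn2real (\<integral>\<^sup>+x. ennreal (- f x) \<partial>M)"
    using real_lebesgue_integral_def[OF assms(1)] assms(2) by simp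
  ultimately show ?thesis by (metis ennreal_enn2real infinity_ennreal_def)
qed

text \<open>The densities of the positive and the negative part of \<open>h\<close> agree on the generator of boxes.\<close>

lemma box_integrals_zero_imp_AE_zero_lborel:
  fixes h :: "'a::euclidean_space \<Rightarrow> real"
  assumes h: "integrable lborel h"
    and zero: "\<And>a b. (LINT x|lborel. indicator (box a b) x * h x) = 0"
  shows "AE x in lborel. h x = 0"
proof -
  have [measurable]: "h \<in> borel_measurable borel" using borel_measurable_integrable[OF h] by simp
  define M N where "M = density lborel (\<lambda>x. ennreal (h x))"
    and "N = density lborel (\<lambda>x. ennreal (- h x))"
  have fin: "(\<integral>\<^sup>+x. ennreal (h x) \<partial>lborel) \<noteq> \<infinity>" "(\<integral>\<^sup>+x. ennreal (- h x) \<partial>lborel) \<noteq> \<infinity>"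
    using h by (auto simp: real_integrable_def)
  have "M = N"
  proof (rule measure_eqI_generator_eq)
    let ?E = "range (\<lambda>(a, b). box a b :: 'a set)"
    let ?A = "\<lambda>n::nat. box (- (real n *\<^sub>R One)) (real n *\<^sub>R One) :: 'a set"
    show "Int_stable ?E" by (auto simp: Int_stable_def box_Int_box)
    show "?E \<subseteq> Pow UNIV" "sets M = sigma_sets UNIV ?E" "sets N = sigma_sets UNIV ?E"
      by (simp_all add: M_def N_def borel_eq_box)
    show "range ?A \<subseteq> ?E" "(\<Union>i. ?A i) = UNIV" unfolding UN_box_eq_UNIV by auto
    show "emeasure M (?A i) \<noteq> \<infinity>" for i
    proof -
      have "emeasure M (?A i) \<le> (\<integral>\<^sup>+x. ennreal (h x) \<partial>lborel)"
        unfolding M_def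
        by (subst emeasure_density) (auto intro!: nn_integral_mono simp: indicator_def)
      then show ?thesis using fin by (auto simp: top_unique)
    qed
    show "emeasure M X = emeasure N X" if mem: "X \<in> ?E" for X
    proof -
      obtain a b where X: "X = box a b" using mem by auto
      have indicator: "ennreal g * indicator X x = ennreal (indicator X x * g)" for x :: 'a and g
        by (auto simp: indicator_def)
      have "integrable lborel (\<lambda>x. indicator X x * h x)"
        using h by (simp add: X integrable_mult_indicator[where 'b = real, simplified])
      from nn_integral_pos_part_eq_neg_part[OF this] show ?thesis
        using zero[of a b] unfolding M_def N_def
        by (simp add: X emeasure_density indicator[unfolded X])
    qed
  qed
  then have "AE x in lborel. ennreal (h x) = ennreal (- h x)"
    using finite_density_unique[of "\<lambda>x. ennreal (h x)" lborel "\<lambda>x. ennreal (- h x)"] fin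
    by (simp add: M_def N_def)
  moreover have "y = 0" if "ennreal y = ennreal (- y)" for y
    using that by (cases "0 \<le> y") (auto simp: ennreal_neg ennreal_eq_0_iff dest: sym)
  ultimately show ?thesis by (auto elim: eventually_mono)
qed

lemma box_integrals_zero_imp_AE_zero:
  fixes h :: "'a::euclidean_space \<Rightarrow> real"
  assumes h: "integrable lebesgue h"
    and zero: "\<And>a b. (LINT x|lebesgue. indicator (box a b) x * h x) = 0"
  shows "AE x in lebesgue. h x = 0"
proof -
  have h_meas: "h \<in> borel_measurable lebesgue" using h by (rule borel_measurable_integrable)
  obtain g where g [measurable]: "g \<in> borel_measurable lborel" and eq: "AE x in lborel. h x = g x"
    using completion_ex_borel_measurable_real[OF h_meas] by blast
  have g_meas [measurable]: "g \<in> borel_measurable lebesgue" using g by (rule measurable_completion)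
  have eq_leb: "AE x in lebesgue. h x = g x" using eq by (rule AE_completion)
  have "integrable lebesgue g" using integrable_cong_AE_imp[OF h g_meas] eq_leb by auto
  then have "integrable lborel g" using g by (simp add: integrable_completion)
  moreover have "(LINT x|lborel. indicator (box a b) x * g x) = 0" for a b
  proof -
    have "(LINT x|lborel. indicator (box a b) x * g x) =
        (LINT x|lebesgue. indicator (box a b) x * g x)"
      by (rule integral_completion[symmetric]) measurable
    also have "\<dots> = (LINT x|lebesgue. indicator (box a b) x * h x)"
      using h_meas eq_leb
      by (intro integral_cong_AE) (auto intro!: borel_measurable_times borel_measurable_indicator)
    finally show ?thesis using zero by simp
  qed
  ultimately have "AE x in lborel. g x = 0" by (rule box_integrals_zero_imp_AE_zero_lborel)
  then show ?thesis using eq_leb by (auto dest: AE_completion)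
qed

lemma box_bump_test_function:
  assumes "\<And>i. a $ i < b $ i" "cbox a b \<subseteq> U"
  shows "box_bump n a b \<in> test_functions U"
proof (rule test_functionI[OF Ck_box_bump compact_cbox assms(2)])
  show "box_bump n a b x = 0" if "x \<notin> cbox a b" for x
    using that box_subset_cbox by (intro box_bump_eq_0[OF assms(1)]) blast
qed

lemma box_bump_integral_tendsto:
  assumes cd: "\<And>i. c $ i < d $ i" and h: "integrable lebesgue h"
  shows "(\<lambda>n. LINT x|lebesgue. box_bump n c d x * h x) \<longlonglongrightarrow>
      (LINT x|lebesgue. indicator (box c d) x * h x)"
proof (rule integral_dominated_convergence)
  have "continuous_on UNIV (box_bump n c d)" for n using Ck_box_bump[of 0 n c d] by simp
  then show "(\<lambda>x. box_bump n c d x * h x) \<in> borel_measurable lebesgue" for n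
    using h by (intro borel_measurable_times)
      (auto intro: continuous_imp_measurable_on_sets_lebesgue[of UNIV, simplified
          lebesgue_on_UNIV_eq])
  show "(\<lambda>x. indicator (box c d) x * h x) \<in> borel_measurable lebesgue"
    using h by (intro borel_measurable_times borel_measurable_indicator) auto
  show "integrable lebesgue (\<lambda>x. \<bar>h x\<bar>)" using h by simp
  show "AE x in lebesgue. (\<lambda>n. box_bump n c d x * h x) \<longlonglongrightarrow> indicator (box c d) x * h x"
    by (intro AE_I2 tendsto_mult_right box_bump_tendsto[OF cd])
  show "AE x in lebesgue. norm (box_bump n c d x * h x) \<le> \<bar>h x\<bar>" for n
    using box_bump_bounds[of n c d] by (intro AE_I2) (simp add: abs_mult mult_left_le_one_le)
qed

lemma test_functions_mult:
  assumes "\<phi> \<in> test_functions U" "\<And>k. Ck k \<psi>"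
  shows "(\<lambda>x. \<phi> x * \<psi> x) \<in> test_functions U"
proof -
  obtain K where "compact K" "K \<subseteq> U" "\<And>x. x \<notin> K \<Longrightarrow> \<phi> x = 0"
    using test_functionD(2)[OF assms(1)] by (rule compact_support_inE) blast
  then show ?thesis
    by (intro test_functionI[of _ K] Ck_mult test_functionD(1)[OF assms(1)] assms(2)) auto
qed

context
  fixes U :: "(real^'n::finite) set" and f :: "real^'n \<Rightarrow> real"
  assumes U: "open U"
    and orth: "\<And>\<phi>. \<phi> \<in> test_functions U \<Longrightarrow> integrable (lebesgue_on U) (\<lambda>x. f x * \<phi> x)"
      "\<And>\<phi>. \<phi> \<in> test_functions U \<Longrightarrow> (LINT x|lebesgue_on U. f x * \<phi> x) = 0"
begin

lemma du_bois_reymond_box: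
  assumes ab: "\<And>i. a $ i < b $ i" and sub: "cbox a b \<subseteq> U"
  shows "AE x in lebesgue. x \<in> box a b \<longrightarrow> f x = 0"
proof -
  have bump: "box_bump 0 a b \<in> test_functions U" by (rule box_bump_test_function[OF ab sub])
  define h where "h x = f x * box_bump 0 a b x" for x
  have off: "h x * g x = 0" if "x \<notin> U" for x g
    using that sub box_subset_cbox[of a b] box_bump_eq_0[OF ab, of x 0] by (auto simp: h_def)
  have h: "integrable lebesgue h"
    using orth(1)[OF bump] lebesgue_on_supported(1)[of U h] off[of _ "\<lambda>_. 1"] U
    unfolding h_def[abs_def] by simp
  have zero: "(LINT x|lebesgue. indicator (box c d) x * h x) = 0" if cd: "\<And>i. c $ i < d $ i" for c d
  proof (rule LIMSEQ_unique)
    show "(\<lambda>n. LINT x|lebesgue. box_bump n c d x * h x) \<longlonglongrightarrow>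
        (LINT x|lebesgue. indicator (box c d) x * h x)"
      by (rule box_bump_integral_tendsto[OF cd h])
    have "(LINT x|lebesgue. box_bump n c d x * h x) = 0" for n
    proof -
      have "(LINT x|lebesgue. h x * box_bump n c d x) =
          (LINT x|lebesgue_on U. h x * box_bump n c d x)"
        using U off by (intro lebesgue_on_supported(2)[symmetric]) auto
      also have "\<dots> = 0"
        using orth(2)[OF test_functions_mult[OF bump Ck_box_bump[where n = n and a = c and b = d]]]
        by (simp add: h_def mult_ac)
      finally show ?thesis by (simp add: mult.commute)
    qed
    then show "(\<lambda>n. LINT x|lebesgue. box_bump n c d x * h x) \<longlonglongrightarrow> 0" by simp
  qed
  have "AE x in lebesgue. h x = 0"
  proof (rule box_integrals_zero_imp_AE_zero[OF h])
    show "(LINT x|lebesgue. indicator (box c d) x * h x) = 0" for c d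
      using zero[of c d]
      by (cases "\<forall>i. c $ i < d $ i") (auto simp: not_less interval_eq_empty_cart(1)[THEN iffD2])
  qed
  then show ?thesis
  proof eventually_elim
    case (elim x)
    then show ?case using box_bump_pos_iff[OF ab, of 0 x] by (auto simp: h_def)
  qed
qed

lemma du_bois_reymond: "AE x in lebesgue_on U. f x = 0"
proof -
  obtain \<D> where \<D>: "countable \<D>" "\<D> \<subseteq> Pow U" "\<And>X. X \<in> \<D> \<Longrightarrow> \<exists>a b. X = cbox a b" "\<Union>\<D> = U"
    using open_countable_Union_open_cbox[OF U] by blast
  have "AE x in lebesgue. x \<in> X \<longrightarrow> f x = 0" if X: "X \<in> \<D>" for X
  proof -
    obtain a b where ab: "X = cbox a b" using \<D>(3)[OF X] by blast
    have "AE x in lebesgue. x \<in> box a b \<longrightarrow> f x = 0"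
    proof (cases "\<forall>i. a $ i < b $ i")
      case True
      then show ?thesis using du_bois_reymond_box[of a b] \<D>(2) X ab by auto
    next
      case False
      then have "box a b = {}" by (auto simp: not_less interval_eq_empty_cart(1))
      then show ?thesis by simp
    qed
    moreover have "AE x in lebesgue. x \<notin> cbox a b - box a b"
      by (rule AE_not_negligible[OF negligible_frontier_interval])
    ultimately show ?thesis by eventually_elim (simp add: ab)
  qed
  then have "AE x in lebesgue. \<forall>X\<in>\<D>. x \<in> X \<longrightarrow> f x = 0"
    unfolding AE_ball_countable[OF \<D>(1)] by blast
  then have "AE x in lebesgue. x \<in> U \<longrightarrow> f x = 0" by eventually_elim (use \<D>(4) in blast)
  then show ?thesis using U by (simp add: lebesgue_on_AE_iff)
qed

end

section \<open>Sobolev spaces of fields with a weak divergence\<close>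

lemma L2_cong_AE:
  fixes f g :: "'a::euclidean_space \<Rightarrow> 'b::euclidean_space"
  assumes "\<Omega> \<in> sets lebesgue" "f \<in> L2 \<Omega>" "AE x in lebesgue_on \<Omega>. f x = g x"
  shows "g \<in> L2 \<Omega>"
proof -
  have "AE x in lebesgue_on \<Omega>. (norm (f x))\<^sup>2 = (norm (g x))\<^sup>2"
    using assms(3) by eventually_elim simp
  then have "integrable (lebesgue_on \<Omega>) (\<lambda>x. (norm (g x))\<^sup>2)"
    by (rule integrable_lebesgue_on_cong_AE(1)[OF assms(1), rotated])
      (use assms(2) in \<open>simp add: L2_def\<close>)
  moreover have "g \<in> borel_measurable (lebesgue_on \<Omega>)"
    by (rule borel_measurable_lebesgue_on_cong_AE[OF assms(1) _ assms(3)])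
      (use assms(2) in \<open>simp add: L2_def\<close>)
  ultimately show ?thesis by (simp add: L2_def)
qed

lemma L2_component:
  fixes v :: "'a::euclidean_space \<Rightarrow> real^'n::finite"
  assumes "v \<in> L2 \<Omega>"
  shows "(\<lambda>x. v x $ k) \<in> L2 \<Omega>"
proof -
  have v: "v \<in> borel_measurable (lebesgue_on \<Omega>)" "integrable (lebesgue_on \<Omega>) (\<lambda>x. (norm (v x))\<^sup>2)"
    using assms by (auto simp: L2_def)
  have meas: "(\<lambda>x. v x $ k) \<in> borel_measurable (lebesgue_on \<Omega>)"
    using borel_measurable_inner[OF v(1) borel_measurable_const[of "axis k 1"]]
    by (simp add: inner_axis)
  have "(norm (v x $ k))\<^sup>2 \<le> (norm (v x))\<^sup>2" for x
    using component_le_norm_cart[of "v x" k] by (intro power_mono) auto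
  then have "integrable (lebesgue_on \<Omega>) (\<lambda>x. (norm (v x $ k))\<^sup>2)"
    using meas by (intro Bochner_Integration.integrable_bound[OF v(2)] AE_I2) auto
  then show ?thesis using meas by (simp add: L2_def)
qed

lemma L2_componentwise:
  fixes v :: "'a::euclidean_space \<Rightarrow> real^'n::finite"
  assumes "\<And>k. (\<lambda>x. v x $ k) \<in> L2 \<Omega>"
  shows "v \<in> L2 \<Omega>"
proof -
  have "(\<lambda>x. \<Sum>k\<in>UNIV. v x $ k *\<^sub>R (axis k 1 :: real^'n)) \<in> borel_measurable (lebesgue_on \<Omega>)"
    using assms by (intro borel_measurable_sum borel_measurable_scaleR) (auto simp: L2_def)
  then have "v \<in> borel_measurable (lebesgue_on \<Omega>)"
    by (simp add: basis_expansion scalar_mult_eq_scaleR[symmetric])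
  moreover have "integrable (lebesgue_on \<Omega>) (\<lambda>x. \<Sum>k\<in>UNIV. (norm (v x $ k))\<^sup>2)"
    using assms by (intro Bochner_Integration.integrable_sum) (simp add: L2_def)
  moreover have "(norm (v x))\<^sup>2 = (\<Sum>k\<in>UNIV. (norm (v x $ k))\<^sup>2)" for x
    by (simp add: norm_vec_def L2_set_def sum_nonneg)
  ultimately show ?thesis by (simp add: L2_def)
qed

lemma L2_bounded:
  fixes f :: "'a::euclidean_space \<Rightarrow> 'b::euclidean_space"
  assumes \<Omega>: "open \<Omega>" "bounded \<Omega>" and f: "f \<in> borel_measurable (lebesgue_on \<Omega>)"
    and B: "AE x in lebesgue_on \<Omega>. norm (f x) \<le> B"
  shows "f \<in> L2 \<Omega>"
proof -
  have sets: "\<Omega> \<in> sets (lebesgue_on \<Omega>)" using \<Omega> by (simp add: sets_restrict_space_iff)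
  have "emeasure lborel \<Omega> < \<infinity>" using \<Omega>(2) by (rule emeasure_bounded_finite)
  then have fin: "emeasure (lebesgue_on \<Omega>) \<Omega> < \<infinity>" using \<Omega>(1) by (simp add: emeasure_restrict_space)
  have meas: "(\<lambda>x. (norm (f x))\<^sup>2) \<in> borel_measurable (lebesgue_on \<Omega>)" using f by measurable
  have "AE x in lebesgue_on \<Omega>. x \<in> \<Omega> \<longrightarrow> norm ((norm (f x))\<^sup>2) \<le> B\<^sup>2"
    using B by eventually_elim (simp add: power_mono)
  then have "integrable (lebesgue_on \<Omega>) (\<lambda>x. (norm (f x))\<^sup>2)"
    by (intro integrableI_bounded_set[OF sets meas fin]) (auto intro: AE_I2)
  then show ?thesis using f by (simp add: L2_def)
qed

lemma L2_mult_test_function_integrable: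
  fixes f :: "real^'n::finite \<Rightarrow> real"
  assumes \<Omega>: "open \<Omega>" and f: "f \<in> L2 \<Omega>" and \<phi>: "\<phi> \<in> test_functions \<Omega>"
  shows "integrable (lebesgue_on \<Omega>) (\<lambda>x. f x * \<phi> x)"
proof -
  obtain K where K: "compact K" "K \<subseteq> \<Omega>" "\<And>x. x \<notin> K \<Longrightarrow> \<phi> x = 0"
    using test_functionD(2)[OF \<phi>] by (rule compact_support_inE) blast
  have cont: "continuous_on UNIV \<phi>" using test_functionD(1)[OF \<phi>, of 0] by simp
  have \<phi>_meas: "\<phi> \<in> borel_measurable (lebesgue_on \<Omega>)"
    by (rule borel_measurable_continuous_lebesgue_on[OF cont \<Omega>])
  have "bounded (\<phi> ` K)"
    using cont K(1) by (intro compact_imp_bounded compact_continuous_image)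
      (auto intro: continuous_on_subset)
  then obtain B where "\<forall>x\<in>K. \<bar>\<phi> x\<bar> \<le> B" unfolding bounded_iff by auto
  then have "\<bar>(\<phi> x)\<^sup>2\<bar> \<le> B\<^sup>2 * indicator K x" for x
    using K(3)[of x] power_mono[of "\<bar>\<phi> x\<bar>" B 2] by (cases "x \<in> K") auto
  then have \<phi>_sq: "integrable (lebesgue_on \<Omega>) (\<lambda>x. (\<phi> x)\<^sup>2)"
    using \<phi>_meas by (intro integrable_bounded_compact_support[OF \<Omega> K(1,2), of _ "B\<^sup>2"] AE_I2) auto
  have f_meas: "f \<in> borel_measurable (lebesgue_on \<Omega>)"
    and f_sq: "integrable (lebesgue_on \<Omega>) (\<lambda>x. (f x)\<^sup>2)"
    using f by (auto simp: L2_def)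
  show ?thesis
  proof (rule Bochner_Integration.integrable_bound[OF Bochner_Integration.integrable_add[OF f_sq
      \<phi>_sq]])
    show "AE x in lebesgue_on \<Omega>. norm (f x * \<phi> x) \<le> norm ((f x)\<^sup>2 + (\<phi> x)\<^sup>2)"
    proof (rule AE_I2)
      fix x
      have "2 * (\<bar>f x\<bar> * \<bar>\<phi> x\<bar>) \<le> (f x)\<^sup>2 + (\<phi> x)\<^sup>2"
        using sum_squares_bound[of "\<bar>f x\<bar>" "\<bar>\<phi> x\<bar>"] by (simp add: mult.assoc)
      moreover have "0 \<le> \<bar>f x\<bar> * \<bar>\<phi> x\<bar>" by simp
      ultimately have "\<bar>f x\<bar> * \<bar>\<phi> x\<bar> \<le> (f x)\<^sup>2 + (\<phi> x)\<^sup>2" by linarith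
      then show "norm (f x * \<phi> x) \<le> norm ((f x)\<^sup>2 + (\<phi> x)\<^sup>2)" by (simp add: abs_mult)
    qed
  qed (use f_meas \<phi>_meas in measurable)
qed

lemma weak_partial_iff:
  "weak_partial \<Omega> k u g \<longleftrightarrow> (\<forall>\<phi>\<in>test_functions \<Omega>.
     (LINT x|lebesgue_on \<Omega>. (u x *\<^sub>R axis k 1) \<bullet> (\<chi> i. partial i \<phi> x)) =
         - (LINT x|lebesgue_on \<Omega>. g x * \<phi> x))"
  by (simp add: weak_partial_def inner_axis')

lemma weak_curl_iff:
  "weak_curl \<Omega> v g \<longleftrightarrow> (\<forall>\<phi>\<in>test_functions \<Omega>.
     (LINT x|lebesgue_on \<Omega>. rot (v x) \<bullet> (\<chi> i. partial i \<phi> x)) =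
         - (LINT x|lebesgue_on \<Omega>. g x * \<phi> x))"
  by (auto simp: weak_curl_def rot_inner minus_equation_iff)

lemma weak_div_test_function:
  assumes "open U" "weak_div U V w" "\<phi> \<in> test_functions U"
  shows "integrable (lebesgue_on U) (\<lambda>x. w x * \<phi> x)"
    and "(LINT x|lebesgue_on U. V x \<bullet> (\<chi> i. partial i \<phi> x)) = - (LINT x|lebesgue_on U. w x * \<phi> x)"
  using weak_divD(2,3)[OF assms(2) test_function_has_ae_gradient[OF assms(3,1)]
      test_functionD(2)[OF assms(3)]]
  by blast+

text \<open>By the du Bois-Reymond lemma a weak divergence on \<open>\<Omega>\<close> agrees with one on \<open>U\<close>.\<close>

lemma weak_div_imp_L2:
  fixes U \<Omega> :: "(real^'n::finite) set"
  assumes op: "open U" "open \<Omega>" and sub: "U \<subseteq> \<Omega>" and neg: "negligible (\<Omega> - U)"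
    and div: "weak_div U V w" and g: "g \<in> L2 \<Omega>"
    and weak: "\<And>\<phi>. \<phi> \<in> test_functions \<Omega> \<Longrightarrow>
      (LINT x|lebesgue_on \<Omega>. V x \<bullet> (\<chi> i. partial i \<phi> x)) = - (LINT x|lebesgue_on \<Omega>. g x * \<phi> x)"
  shows "w \<in> L2 \<Omega>"
proof -
  have sets: "U \<in> sets lebesgue" "\<Omega> \<in> sets lebesgue" using op by auto
  note on_U = lebesgue_on_negligible_integral[OF sets sub neg]
  have "AE x in lebesgue_on U. w x - g x = 0"
  proof (rule du_bois_reymond[OF op(1)])
    fix \<phi> assume \<phi>: "\<phi> \<in> test_functions U"
    then have \<phi>\<Omega>: "\<phi> \<in> test_functions \<Omega>" using test_functions_mono[OF sub] by blast
    note w = weak_div_test_function[OF op(1) div \<phi>]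
    have g\<phi>: "integrable (lebesgue_on U) (\<lambda>x. g x * \<phi> x)"
      using L2_mult_test_function_integrable[OF op(2) g \<phi>\<Omega>] on_U(1) by blast
    then show "integrable (lebesgue_on U) (\<lambda>x. (w x - g x) * \<phi> x)"
      using w(1) by (simp add: left_diff_distrib)
    show "(LINT x|lebesgue_on U. (w x - g x) * \<phi> x) = 0"
      using weak[OF \<phi>\<Omega>] unfolding left_diff_distrib
      by (subst Bochner_Integration.integral_diff[OF w(1) g\<phi>]) (use w(2) in \<open>simp add: on_U(2)\<close>)
  qed
  then have "AE x in lebesgue_on \<Omega>. g x = w x"
    using lebesgue_on_negligible_AE[OF sets sub neg] by (auto elim!: eventually_mono)
  then show ?thesis by (rule L2_cong_AE[OF sets(2) g])
qed

lemma H1_imp_gradient_L2: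
  fixes U \<Omega> :: "(real^'n::finite) set"
  assumes "open U" "open \<Omega>" "U \<subseteq> \<Omega>" "negligible (\<Omega> - U)" "2 \<le> CARD('n)"
    and u: "has_ae_gradient U u v" "u \<in> H1 \<Omega>"
  shows "v \<in> L2 \<Omega>"
proof (rule L2_componentwise)
  fix k
  obtain g where g: "g \<in> L2 \<Omega>" "weak_partial \<Omega> k u g" using u(2) by (auto simp: H1_def)
  have div: "weak_div U (\<lambda>x. u x *\<^sub>R axis k 1) (\<lambda>x. v x $ k)"
    using weak_div_scaleR_const[OF assms(1) u(1), of "axis k 1"] assms(5) by (simp add: inner_axis)
  show "(\<lambda>x. v x $ k) \<in> L2 \<Omega>"
    using g(2) by (intro weak_div_imp_L2[OF assms(1-4) div g(1)]) (simp add: weak_partial_iff)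
qed

lemma Hcurl_imp_curl_L2:
  assumes "open U" "open \<Omega>" "U \<subseteq> \<Omega>" "negligible (\<Omega> - U)"
    and div: "weak_div U (\<lambda>x. rot (v x)) w" and v: "v \<in> Hcurl \<Omega>"
  shows "w \<in> L2 \<Omega>"
proof -
  obtain g where g: "g \<in> L2 \<Omega>" "weak_curl \<Omega> v g" using v by (auto simp: Hcurl_def)
  then show ?thesis by (intro weak_div_imp_L2[OF assms(1-4) div g(1)]) (simp add: weak_curl_iff)
qed

lemma bounded_images_common_bound:
  assumes "bounded (f ` X)" "bounded (g ` X)"
  obtains B where "\<And>x. x \<in> X \<Longrightarrow> norm (f x) \<le> B" "\<And>x. x \<in> X \<Longrightarrow> norm (g x) \<le> B"
proof -
  obtain A B where "\<forall>x\<in>X. norm (f x) \<le> A" "\<forall>x\<in>X. norm (g x) \<le> B"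
    using assms unfolding bounded_iff by auto
  then show thesis by (intro that[of "max A B"])
    (auto intro: order_trans max.cobounded1 max.cobounded2)
qed

lemma L2_bounded_punctured:
  fixes f :: "'a::euclidean_space \<Rightarrow> 'b::euclidean_space"
  assumes \<Omega>: "open \<Omega>" "bounded \<Omega>" and f: "f \<in> borel_measurable (lebesgue_on \<Omega>)"
    "bounded (f ` (\<Omega> - {a}))"
  shows "f \<in> L2 \<Omega>"
proof -
  obtain B where B: "\<forall>x\<in>\<Omega> - {a}. norm (f x) \<le> B" using f(2) unfolding bounded_iff by auto
  have "AE x in lebesgue_on \<Omega>. norm (f x) \<le> B"
    using AE_in_punctured_domain[OF \<Omega>(1), of a] by eventually_elim (use B in blast)
  then show ?thesis by (rule L2_bounded[OF \<Omega> f(1)])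
qed

lemma H1_punctured:
  fixes \<Omega> :: "(real^'n::finite) set"
  assumes \<Omega>: "open \<Omega>" "bounded \<Omega>" and dim: "2 \<le> CARD('n)"
    and grad: "has_ae_gradient (\<Omega> - {a}) u v"
    and meas: "u \<in> borel_measurable (lebesgue_on \<Omega>)" "v \<in> borel_measurable (lebesgue_on \<Omega>)"
    and bounded: "bounded (u ` (\<Omega> - {a}))" "bounded (v ` (\<Omega> - {a}))"
  shows "u \<in> H1 \<Omega>"
proof -
  obtain B where B: "\<And>x. x \<in> \<Omega> - {a} \<Longrightarrow> norm (u x) \<le> B" "\<And>x. x \<in> \<Omega> - {a} \<Longrightarrow> norm (v x) \<le> B"
    using bounded by (rule bounded_images_common_bound) blast
  have "weak_partial \<Omega> k u (\<lambda>x. v x $ k)" for k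
  proof -
    have "weak_div (\<Omega> - {a}) (\<lambda>x. u x *\<^sub>R axis k 1) (\<lambda>x. v x $ k)"
      using weak_div_scaleR_const[OF _ grad, of "axis k 1"] \<Omega>(1) dim
      by (simp add: inner_axis open_delete)
    then have "weak_div \<Omega> (\<lambda>x. u x *\<^sub>R axis k 1) (\<lambda>x. v x $ k)"
    proof (rule weak_div_insert_point[rotated 2])
      show "(\<lambda>x. u x *\<^sub>R axis k 1 :: real^'n) \<in> borel_measurable (lebesgue_on \<Omega>)"
        using meas(1) by (intro borel_measurable_scaleR) auto
      show "(\<lambda>x. v x $ k) \<in> borel_measurable (lebesgue_on \<Omega>)"
        using borel_measurable_inner[OF meas(2) borel_measurable_const[of "axis k 1"]]
        by (simp add: inner_axis)
      show "norm (u x *\<^sub>R axis k 1 :: real^'n) \<le> B" if "x \<in> \<Omega> - {a}" for x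
        using B(1)[OF that] by (simp add: norm_axis_1)
      show "\<bar>v x $ k\<bar> \<le> B" if "x \<in> \<Omega> - {a}" for x
        using B(2)[OF that] component_le_norm_cart[of "v x" k] by linarith
    qed (use \<Omega> dim in auto)
    then show ?thesis using weak_div_test_function(2)[OF \<Omega>(1)] unfolding weak_partial_iff by blast
  qed
  moreover have "u \<in> L2 \<Omega>" "v \<in> L2 \<Omega>"
    using L2_bounded_punctured[OF \<Omega>] meas bounded by blast+
  ultimately show ?thesis unfolding H1_def by (blast intro: L2_component)
qed

lemma Hcurl_punctured:
  assumes \<Omega>: "open \<Omega>" "bounded \<Omega>"
    and div: "weak_div (\<Omega> - {a}) (\<lambda>x. rot (v x)) w"
    and meas: "v \<in> borel_measurable (lebesgue_on \<Omega>)" "w \<in> borel_measurable (lebesgue_on \<Omega>)"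
    and bounded: "bounded (v ` (\<Omega> - {a}))" "bounded (w ` (\<Omega> - {a}))"
  shows "v \<in> Hcurl \<Omega>"
proof -
  obtain B where B: "\<And>x. x \<in> \<Omega> - {a} \<Longrightarrow> norm (v x) \<le> B" "\<And>x. x \<in> \<Omega> - {a} \<Longrightarrow> norm (w x) \<le> B"
    using bounded by (rule bounded_images_common_bound) blast
  have "rot \<in> borel_measurable borel"
    by (intro borel_measurable_continuous_onI linear_continuous_on
        linear_conv_bounded_linear[THEN iffD1] linear_rot)
  then have "(\<lambda>x. rot (v x)) \<in> borel_measurable (lebesgue_on \<Omega>)"
    by (rule measurable_compose[OF meas(1)])
  then have "weak_div \<Omega> (\<lambda>x. rot (v x)) w"
    using \<Omega> B by (intro weak_div_insert_point[OF _ _ div _ meas(2)]) (auto simp: norm_rot)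
  then have "weak_curl \<Omega> v w"
    using weak_div_test_function(2)[OF \<Omega>(1)] unfolding weak_curl_iff by blast
  moreover have "v \<in> L2 \<Omega>" "w \<in> L2 \<Omega>"
    using L2_bounded_punctured[OF \<Omega>] meas bounded by blast+
  ultimately show ?thesis by (auto simp: Hcurl_def)
qed

section \<open>B-splines\<close>

lemma bspline_cong:
  "(\<And>k. i \<le> k \<Longrightarrow> k \<le> i + p + 1 \<Longrightarrow> t k = t' k) \<Longrightarrow> bspline t p i x = bspline t' p i x"
proof (induction p arbitrary: i)
  case (Suc p)
  have "bspline t p i x = bspline t' p i x" "bspline t p (i + 1) x = bspline t' p (i + 1) x"
    by (rule Suc.IH; use Suc.prems in simp)+
  then show ?case using Suc.prems by simp
qed simp

lemma bspline_shift:
  assumes "\<And>m. t (m + k) = t m + a"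
  shows "bspline t p (i + k) (x + a) = bspline t p i x"
proof (induction p arbitrary: i)
  case 0
  then show ?case using assms[of i] assms[of "Suc i"] by simp
next
  case (Suc p)
  show ?case
    using assms[of i] assms[of "Suc i"] assms[of "i + p + 1"] assms[of "i + p + 2"]
      Suc.IH[of i] Suc.IH[of "i + 1"]
    by (simp add: algebra_simps)
qed

lemma bspline_support:
  assumes "mono t" "bspline t p i x \<noteq> 0"
  shows "t i \<le> x \<and> x < t (i + p + 1)"
  using assms(2)
proof (induction p arbitrary: i)
  case 0
  then show ?case by (auto split: if_splits)
next
  case (Suc p)
  then consider (left) "bspline t p i x \<noteq> 0" | (right) "bspline t p (i + 1) x \<noteq> 0" by fastforce
  then show ?case
  proof cases
    case left
    with Suc.IH[of i] monoD[OF assms(1), of "i + p + 1" "i + p + 2"] show ?thesis by simp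
  next
    case right
    with Suc.IH[of "i + 1"] monoD[OF assms(1), of i "i + 1"] show ?thesis by simp
  qed
qed

lemma bspline_eq_0:
  assumes "mono t" "x < t i \<or> t (i + p + 1) \<le> x"
  shows "bspline t p i x = 0"
  using bspline_support[OF assms(1), of p i x] assms(2) by force

lemma bspline_Suc_eq_convex:
  fixes t :: "nat \<Rightarrow> real" and p :: nat and x :: real
  assumes "mono t"
  defines "w \<equiv> \<lambda>i. (x - t i) / (t (i + p + 1) - t i)"
  shows "bspline t (Suc p) i x = w i * bspline t p i x + (1 - w (i + 1)) * bspline t p (i + 1) x"
proof -
  have "(t (i + p + 2) - x) / (t (i + p + 2) - t (i + 1)) = 1 - w (i + 1)"
    if "bspline t p (i + 1) x \<noteq> 0"
    using bspline_support[OF assms(1) that] by (simp add: w_def field_simps)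
  then show ?thesis by (cases "bspline t p (i + 1) x = 0") (simp_all add: w_def)
qed

lemma bspline_nonneg:
  assumes "mono t"
  shows "0 \<le> bspline t p i x"
proof (induction p arbitrary: i)
  case (Suc p)
  have "0 \<le> (x - t i) / (t (i + p + 1) - t i) * bspline t p i x"
    using bspline_support[OF assms, of p i x] Suc[of i] monoD[OF assms, of i "i + p + 1"]
    by (cases "bspline t p i x = 0") auto
  moreover have "0 \<le> (t (i + p + 2) - x) / (t (i + p + 2) - t (i + 1)) * bspline t p (i + 1) x"
    using bspline_support[OF assms, of p "i + 1" x] Suc[of "i + 1"]
        monoD[OF assms, of "i + 1" "i + p + 2"]
    by (cases "bspline t p (i + 1) x = 0") auto
  ultimately show ?case by simp
qed simp

lemma bspline_sum_le_1:
  assumes "mono t"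
  shows "(\<Sum>i\<le>n. bspline t p i x) \<le> 1"
proof (induction p arbitrary: n)
  case 0
  have "(\<Sum>i\<le>n. bspline t 0 i x) = (if t 0 \<le> x \<and> x < t (n + 1) then 1 else 0)"
  proof (induction n)
    case (Suc n)
    then show ?case
      using monoD[OF assms, of 0 "n + 1"] monoD[OF assms, of "n + 1" "n + 2"] by auto
  qed simp
  then show ?case by simp
next
  case (Suc p)
  define l where "l i = (x - t i) / (t (i + p + 1) - t i) * bspline t p i x" for i
  have l: "0 \<le> l i \<and> l i \<le> bspline t p i x" for i
  proof (cases "bspline t p i x = 0")
    case False
    define w where "w = (x - t i) / (t (i + p + 1) - t i)"
    have w: "0 \<le> w" "w \<le> 1" using bspline_support[OF assms False] by (auto simp: w_def)
    show ?thesis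
      unfolding l_def w_def[symmetric] using bspline_nonneg[OF assms] w
      by (intro conjI mult_nonneg_nonneg mult_left_le_one_le)
  qed (simp add: l_def)
  have "bspline t (Suc p) i x = l i - l (Suc i) + bspline t p (Suc i) x" for i
    using bspline_Suc_eq_convex[OF assms, of p i x]
    by (simp add: l_def algebra_simps del: bspline.simps)
  then have "(\<Sum>i\<le>n. bspline t (Suc p) i x) =
      (\<Sum>i\<le>n. l i - l (Suc i)) + (\<Sum>i\<le>n. bspline t p (Suc i) x)"
    by (simp only: sum.distrib)
  also have "\<dots> = l 0 - l (Suc n) + (\<Sum>i\<le>n. bspline t p (Suc i) x)" by (simp only: sum_telescope)
  also have "\<dots> \<le> bspline t p 0 x + (\<Sum>i\<le>n. bspline t p (Suc i) x)"
    using l[of "Suc n"] l[of 0] by linarith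
  also have "\<dots> = (\<Sum>i\<le>Suc n. bspline t p i x)" by (simp only: sum.atMost_Suc_shift)
  also have "\<dots> \<le> 1" by (rule Suc)
  finally show ?case .
qed

lemma bspline_le_1:
  assumes "mono t"
  shows "bspline t p i x \<le> 1"
proof -
  have "bspline t p i x \<le> (\<Sum>j\<le>i. bspline t p j x)"
    by (rule member_le_sum) (use bspline_nonneg[OF assms] in auto)
  also have "\<dots> \<le> 1" by (rule bspline_sum_le_1[OF assms])
  finally show ?thesis .
qed

lemma bspline_0_has_derivative:
  assumes "x \<notin> range t"
  shows "(bspline t 0 i has_real_derivative 0) (at x)"
proof -
  define e where "e = min \<bar>x - t i\<bar> \<bar>x - t (i + 1)\<bar>"
  have "x \<noteq> t i" "x \<noteq> t (i + 1)" using assms by auto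
  then have "e > 0" by (simp add: e_def)
  moreover have "bspline t 0 i y = bspline t 0 i x" if "dist y x < e" for y
    using that by (auto simp: e_def dist_real_def)
  ultimately have ev: "\<forall>\<^sub>F y in nhds x. bspline t 0 i y = bspline t 0 i x"
    unfolding eventually_nhds_metric by blast
  show ?thesis unfolding DERIV_cong_ev[OF refl ev refl] by (rule DERIV_const)
qed

text \<open>The product rule applied to the recursion and the induction hypothesis give the left-hand side; \<open>d\<close> and
  \<open>e\<close> are the reciprocal knot distances of degrees \<open>p + 1\<close> and \<open>p\<close>.\<close>

lemma bspline_derivative_recursion:
  fixes t :: "nat \<Rightarrow> real" and p :: nat and x :: real
  assumes "mono t"
  defines "e \<equiv> \<lambda>k. inverse (t (k + p) - t k)" and "d \<equiv> \<lambda>k. inverse (t (k + Suc p) - t k)"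
    and "B \<equiv> \<lambda>k. bspline t p k x" and "C \<equiv> \<lambda>k. bspline t (p - 1) k x"
  shows "real p * ((x - t i) * d i * (C i * e i - C (i + 1) * e (i + 1)) +
        (t (i + p + 2) - x) * d (i + 1) * (C (i + 1) * e (i + 1) - C (i + 2) * e (i + 2)))
      = real p * (d i * B i - d (i + 1) * B (i + 1))"
proof (cases p)
  case (Suc q)
  have B: "B k = (x - t k) * e k * C k + (t (k + p + 1) - x) * e (k + 1) * C (k + 1)" for k
    using Suc by (simp add: B_def C_def e_def divide_inverse add_ac)
  have "e (i + 1) * (d (i + 1) * (t (i + p + 2) - t (i + 1)) - d i * (t (i + p + 1) - t i)) = 0"
  proof (cases "e (i + 1) = 0")
    case False
    then have "t (i + 1) < t (i + 1 + p)"
      using monoD[OF assms(1), of "i + 1" "i + 1 + p"] by (auto simp: e_def)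
    then have "t (i + 1) < t (i + p + 2)" "t i < t (i + p + 1)"
      using monoD[OF assms(1), of "i + 1 + p" "i + p + 2"] monoD[OF assms(1), of i "i + 1"]
      by (auto simp: add_ac)
    then show ?thesis by (simp add: d_def)
  qed simp
  then have "e (i + 1) * ((t (i + p + 2) - x) * d (i + 1) - (x - t i) * d i)
     = e (i + 1) * (d i * (t (i + p + 1) - x) - d (i + 1) * (x - t (i + 1)))"
    by (simp add: algebra_simps)
  then have "C (i + 1) * (e (i + 1) * ((t (i + p + 2) - x) * d (i + 1) - (x - t i) * d i))
     = C (i + 1) * (e (i + 1) * (d i * (t (i + p + 1) - x) - d (i + 1) * (x - t (i + 1))))"
    by simp
  then show ?thesis unfolding B by (simp add: algebra_simps)
qed simp

lemma bspline_has_derivative: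
  assumes "mono t" and "x \<notin> range t"
  shows "(bspline t p i has_real_derivative
     real p * (bspline t (p - 1) i x / (t (i + p) - t i) -
               bspline t (p - 1) (i + 1) x / (t (i + p + 1) - t (i + 1)))) (at x)"
proof (induction p arbitrary: i)
  case 0
  show ?case using bspline_0_has_derivative[OF assms(2)] by (simp del: bspline.simps)
next
  case (Suc p)
  define e where "e k = inverse (t (k + p) - t k)" for k
  define d where "d k = inverse (t (k + Suc p) - t k)" for k
  let ?B = "\<lambda>k. bspline t p k x" and ?C = "\<lambda>k. bspline t (p - 1) k x"
  have IH: "(bspline t p k has_real_derivative
      real p * (?C k * e k - ?C (k + 1) * e (k + 1))) (at x)"
    for k using Suc.IH[of k] by (simp add: e_def divide_inverse add_ac del: bspline.simps)
  have eq: "bspline t (Suc p) i = (\<lambda>x. (x - t i) * d i * bspline t p i x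
      + (t (i + p + 2) - x) * d (i + 1) * bspline t p (i + 1) x)"
    by (rule ext) (simp add: d_def divide_inverse add_ac)
  have "real p * ((x - t i) * d i * (?C i * e i - ?C (i + 1) * e (i + 1)) +
        (t (i + p + 2) - x) * d (i + 1) * (?C (i + 1) * e (i + 1) - ?C (i + 2) * e (i + 2)))
      = real p * (d i * ?B i - d (i + 1) * ?B (i + 1))"
    unfolding d_def e_def by (rule bspline_derivative_recursion[OF assms(1)])
  then have "(bspline t (Suc p) i has_real_derivative
      (1 + real p) * (d i * ?B i - d (i + 1) * ?B (i + 1))) (at x)"
    unfolding eq using IH[of i] IH[of "i + 1"]
    by (auto intro!: derivative_eq_intros simp: algebra_simps)
  then show ?case by (simp add: d_def divide_inverse add_ac mult.commute del: bspline.simps)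
qed

lemma borel_measurable_bspline [measurable]: "bspline t p i \<in> borel_measurable borel"
proof (induction p arbitrary: i)
  case 0
  have "bspline t 0 i = indicator {t i..<t (i + 1)}" by (auto simp: indicator_def fun_eq_iff)
  then show ?case by simp
next
  case (Suc p)
  note [measurable] = Suc
  have "bspline t (Suc p) i = (\<lambda>x. (x - t i) / (t (i + p + 1) - t i) * bspline t p i x +
     (t (i + p + 2) - x) / (t (i + p + 2) - t (i + 1)) * bspline t p (i + 1) x)"
    by (rule ext) simp
  then show ?case by simp
qed

lemma loc_lipschitz_affine:
  fixes X :: "real set"
  shows "loc_lipschitz X (\<lambda>x. (x - a) / b)" "loc_lipschitz X (\<lambda>x. (a - x) / b)"
  by (rule lipschitz_on_imp_loc_lipschitz[of "1 / \<bar>b\<bar>"], rule lipschitz_onI;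
      auto simp: dist_real_def diff_divide_distrib[symmetric] abs_divide abs_minus_commute)+

text \<open>Repeated knots make splines discontinuous, so they are only admitted at the ends of \<open>X\<close>.\<close>

lemma loc_lipschitz_hat:
  fixes a b c :: real
  defines "u \<equiv> \<lambda>x. (x - a) / (b - a)" and "v \<equiv> \<lambda>x. (c - x) / (c - b)"
  assumes "a \<le> b" "b \<le> c"
    and double_left: "a = b \<Longrightarrow> X \<subseteq> {b..} \<or> X \<subseteq> {..<b}"
      and double_right: "b = c \<Longrightarrow> X \<subseteq> {b..} \<or> X \<subseteq> {..<b}"
  shows "loc_lipschitz X (\<lambda>x. u x * of_bool (a \<le> x \<and> x < b) + v x * of_bool (b \<le> x \<and> x < c))"
    (is "loc_lipschitz X ?f")
proof -
  have zero: "loc_lipschitz X (\<lambda>x. 0)" by (rule loc_lipschitz_const)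
  have u: "loc_lipschitz X (\<lambda>x. max 0 (u x))" and v: "loc_lipschitz X (\<lambda>x. max 0 (v x))"
    unfolding u_def v_def by (intro loc_lipschitz_max zero loc_lipschitz_affine)+
  have uv: "loc_lipschitz X (\<lambda>x. min (max 0 (u x)) (max 0 (v x)))"
    by (rule loc_lipschitz_min[OF u v])
  consider (double) "a = b" "b = c" | (left) "a = b" "b < c" "X \<subseteq> {b..}"
    | (left_outside) "a = b" "b < c" "X \<subseteq> {..<b}"
    | (right_outside) "a < b" "b = c" "X \<subseteq> {b..}" | (right) "a < b" "b = c" "X \<subseteq> {..<b}"
    | (simple) "a < b" "b < c"
    using \<open>a \<le> b\<close> \<open>b \<le> c\<close> double_left double_right unfolding order_le_less by blast
  then show ?thesis
  proof cases
    case left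
    then show ?thesis by (intro loc_lipschitz_cong[OF v])
      (auto simp: u_def v_def max_def field_simps)
  next
    case right
    then show ?thesis by (intro loc_lipschitz_cong[OF u])
      (auto simp: u_def v_def max_def field_simps)
  next
    case simple
    then have signs: "0 \<le> u x \<longleftrightarrow> a \<le> x" "0 \<le> v x \<longleftrightarrow> x \<le> c" for x
      by (auto simp: u_def v_def zero_le_divide_iff)
    have "min (max 0 (u x)) (max 0 (v x)) = ?f x" for x
    proof (cases "x < b")
      case True
      then have "u x \<le> 1" "1 \<le> v x" using simple by (simp_all add: u_def v_def field_simps)
      then show ?thesis using True signs(1)[of x] by (auto simp: max_def)
    next
      case False
      then have "v x \<le> 1" "1 \<le> u x" using simple by (simp_all add: u_def v_def field_simps)
      moreover have "v c = 0" by (simp add: v_def)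
      ultimately show ?thesis
        using False signs(2)[of x] simple by (cases "x = c") (auto simp: max_def)
    qed
    then show ?thesis by (rule loc_lipschitz_cong[OF uv])
  qed (intro loc_lipschitz_cong[OF zero]; fastforce)+
qed

lemma loc_lipschitz_bspline:
  assumes "mono t" and double: "\<And>k. t k = t (Suc k) \<Longrightarrow> X \<subseteq> {t k..} \<or> X \<subseteq> {..<t k}" and "p \<ge> 1"
  shows "loc_lipschitz X (bspline t p i)"
  using \<open>p \<ge> 1\<close>
proof (induction p arbitrary: i rule: dec_induct)
  case base
  have "loc_lipschitz X (\<lambda>x. (x - t i) / (t (i + 1) - t i) * of_bool (t i \<le> x \<and> x < t (i + 1)) +
      (t (i + 2) - x) / (t (i + 2) - t (i + 1)) * of_bool (t (i + 1) \<le> x \<and> x < t (i + 2)))"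
    using double[of i] double[of "Suc i"] by (intro loc_lipschitz_hat monoD[OF assms(1)]) auto
  then show ?case
    by (rule loc_lipschitz_cong) (auto simp: of_bool_def numeral_2_eq_2)
next
  case (step p)
  have "loc_lipschitz X (\<lambda>x. (x - t i) / (t (i + p + 1) - t i) * bspline t p i x +
     (t (i + p + 2) - x) / (t (i + p + 2) - t (i + 1)) * bspline t p (i + 1) x)"
    by (intro loc_lipschitz_add loc_lipschitz_mult loc_lipschitz_affine step.IH)
  then show ?case
    by (rule loc_lipschitz_cong) simp
qed

section \<open>Periodic splines\<close>

lemma sum_cyclic_shift:
  fixes f :: "nat \<Rightarrow> 'a::comm_monoid_add"
  shows "(\<Sum>j<n. f ((j + 1) mod n)) = (\<Sum>j<n. f j)"
proof (cases n)
  case (Suc m)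
  have "(\<Sum>j<m. f ((j + 1) mod n)) = (\<Sum>j<m. f (Suc j))" by (intro sum.cong) (auto simp: Suc)
  then have "(\<Sum>j<n. f ((j + 1) mod n)) = (\<Sum>j<m. f (Suc j)) + f 0" by (simp add: Suc)
  also have "\<dots> = (\<Sum>j<n. f j)" unfolding Suc sum.lessThan_Suc_shift by (rule add.commute)
  finally show ?thesis .
qed simp

lemma shift_into_period:
  fixes t :: real
  obtains k :: int where "0 \<le> t + 2 * pi * of_int k" "t + 2 * pi * of_int k < 2 * pi"
proof -
  have "0 \<le> frac (t / (2 * pi)) * (2 * pi)" "frac (t / (2 * pi)) * (2 * pi) < 2 * pi"
    by (simp_all add: frac_lt_1)
  moreover have "frac (t / (2 * pi)) * (2 * pi) = t + 2 * pi * of_int (- \<lfloor>t / (2 * pi)\<rfloor>)"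
    by (simp add: frac_def algebra_simps)
  ultimately show ?thesis using that by metis
qed

locale periodic_knots =
  fixes nt :: nat
  assumes nt_pos: "nt > 0"
begin

abbreviation "\<tau> \<equiv> \<lambda>m::nat. real m * dtheta nt"

lemma dtheta_pos: "dtheta nt > 0"
  using nt_pos by (simp add: dtheta_def)

lemma nt_dtheta: "real nt * dtheta nt = 2 * pi"
  using nt_pos by (simp add: dtheta_def)

lemma mono_\<tau>: "mono \<tau>"
  using dtheta_pos by (auto intro!: monoI mult_right_mono)

lemma bspline_\<tau>_eq_0:
  assumes "\<bar>x\<bar> + \<tau> (j + q + 1) \<le> \<bar>of_int k\<bar>"
  shows "bspline \<tau> q j (x + 2 * pi * of_int k) = 0"
proof (rule bspline_eq_0[OF mono_\<tau>])
  have "0 < \<tau> (j + q + 1)" "0 \<le> \<tau> j" using dtheta_pos by auto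
  moreover have "\<bar>of_int k\<bar> \<le> 2 * pi * \<bar>of_int k\<bar>" using pi_gt3 by (simp add: mult_le_cancel_right1)
  moreover consider "\<bar>real_of_int k\<bar> = of_int k" | "\<bar>real_of_int k\<bar> = - of_int k" by linarith
  ultimately show "x + 2 * pi * of_int k < \<tau> j \<or> \<tau> (j + q + 1) \<le> x + 2 * pi * of_int k"
    using assms by cases (simp_all only:; linarith)+
qed

lemma periodic_bspline_eq_sum:
  assumes "\<bar>x\<bar> + \<tau> (j + q + 1) \<le> real n"
  shows "periodic_bspline nt q j x = (\<Sum>k\<in>{- int n..int n}. bspline \<tau> q j (x + 2 * pi * of_int k))"
proof -
  have "bspline \<tau> q j (x + 2 * pi * of_int k) = 0" if "k \<notin> {- int n..int n}" for k
  proof (rule bspline_\<tau>_eq_0)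
    have "int n < \<bar>k\<bar>" using that by auto
    then have "real n < \<bar>of_int k\<bar>" by linarith
    then show "\<bar>x\<bar> + \<tau> (j + q + 1) \<le> \<bar>of_int k\<bar>" using assms by linarith
  qed
  then have "periodic_bspline nt q j x =
      (\<Sum>\<^sub>\<infinity>k\<in>{- int n..int n}. bspline \<tau> q j (x + 2 * pi * of_int k))"
    unfolding periodic_bspline_def by (intro infsum_cong_neutral) auto
  then show ?thesis by simp
qed

lemma periodic_bspline_nonneg: "0 \<le> periodic_bspline nt q j x"
  unfolding periodic_bspline_def by (intro infsum_nonneg bspline_nonneg mono_\<tau>)

lemma periodic_bspline_shift:
  "periodic_bspline nt q j (x + 2 * pi * of_int k) = periodic_bspline nt q j x"
proof -
  have "bij_betw (\<lambda>l::int. k + l) UNIV UNIV"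
    by (rule bij_betwI[of _ _ _ "\<lambda>l. l - k"]) auto
  from infsum_reindex_bij_betw[OF this, of "\<lambda>k. bspline \<tau> q j (x + 2 * pi * of_int k)"]
  show ?thesis unfolding periodic_bspline_def by (simp add: algebra_simps)
qed

lemma periodic_bspline_translate:
  "periodic_bspline nt q (j + m) x = periodic_bspline nt q j (x - \<tau> m)"
proof -
  have "bspline \<tau> q (j + m) (y + \<tau> m) = bspline \<tau> q j y" for y
    by (rule bspline_shift) (simp add: distrib_right)
  from this[of "x - \<tau> m + 2 * pi * of_int k" for k] show ?thesis
    unfolding periodic_bspline_def by (simp add: algebra_simps)
qed

lemma periodic_bspline_mod: "periodic_bspline nt q (j mod nt) x = periodic_bspline nt q j x"
proof -
  have "x - \<tau> (j div nt * nt) = x + 2 * pi * of_int (- int (j div nt))"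
    using nt_dtheta by (simp add: mult.assoc)
  then have "periodic_bspline nt q (j mod nt + j div nt * nt) x =
      periodic_bspline nt q (j mod nt) x"
    unfolding periodic_bspline_translate by (simp only: periodic_bspline_shift)
  then show ?thesis by simp
qed

lemma borel_measurable_periodic_bspline [measurable]:
  "periodic_bspline nt q j \<in> borel_measurable borel"
proof (rule borel_measurable_LIMSEQ_real)
  fix x :: real
  obtain N where N: "\<bar>x\<bar> + \<tau> (j + q + 1) \<le> real N" using real_arch_simple by blast
  have "(\<Sum>k\<in>{- int n..int n}. bspline \<tau> q j (x + 2 * pi * of_int k)) = periodic_bspline nt q j x"
    if "N \<le> n" for n
    using periodic_bspline_eq_sum[of x j q n] N that by simp
  then show "(\<lambda>n. \<Sum>k\<in>{- int n..int n}. bspline \<tau> q j (x + 2 * pi * of_int k)) \<longlonglongrightarrow>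
      periodic_bspline nt q j x"
    by (intro tendsto_eventually) (auto simp: eventually_sequentially)
qed measurable

lemma loc_lipschitz_periodic_bspline:
  assumes "q \<ge> 1"
  shows "loc_lipschitz UNIV (periodic_bspline nt q j)"
proof (rule loc_lipschitz_locallyI)
  fix x :: real
  obtain n where n: "\<bar>x\<bar> + 1 + \<tau> (j + q + 1) \<le> real n" using real_arch_simple by blast
  have "loc_lipschitz UNIV (\<lambda>y. bspline \<tau> q j (y + a))" for a
  proof (rule loc_lipschitz_compose[where f = "\<lambda>y. y + a"])
    show "loc_lipschitz UNIV (\<lambda>y. y + a)"
      by (rule lipschitz_on_imp_loc_lipschitz[of 1]) (auto simp: lipschitz_on_def)
    show "loc_lipschitz UNIV (bspline \<tau> q j)"
      using dtheta_pos by (intro loc_lipschitz_bspline mono_\<tau> assms) auto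
  qed simp
  then have "loc_lipschitz (ball x 1)
      (\<lambda>y. \<Sum>k\<in>{- int n..int n}. bspline \<tau> q j (y + 2 * pi * of_int k))"
    by (intro loc_lipschitz_sum) (blast intro: loc_lipschitz_subset)
  then have "loc_lipschitz (ball x 1) (periodic_bspline nt q j)"
  proof (rule loc_lipschitz_cong)
    fix y assume "y \<in> ball x 1"
    then have "\<bar>y\<bar> + \<tau> (j + q + 1) \<le> real n" using n by (auto simp: dist_real_def)
    then show "(\<Sum>k\<in>{- int n..int n}. bspline \<tau> q j (y + 2 * pi * of_int k)) =
        periodic_bspline nt q j y"
      by (rule periodic_bspline_eq_sum[symmetric])
  qed
  then show "\<exists>Y. open Y \<and> x \<in> Y \<and> loc_lipschitz Y (periodic_bspline nt q j)"
    by (intro exI[of _ "ball x 1"]) auto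
qed

definition knots :: "real set" where
  "knots = range (\<lambda>k::int. of_int k * dtheta nt)"

lemma knots_shift: "x + of_int m * dtheta nt \<in> knots \<longleftrightarrow> x \<in> knots"
proof -
  have shift: "y + of_int m * dtheta nt \<in> knots" if y: "y \<in> knots" for y and m :: int
  proof -
    obtain l where "y = of_int l * dtheta nt" using y by (auto simp: knots_def)
    then have "y + of_int m * dtheta nt = of_int (l + m) * dtheta nt" by (simp add: algebra_simps)
    then show ?thesis unfolding knots_def by blast
  qed
  from shift[of x m] shift[of "x + of_int m * dtheta nt" "- m"] show ?thesis by auto
qed

lemma knots_period: "x + 2 * pi * of_int k \<in> knots \<longleftrightarrow> x \<in> knots"
proof -
  have "2 * pi * of_int k = of_int (int nt * k) * dtheta nt" using nt_dtheta by simp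
  then show ?thesis by (simp only: knots_shift)
qed

lemma countable_knots: "countable knots"
  by (simp add: knots_def)

lemma closed_knots: "closed knots"
proof -
  have "knots = (\<lambda>x. dtheta nt *\<^sub>R x) ` (of_int ` UNIV)"
    by (auto simp: knots_def mult.commute)
  then show ?thesis using closed_scaling[OF closed_of_int_image[of UNIV], of "dtheta nt"] by metis
qed

lemma bspline_\<tau>_has_derivative:
  assumes "x \<notin> range \<tau>"
  shows "(bspline \<tau> q j has_real_derivative
     (if q = 0 then 0 else (bspline \<tau> (q - 1) j x - bspline \<tau> (q - 1) (j + 1) x) / dtheta nt))
         (at x)"
proof -
  have "\<tau> (j + q) - \<tau> j = real q * dtheta nt" "\<tau> (j + q + 1) - \<tau> (j + 1) = real q * dtheta nt"
    by (simp_all add: algebra_simps)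
  moreover have "real q * (a / (real q * dtheta nt) - b / (real q * dtheta nt)) =
      (if q = 0 then 0 else (a - b) / dtheta nt)"
    for a b using dtheta_pos by (simp add: field_simps)
  ultimately show ?thesis
    using bspline_has_derivative[OF mono_\<tau> assms, of q j] by (simp only:)
qed

lemma periodic_bspline_has_derivative:
  assumes "x \<notin> knots"
  shows "(periodic_bspline nt q j has_real_derivative (if q = 0 then 0 else
     (periodic_bspline nt (q - 1) j x - periodic_bspline nt (q - 1) (j + 1) x) / dtheta nt)) (at x)"
proof -
  obtain n where n: "\<bar>x\<bar> + 1 + \<tau> (j + q + 1) \<le> real n" using real_arch_simple by blast
  let ?sum = "\<lambda>q j y. \<Sum>k\<in>{- int n..int n}. bspline \<tau> q j (y + 2 * pi * of_int k)"
  let ?D = "\<lambda>k. if q = 0 then 0 else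
    (bspline \<tau> (q - 1) j (x + 2 * pi * of_int k) - bspline \<tau> (q - 1) (j + 1)
        (x + 2 * pi * of_int k)) / dtheta nt"
  have sum: "periodic_bspline nt q' j' y = ?sum q' j' y" if "j' + q' \<le> j + q" "dist y x < 1"
    for q' j' y
  proof (rule periodic_bspline_eq_sum)
    have "\<tau> (j' + q' + 1) \<le> \<tau> (j + q + 1)" using that(1) by (intro monoD[OF mono_\<tau>]) simp
    then show "\<bar>y\<bar> + \<tau> (j' + q' + 1) \<le> real n" using that(2) n unfolding dist_real_def by linarith
  qed
  have "((\<lambda>y. bspline \<tau> q j (y + 2 * pi * of_int k)) has_real_derivative ?D k) (at x)" for k
  proof -
    have "of_int (int m) * dtheta nt \<in> knots" for m unfolding knots_def by (rule rangeI)
    then have "range \<tau> \<subseteq> knots" by auto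
    then have "x + 2 * pi * of_int k \<notin> range \<tau>" using assms knots_period[of x k] by blast
    from bspline_\<tau>_has_derivative[OF this, of q j] show ?thesis by (simp only: DERIV_shift)
  qed
  then have "(?sum q j has_real_derivative (\<Sum>k\<in>{- int n..int n}. ?D k)) (at x)" by (intro DERIV_sum)
  moreover have "(\<Sum>k\<in>{- int n..int n}. ?D k) = (if q = 0 then 0 else
      (periodic_bspline nt (q - 1) j x - periodic_bspline nt (q - 1) (j + 1) x) / dtheta nt)"
    using sum[of j "q - 1" x] sum[of "j + 1" "q - 1" x]
    by (simp add: sum_divide_distrib[symmetric] sum_subtractf)
  moreover have "\<forall>\<^sub>F y in nhds x. ?sum q j y = periodic_bspline nt q j y"
    unfolding eventually_nhds_metric using sum by (intro exI[of _ 1]) simp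
  ultimately show ?thesis by (simp only: DERIV_cong_ev[OF refl _ refl])
qed

lemma periodic_bspline_0:
  assumes "j < nt" "0 \<le> x" "x < 2 * pi"
  shows "periodic_bspline nt 0 j x = of_bool (\<tau> j \<le> x \<and> x < \<tau> (j + 1))"
proof -
  have "\<tau> (j + 1) \<le> 2 * pi"
    using monoD[OF mono_\<tau>, of "j + 1" nt] assms(1) nt_dtheta by simp
  have "bspline \<tau> 0 j (x + 2 * pi * of_int k) = 0" if nz: "k \<noteq> 0" for k
  proof (rule bspline_eq_0[OF mono_\<tau>])
    consider (neg) "k \<le> - 1" | (pos) "1 \<le> k" using nz by linarith
    then show "x + 2 * pi * of_int k < \<tau> j \<or> \<tau> (j + 0 + 1) \<le> x + 2 * pi * of_int k"
    proof cases
      case neg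
      then have "2 * pi * of_int k \<le> 2 * pi * (- 1)" by (intro mult_left_mono) auto
      moreover have "0 \<le> \<tau> j" using dtheta_pos by simp
      ultimately show ?thesis using assms by linarith
    next
      case pos
      then have "2 * pi * 1 \<le> 2 * pi * of_int k" by (intro mult_left_mono) auto
      moreover have "\<tau> (j + 0 + 1) \<le> 2 * pi" using \<open>\<tau> (j + 1) \<le> 2 * pi\<close> by simp
      ultimately show ?thesis using assms by linarith
    qed
  qed
  then have "periodic_bspline nt 0 j x = (\<Sum>\<^sub>\<infinity>k\<in>{0::int}. bspline \<tau> 0 j (x + 2 * pi * of_int k))"
    unfolding periodic_bspline_def by (intro infsum_cong_neutral) auto
  then show ?thesis by simp
qed

lemma interval_index:
  assumes "0 \<le> x" "x < 2 * pi"
  obtains i where "i < nt" "\<And>j. \<tau> j \<le> x \<and> x < \<tau> (j + 1) \<longleftrightarrow> j = i"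
proof -
  define i where "i = nat \<lfloor>x / dtheta nt\<rfloor>"
  have i: "\<lfloor>x / dtheta nt\<rfloor> = int i" using assms dtheta_pos by (simp add: i_def)
  have iff: "\<tau> j \<le> x \<and> x < \<tau> (j + 1) \<longleftrightarrow> j = i" for j
  proof -
    have "\<tau> j \<le> x \<and> x < \<tau> (j + 1) \<longleftrightarrow> \<lfloor>x / dtheta nt\<rfloor> = int j"
      using dtheta_pos by (simp add: floor_eq_iff pos_le_divide_eq pos_divide_less_eq algebra_simps)
    then show ?thesis using i by auto
  qed
  moreover have "i < nt"
  proof (rule ccontr)
    assume "\<not> i < nt"
    then have "2 * pi \<le> \<tau> i" using monoD[OF mono_\<tau>, of nt i] nt_dtheta by simp
    then show False using iff[of i] assms by simp
  qed
  ultimately show ?thesis using that by blast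
qed

lemma summable_bspline_\<tau>: "(\<lambda>k::int. c k * bspline \<tau> q j (x + 2 * pi * of_int k)) summable_on UNIV"
proof -
  obtain n where n: "\<bar>x\<bar> + \<tau> (j + q + 1) \<le> real n" using real_arch_simple by blast
  have "{k. bspline \<tau> q j (x + 2 * pi * of_int k) \<noteq> 0} \<subseteq> {- int n..int n}"
  proof
    fix k assume "k \<in> {k. bspline \<tau> q j (x + 2 * pi * of_int k) \<noteq> 0}"
    then have "\<not> \<bar>x\<bar> + \<tau> (j + q + 1) \<le> \<bar>of_int k\<bar>" using bspline_\<tau>_eq_0[of x j q k] by blast
    then have "\<bar>k\<bar> < int n" using n by linarith
    then show "k \<in> {- int n..int n}" by auto
  qed
  then have "finite {k. c k * bspline \<tau> q j (x + 2 * pi * of_int k) \<noteq> 0}"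
    by (rule finite_subset[rotated, OF finite_subset]) auto
  then show ?thesis by (intro finite_nonzero_values_imp_summable_on) simp
qed

lemma periodic_bspline_Suc:
  obtains A where "\<And>j. periodic_bspline nt (Suc q) j x =
      A j - A (Suc j) + periodic_bspline nt q (Suc j) x" "A nt = A 0"
proof -
  define w where "w j y = (y - \<tau> j) / (\<tau> (j + q + 1) - \<tau> j)" for j y
  define f where "f j k = w j (x + 2 * pi * of_int k) * bspline \<tau> q j (x + 2 * pi * of_int k)"
    for j and k :: int
  have f: "f j summable_on UNIV" for j
    unfolding f_def[abs_def] by (rule summable_bspline_\<tau>)
  have rec: "bspline \<tau> (Suc q) j (x + 2 * pi * of_int k) + f (Suc j) k
      = f j k + bspline \<tau> q (Suc j) (x + 2 * pi * of_int k)" for j k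
    unfolding bspline_Suc_eq_convex[OF mono_\<tau>] f_def w_def
    by (simp add: left_diff_distrib del: of_nat_Suc bspline.simps)
  have B: "(\<lambda>k. bspline \<tau> q' j (x + 2 * pi * of_int k)) summable_on UNIV" for q' j
    using summable_bspline_\<tau>[of "\<lambda>_. 1"] by simp
  have "periodic_bspline nt (Suc q) j x + infsum (f (Suc j)) UNIV =
      infsum (f j) UNIV + periodic_bspline nt q (Suc j) x" for j
    unfolding periodic_bspline_def infsum_add[OF B f, symmetric] infsum_add[OF f B, symmetric]
      rec by (rule refl)
  then have "periodic_bspline nt (Suc q) j x = infsum (f j) UNIV - infsum (f (Suc j)) UNIV
      + periodic_bspline nt q (Suc j) x" for j by (simp add: algebra_simps)
  moreover have "infsum (f nt) UNIV = infsum (f 0) UNIV"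
  proof -
    have "bspline \<tau> q (0 + nt) (y + 2 * pi) = bspline \<tau> q 0 y" for y
      by (rule bspline_shift) (simp add: distrib_right nt_dtheta)
    then have "f nt (k + 1) = f 0 k" for k
      using nt_dtheta by (simp add: f_def w_def distrib_left distrib_right add.assoc[symmetric])
    moreover have "bij_betw (\<lambda>k::int. k + 1) UNIV UNIV"
      by (rule bij_betwI[of _ _ _ "\<lambda>k. k - 1"]) auto
    ultimately show ?thesis
      using infsum_reindex_bij_betw[of "\<lambda>k::int. k + 1" UNIV UNIV "f nt"] by simp
  qed
  ultimately show ?thesis by (rule that[of "\<lambda>j. infsum (f j) UNIV"])
qed

lemma periodic_bspline_partition_of_unity: "(\<Sum>j<nt. periodic_bspline nt q j x) = 1"
proof (induction q arbitrary: x)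
  case 0
  obtain k :: int where k: "0 \<le> x + 2 * pi * of_int k" "x + 2 * pi * of_int k < 2 * pi"
    by (rule shift_into_period)
  obtain i where "i < nt"
    "\<And>j. \<tau> j \<le> x + 2 * pi * of_int k \<and> x + 2 * pi * of_int k < \<tau> (j + 1) \<longleftrightarrow> j = i"
    using interval_index[OF k] by blast
  then have "(\<Sum>j<nt. periodic_bspline nt 0 j (x + 2 * pi * of_int k)) = 1"
    using k by (simp add: periodic_bspline_0)
  then show ?case by (simp only: periodic_bspline_shift)
next
  case (Suc q)
  obtain A where A: "\<And>j. periodic_bspline nt (Suc q) j x =
      A j - A (Suc j) + periodic_bspline nt q (Suc j) x" "A nt = A 0"
    using periodic_bspline_Suc by blast
  have "(\<Sum>j<nt. periodic_bspline nt (Suc q) j x)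
      = (\<Sum>j<nt. A j - A (Suc j)) + (\<Sum>j<nt. periodic_bspline nt q j (x - dtheta nt))"
    by (simp add: A(1) sum.distrib periodic_bspline_translate[of q _ 1, simplified])
  then show ?case using Suc A(2) by (simp add: sum_lessThan_telescope')
qed

lemma periodic_bspline_le_1:
  assumes "j < nt"
  shows "periodic_bspline nt q j x \<le> 1"
proof -
  have "periodic_bspline nt q j x \<le> (\<Sum>j<nt. periodic_bspline nt q j x)"
    using assms by (intro member_le_sum periodic_bspline_nonneg) auto
  then show ?thesis by (simp add: periodic_bspline_partition_of_unity)
qed

lemma half_not_knot: "(real j + 1 / 2) * dtheta nt \<notin> knots"
proof
  assume "(real j + 1 / 2) * dtheta nt \<in> knots"
  then obtain k :: int where "(real j + 1 / 2) * dtheta nt = of_int k * dtheta nt"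
    by (auto simp: knots_def)
  then have "real_of_int (2 * int j + 1) = of_int (2 * k)" using dtheta_pos by simp
  then have "2 * int j + 1 = 2 * k" by (simp only: of_int_eq_iff)
  then show False by presburger
qed

definition cyc_diff :: "(nat \<Rightarrow> real) \<Rightarrow> nat \<Rightarrow> real" where
  "cyc_diff e j = e ((j + 1) mod nt) - e j"

lemma cyc_diff_eq_0_iff_const: "(\<forall>j<nt. cyc_diff e j = 0) \<longleftrightarrow> (\<exists>c. \<forall>j<nt. e j = c)"
proof
  assume diff: "\<forall>j<nt. cyc_diff e j = 0"
  have "e j = e 0" if "j < nt" for j
    using that
  proof (induction j)
    case (Suc j)
    then show ?case using diff[rule_format, of j] by (simp add: cyc_diff_def)
  qed simp
  then show "\<exists>c. \<forall>j<nt. e j = c" by blast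
qed (auto simp: cyc_diff_def)

lemma cyc_diff_primitive:
  obtains b where "\<And>j. j < nt \<Longrightarrow> cyc_diff b j = e j - (\<Sum>j<nt. e j) / real nt"
proof -
  define m where "m = (\<Sum>j<nt. e j) / real nt"
  define b where "b j = (\<Sum>k<j. e k - m)" for j
  have "b nt = b 0" using nt_pos by (simp add: b_def sum_subtractf m_def)
  then have "b ((j + 1) mod nt) = b (Suc j)" if "j < nt" for j
    using that by (cases "Suc j = nt") auto
  then have "cyc_diff b j = e j - m" if "j < nt" for j using that by (simp add: cyc_diff_def b_def)
  then show ?thesis using that unfolding m_def by blast
qed

definition periodic_spline :: "nat \<Rightarrow> (nat \<Rightarrow> real) \<Rightarrow> real \<Rightarrow> real" where
  "periodic_spline q e t = (\<Sum>j<nt. e j * periodic_bspline nt q j t)"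

lemma periodic_spline_shift: "periodic_spline q e (t + 2 * pi * of_int k) = periodic_spline q e t"
  by (simp add: periodic_spline_def periodic_bspline_shift)

lemma periodic_spline_cong:
  "(\<And>j. j < nt \<Longrightarrow> e j = e' j) \<Longrightarrow> periodic_spline q e t = periodic_spline q e' t"
  by (simp add: periodic_spline_def)

lemma periodic_spline_diff:
  "periodic_spline q (\<lambda>j. e j - e' j) t = periodic_spline q e t - periodic_spline q e' t"
  by (simp add: periodic_spline_def left_diff_distrib sum_subtractf)

lemma periodic_spline_const: "periodic_spline q (\<lambda>j. c) t = c"
  by (simp add: periodic_spline_def sum_distrib_left[symmetric] periodic_bspline_partition_of_unity)

lemma borel_measurable_periodic_spline [measurable]: "periodic_spline q e \<in> borel_measurable borel"
  unfolding periodic_spline_def[abs_def] by measurable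

lemma abs_periodic_spline_le: "\<bar>periodic_spline q e t\<bar> \<le> (\<Sum>j<nt. \<bar>e j\<bar>)"
  unfolding periodic_spline_def
  by (rule order_trans[OF sum_abs], rule sum_mono)
    (simp add: abs_mult mult_left_le periodic_bspline_nonneg periodic_bspline_le_1)

lemma loc_lipschitz_periodic_spline: "q \<ge> 1 \<Longrightarrow> loc_lipschitz UNIV (periodic_spline q e)"
  unfolding periodic_spline_def[abs_def]
  by (intro loc_lipschitz_sum loc_lipschitz_mult loc_lipschitz_periodic_bspline
      loc_lipschitz_const)

lemma isCont_periodic_spline:
  assumes "t \<notin> knots"
  shows "isCont (periodic_spline q e) t"
  unfolding periodic_spline_def[abs_def]
  by (intro continuous_intros DERIV_isCont[OF periodic_bspline_has_derivative[OF assms]])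

lemma periodic_spline_has_derivative:
  assumes "t \<notin> knots"
  shows "(periodic_spline (Suc q) e has_real_derivative
      periodic_spline q (cyc_diff e) (t - dtheta nt) / dtheta nt) (at t)"
proof -
  let ?P = "\<lambda>j. periodic_bspline nt q j t"
  have "(\<Sum>j<nt. e ((j + 1) mod nt) * ?P (j + 1)) = (\<Sum>j<nt. e j * ?P j)"
    using sum_cyclic_shift[of "\<lambda>j. e j * ?P j" nt] by (simp add: periodic_bspline_mod)
  then have "(\<Sum>j<nt. e j * (?P j - ?P (j + 1))) = (\<Sum>j<nt. cyc_diff e j * ?P (j + 1))"
    by (simp add: cyc_diff_def left_diff_distrib right_diff_distrib sum_subtractf)
  also have "\<dots> = periodic_spline q (cyc_diff e) (t - dtheta nt)"
    by (simp add: periodic_spline_def periodic_bspline_translate[of q _ 1, simplified])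
  finally have "(\<Sum>j<nt. e j * ((?P j - ?P (j + 1)) / dtheta nt)) =
      periodic_spline q (cyc_diff e) (t - dtheta nt) / dtheta nt"
    by (simp add: sum_divide_distrib[symmetric])
  moreover have "(periodic_spline (Suc q) e has_real_derivative
      (\<Sum>j<nt. e j * ((?P j - ?P (j + 1)) / dtheta nt))) (at t)"
    unfolding periodic_spline_def[abs_def]
    using periodic_bspline_has_derivative[OF assms, of "Suc q"]
    by (intro DERIV_sum DERIV_cmult) simp
  ultimately show ?thesis by simp
qed

text \<open>Differentiating a vanishing combination reduces the degree until the splines are
  indicator functions of disjoint intervals.\<close>

lemma periodic_spline_eq_0_imp:
  assumes "\<And>t. t \<notin> knots \<Longrightarrow> periodic_spline q e t = 0" "j < nt"
  shows "e j = 0"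
  using assms
proof (induction q arbitrary: e j)
  case 0
  define t where "t = (real j + 1 / 2) * dtheta nt"
  have t: "\<tau> j \<le> t" "t < \<tau> (j + 1)" using dtheta_pos by (simp_all add: t_def algebra_simps)
  moreover have "0 \<le> \<tau> j" "\<tau> (j + 1) \<le> 2 * pi"
    using monoD[OF mono_\<tau>, of "j + 1" nt] 0(2) nt_dtheta dtheta_pos by simp_all
  ultimately have range: "0 \<le> t" "t < 2 * pi" by linarith+
  obtain i where i: "\<And>j. \<tau> j \<le> t \<and> t < \<tau> (j + 1) \<longleftrightarrow> j = i" using interval_index[OF range] by blast
  then have "j = i" using t by blast
  then have "periodic_bspline nt 0 k t = of_bool (k = j)" if "k < nt" for k
    using periodic_bspline_0[OF that range] by (simp only: i)
  then have "periodic_spline 0 e t = (\<Sum>k<nt. if k = j then e j else 0)"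
    unfolding periodic_spline_def by (intro sum.cong) auto
  then show ?case using 0 half_not_knot[of j] by (simp add: t_def)
next
  case (Suc q)
  have "periodic_spline q (cyc_diff e) (t - dtheta nt) = 0" if t: "t \<notin> knots" for t
  proof -
    have "((\<lambda>t. 0) has_real_derivative
        periodic_spline q (cyc_diff e) (t - dtheta nt) / dtheta nt) (at t)"
      by (rule has_field_derivative_transform_within_open[OF periodic_spline_has_derivative[OF t],
          of "- knots"])
        (use Suc.prems(1) t closed_knots in auto)
    from DERIV_unique[OF this DERIV_const] show ?thesis using dtheta_pos by simp
  qed
  then have "periodic_spline q (cyc_diff e) t = 0" if "t \<notin> knots" for t
    using that knots_shift[of t 1] by (metis add_diff_cancel_right' mult_1 of_int_1)
  then have "\<forall>j<nt. cyc_diff e j = 0" using Suc.IH by blast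
  then obtain c where const: "\<And>k. k < nt \<Longrightarrow> e k = c" using cyc_diff_eq_0_iff_const by blast
  have "c = periodic_spline (Suc q) (\<lambda>_. c) (1 / 2 * dtheta nt)"
    by (simp only: periodic_spline_const)
  also have "\<dots> = periodic_spline (Suc q) e (1 / 2 * dtheta nt)"
    by (rule periodic_spline_cong) (rule const[symmetric])
  also have "\<dots> = 0" using Suc.prems(1) half_not_knot[of 0] by simp
  finally show ?case using const[OF Suc.prems(2)] by simp
qed

end

locale angular_splines = periodic_knots nt for nt +
  fixes p :: nat
  assumes degree_pos: "1 \<le> p"
begin

definition bt :: "(nat \<Rightarrow> real) \<Rightarrow> real \<Rightarrow> real" where
  "bt e t = (\<Sum>j<nt. e j * Bt p nt j t)"

definition mt :: "(nat \<Rightarrow> real) \<Rightarrow> real \<Rightarrow> real" where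
  "mt e t = (\<Sum>j<nt. e j * Mt p nt j t)"

lemma bt_eq: "bt = periodic_spline p"
  by (simp add: fun_eq_iff bt_def periodic_spline_def Bt_def)

lemma mt_eq: "mt e t = periodic_spline (p - 1) e (t - dtheta nt) / dtheta nt"
  by (simp add: mt_def periodic_spline_def Mt_def sum_divide_distrib
      periodic_bspline_translate[of _ _ 1, simplified])

lemma bt_shift: "bt e (t + 2 * pi * of_int k) = bt e t"
  by (simp add: bt_eq periodic_spline_shift)

lemma mt_shift: "mt e (t + 2 * pi * of_int k) = mt e t"
  using periodic_spline_shift[of "p - 1" e "t - dtheta nt" k] by (simp add: mt_eq algebra_simps)

lemma bt_diff: "bt (\<lambda>j. e j - e' j) t = bt e t - bt e' t"
  by (simp add: bt_eq periodic_spline_diff)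

lemma mt_diff: "mt (\<lambda>j. e j - e' j) t = mt e t - mt e' t"
  by (simp add: mt_eq periodic_spline_diff diff_divide_distrib)

lemma bt_const: "(\<And>j. j < nt \<Longrightarrow> e j = c) \<Longrightarrow> bt e t = c"
  using periodic_spline_cong[of e "\<lambda>_. c"] by (simp add: bt_eq periodic_spline_const)

lemma mt_zero: "(\<And>j. j < nt \<Longrightarrow> e j = 0) \<Longrightarrow> mt e t = 0"
  by (simp add: mt_def)

lemma borel_measurable_bt [measurable]: "bt e \<in> borel_measurable borel"
  by (simp add: bt_eq)

lemma borel_measurable_mt [measurable]: "mt e \<in> borel_measurable borel"
  unfolding mt_eq by measurable

lemma bounded_bt: "bounded (range (bt e))"
  using abs_periodic_spline_le[of p e] by (auto simp: bt_eq bounded_iff)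

lemma bounded_mt: "bounded (range (mt e))"
proof -
  have "\<bar>mt e t\<bar> \<le> (\<Sum>j<nt. \<bar>e j\<bar>) / dtheta nt" for t
    using abs_periodic_spline_le[of "p - 1" e "t - dtheta nt"] dtheta_pos
    by (simp add: mt_eq abs_divide divide_right_mono)
  then show ?thesis by (auto simp: bounded_iff)
qed

lemma loc_lipschitz_bt: "loc_lipschitz UNIV (bt e)"
  unfolding bt_eq by (rule loc_lipschitz_periodic_spline[OF degree_pos])

lemma not_knot_translate: "t \<notin> knots \<Longrightarrow> t - dtheta nt \<notin> knots"
  using knots_shift[of "t - dtheta nt" 1] by simp

lemma isCont_mt:
  assumes "t \<notin> knots"
  shows "isCont (mt e) t"
proof -
  have "isCont (\<lambda>t. periodic_spline (p - 1) e (t - dtheta nt)) t"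
    by (rule isCont_o2[where f = "\<lambda>t. t - dtheta nt"])
      (intro continuous_intros isCont_periodic_spline not_knot_translate assms)+
  then show ?thesis unfolding mt_eq[abs_def] using dtheta_pos by (intro continuous_intros) auto
qed

lemma bt_has_derivative: "t \<notin> knots \<Longrightarrow> (bt e has_real_derivative mt (cyc_diff e) t) (at t)"
  using periodic_spline_has_derivative[of t "p - 1" e] degree_pos by (simp add: bt_eq mt_eq)

lemma mt_primitive:
  obtains b where "\<And>t. t \<notin> knots \<Longrightarrow> (bt b has_real_derivative
      mt e t - (\<Sum>j<nt. e j) / (2 * pi)) (at t)"
proof -
  define m where "m = (\<Sum>j<nt. e j) / real nt"
  obtain b where b: "\<And>j. j < nt \<Longrightarrow> cyc_diff b j = e j - m"
    using cyc_diff_primitive[of e] by (auto simp: m_def)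
  have "mt (cyc_diff b) t = mt e t - mt (\<lambda>_. m) t" for t
    using b by (simp add: mt_diff[symmetric]) (simp add: mt_def)
  moreover have "mt (\<lambda>_. m) t = (\<Sum>j<nt. e j) / (2 * pi)" for t
    using nt_pos by (simp add: mt_eq periodic_spline_const m_def dtheta_def)
  ultimately show ?thesis using that[of b] bt_has_derivative[of _ b] by simp
qed

lemma bt_eq_0_imp: "(\<And>t. t \<notin> knots \<Longrightarrow> bt e t = 0) \<Longrightarrow> j < nt \<Longrightarrow> e j = 0"
  unfolding bt_eq by (rule periodic_spline_eq_0_imp)

lemma mt_eq_0_imp:
  assumes "\<And>t. t \<notin> knots \<Longrightarrow> mt e t = 0" "j < nt"
  shows "e j = 0"
proof (rule periodic_spline_eq_0_imp[OF _ assms(2)])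
  fix t assume "t \<notin> knots"
  then have "mt e (t + dtheta nt) = 0" using knots_shift[of t 1] by (intro assms(1)) simp
  then show "periodic_spline (p - 1) e t = 0" using dtheta_pos by (simp add: mt_eq)
qed

lemma mt_nonzero_sector:
  assumes "j < nt" "e j \<noteq> 0"
  obtains t \<delta> \<eta> where "0 \<le> t - \<delta>" "t + \<delta> < 2 * pi" "0 < \<delta>" "0 < \<eta>" "\<And>u. \<bar>u - t\<bar> \<le> \<delta> \<Longrightarrow> \<eta> \<le> \<bar>mt e u\<bar>"
proof -
  obtain u where u: "u \<notin> knots" "mt e u \<noteq> 0" using mt_eq_0_imp[of e j] assms by blast
  obtain k :: int where k: "0 \<le> u + 2 * pi * of_int k" "u + 2 * pi * of_int k < 2 * pi"
    by (rule shift_into_period)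
  define t where "t = u + 2 * pi * of_int k"
  have t_knot: "t \<notin> knots" "mt e t \<noteq> 0" using u unfolding t_def knots_period mt_shift .
  then have "t \<noteq> 0" using rangeI[of "\<lambda>k::int. of_int k * dtheta nt" 0] by (auto simp: knots_def)
  then have t: "0 < t" "t < 2 * pi" using k by (auto simp: t_def)
  have "0 < \<bar>mt e t\<bar> / 2" using t_knot by simp
  then obtain d where d: "d > 0" "\<And>u. \<bar>u - t\<bar> < d \<Longrightarrow> \<bar>mt e u - mt e t\<bar> < \<bar>mt e t\<bar> / 2"
    using isCont_mt[OF t_knot(1), of e] unfolding continuous_at_eps_delta dist_real_def by blast
  define \<delta> where "\<delta> = min (d / 2) (min t ((2 * pi - t) / 2))"
  show ?thesis
  proof (rule that[of t \<delta> "\<bar>mt e t\<bar> / 2"])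
    show "\<bar>mt e t\<bar> / 2 \<le> \<bar>mt e u\<bar>" if "\<bar>u - t\<bar> \<le> \<delta>" for u
    proof -
      have "\<bar>u - t\<bar> < d" using that d(1) by (auto simp: \<delta>_def)
      then show ?thesis using d(2)[of u] by linarith
    qed
    have "\<delta> \<le> t" "\<delta> \<le> (2 * pi - t) / 2" unfolding \<delta>_def by linarith+
    then have "0 \<le> t - \<delta>" "2 * \<delta> \<le> 2 * pi - t" by simp_all
    then show "0 \<le> t - \<delta>" "t + \<delta> < 2 * pi" using t by linarith+
    show "0 < \<delta>" using t d(1) by (simp add: \<delta>_def)
    show "0 < \<bar>mt e t\<bar> / 2" using t_knot by simp
  qed
qed

end

section \<open>Splines on an open knot sequence\<close>

lemma bounded_linear_growth_at_left_end:
  fixes f :: "real \<Rightarrow> real"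
  assumes f: "loc_lipschitz {0..<r} f" "0 < r" and B: "\<And>x. x \<in> {0..<L} \<Longrightarrow> \<bar>f x - f 0\<bar> \<le> B"
  obtains K where "\<And>x. x \<in> {0..<L} \<Longrightarrow> \<bar>f x - f 0\<bar> \<le> K * x"
proof -
  obtain e C where e: "e > 0" and C: "C-lipschitz_on (cball 0 e \<inter> {0..<r}) f"
    using f unfolding loc_lipschitz_iff by (auto dest: bspec[of _ _ 0])
  define d where "d = min e (r / 2)"
  have d: "d > 0" using e f(2) by (simp add: d_def)
  show ?thesis
  proof (rule that)
    fix x assume x: "x \<in> {0..<L}"
    show "\<bar>f x - f 0\<bar> \<le> (C + \<bar>B\<bar> / d) * x"
    proof (cases "x \<le> d")
      case True
      then have "\<bar>f x - f 0\<bar> \<le> C * x"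
        using lipschitz_onD[OF C, of x 0] x e f(2) by (auto simp: d_def dist_real_def)
      also have "\<dots> \<le> (C + \<bar>B\<bar> / d) * x" using x d by (intro mult_right_mono) auto
      finally show ?thesis .
    next
      case False
      have "\<bar>f x - f 0\<bar> \<le> \<bar>B\<bar> / d * d" using B[OF x] d by simp
      also have "\<dots> \<le> (C + \<bar>B\<bar> / d) * x"
        using False d lipschitz_on_nonneg[OF C] by (intro mult_mono) auto
      finally show ?thesis .
    qed
  qed
qed

locale radial_knots =
  fixes L :: real and p ns :: nat and s :: "nat \<Rightarrow> real"
  assumes open_knots: "open_knots L p ns s" and p_pos: "1 \<le> p"
begin

lemma p_less_ns: "p < ns"
  using open_knots by (simp add: open_knots_def)

lemma s_low: "k \<le> p \<Longrightarrow> s k = 0"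
  using open_knots by (simp add: open_knots_def)

lemma s_high: "ns \<le> k \<Longrightarrow> k \<le> ns + p \<Longrightarrow> s k = L"
  using open_knots by (simp add: open_knots_def)

lemma s_less: "p \<le> k \<Longrightarrow> k < l \<Longrightarrow> l \<le> ns \<Longrightarrow> s k < s l"
  using open_knots by (auto simp: open_knots_def intro: strict_mono_onD)

lemma first_knot_pos: "0 < s (p + 1)"
  using s_low[of p] s_less[of p "p + 1"] p_less_ns by simp

text \<open>The knots beyond index \<open>ns + p\<close> are irrelevant; repeating the last one gives a monotone sequence.\<close>

definition s' :: "nat \<Rightarrow> real" where
  "s' k = s (min k (ns + p))"

lemma s'_Suc: "s' k \<le> s' (Suc k)" "s' k = s' (Suc k) \<longleftrightarrow> k < p \<or> ns \<le> k"
proof -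
  consider (start) "k < p" | (interior) "p \<le> k" "k < ns" | (tail) "ns \<le> k" by linarith
  then have "s' k \<le> s' (Suc k) \<and> (s' k = s' (Suc k) \<longleftrightarrow> k < p \<or> ns \<le> k)"
  proof cases
    case start
    then show ?thesis using s_low[of k] s_low[of "Suc k"] by (simp add: s'_def min_def)
  next
    case interior
    then show ?thesis using s_less[of k "Suc k"] p_less_ns by (simp add: s'_def min_def)
  next
    case tail
    then show ?thesis using s_high[of "min k (ns + p)"] s_high[of "min (Suc k) (ns + p)"]
      by (auto simp: s'_def)
  qed
  then show "s' k \<le> s' (Suc k)" "s' k = s' (Suc k) \<longleftrightarrow> k < p \<or> ns \<le> k" by blast+
qed

lemma mono_s': "mono s'"
  using s'_Suc by (simp add: mono_iff_le_Suc)

lemma bspline_s': "i + q + 1 \<le> ns + p \<Longrightarrow> bspline s q i x = bspline s' q i x"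
  by (rule bspline_cong) (simp add: s'_def min_def)

definition breakpoints :: "real set" where
  "breakpoints = s ` {..ns + p}"

lemma finite_breakpoints: "finite breakpoints"
  by (simp add: breakpoints_def)

lemma range_s': "range s' \<subseteq> breakpoints"
  by (auto simp: s'_def breakpoints_def)

lemma loc_lipschitz_Bs:
  assumes "i < ns"
  shows "loc_lipschitz {0..<L} (Bs p s i)"
proof -
  have "loc_lipschitz {0..<L} (bspline s' p i)"
  proof (rule loc_lipschitz_bspline[OF mono_s' _ p_pos])
    fix k assume "s' k = s' (Suc k)"
    then consider (start) "k < p" | (tail) "ns \<le> k" by (auto simp: s'_Suc)
    then show "{0..<L} \<subseteq> {s' k..} \<or> {0..<L} \<subseteq> {..<s' k}"
    proof cases
      case start
      then show ?thesis using s_low[of k] by (auto simp: s'_def min_def)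
    next
      case tail
      then show ?thesis using s_high[of "min k (ns + p)"] by (auto simp: s'_def)
    qed
  qed
  then show ?thesis by (rule loc_lipschitz_cong) (use assms in \<open>simp add: Bs_def bspline_s'\<close>)
qed

definition Bs' :: "nat \<Rightarrow> real \<Rightarrow> real" where
  "Bs' i x = (if i = 0 then 0 else Ms p s (i - 1) x) - Ms p s i x"

lemma Bs_has_derivative:
  assumes "i < ns" "x \<notin> breakpoints"
  shows "(Bs p s i has_real_derivative Bs' i x) (at x)"
proof -
  have "(bspline s' p i has_real_derivative
     real p * (bspline s' (p - 1) i x / (s' (i + p) - s' i) -
               bspline s' (p - 1) (i + 1) x / (s' (i + p + 1) - s' (i + 1)))) (at x)"
    using range_s' assms(2) by (intro bspline_has_derivative mono_s') auto
  moreover have "bspline s' p i = Bs p s i"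
    using assms(1) by (auto simp: Bs_def bspline_s')
  moreover have "bspline s' (p - 1) k = bspline s (p - 1) k" if "k \<le> i + 1" for k
    using assms(1) p_pos that by (auto simp: bspline_s')
  moreover have "s' (i + p) = s (i + p)" "s' i = s i" "s' (i + p + 1) = s (i + p + 1)"
    "s' (i + 1) = s (i + 1)"
    using assms(1) p_pos by (auto simp: s'_def min_def)
  ultimately have "(Bs p s i has_real_derivative
     real p * (bspline s (p - 1) i x / (s (i + p) - s i) -
               bspline s (p - 1) (i + 1) x / (s (i + p + 1) - s (i + 1)))) (at x)" by simp
  then show ?thesis
    by (rule DERIV_cong) (auto simp: Bs'_def Ms_def right_diff_distrib s_low)
qed

lemma bspline_at_0:
  assumes "q \<le> p" "i + q + 1 \<le> ns + p"
  shows "bspline s q i 0 = (if i + q = p then 1 else 0)"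
  using assms
proof (induction q arbitrary: i)
  case 0
  have "0 < L" using s_less[of p ns] s_low[of p] s_high[of ns] p_less_ns by simp
  consider (start) "i < p" | (first_interior) "i = p" | (interior) "p < i" "i < ns"
    | (tail) "ns \<le> i" by linarith
  then have "s i \<le> 0 \<and> 0 < s (i + 1) \<longleftrightarrow> i = p"
  proof cases
    case start
    then show ?thesis using s_low[of "i + 1"] by auto
  next
    case first_interior
    then show ?thesis using s_low[of p] first_knot_pos by auto
  next
    case interior
    then show ?thesis using s_low[of p] s_less[of p i] by auto
  next
    case tail
    then show ?thesis using s_high[of i] 0 \<open>0 < L\<close> p_less_ns by auto
  qed
  then show ?case by (simp add: bspline.simps)
next
  case (Suc q)
  have left: "bspline s q i 0 = (if i + q = p then 1 else 0)"
    and right: "bspline s q (i + 1) 0 = (if i + 1 + q = p then 1 else 0)"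
    using Suc.prems by (intro Suc.IH; simp)+
  have "s i * bspline s q i 0 = 0" using left s_low[of i] by auto
  then have "bspline s (Suc q) i 0 =
      s (i + q + 2) / (s (i + q + 2) - s (i + 1)) * (if i + 1 + q = p then 1 else 0)"
    by (simp add: bspline.simps right[simplified])
  also have "\<dots> = (if i + Suc q = p then 1 else 0)"
  proof (cases "i + Suc q = p")
    case True
    then show ?thesis using s_low[of "i + 1"] first_knot_pos by (simp add: eval_nat_numeral)
  qed simp
  finally show ?case .
qed

lemma bspline_0_const_near_0:
  assumes "i + 1 \<le> ns + p" "x \<in> {0..<s (p + 1)}"
  shows "bspline s 0 i x = bspline s 0 i 0"
proof -
  have "s k = 0 \<or> s (p + 1) \<le> s k" if "k \<le> ns + p" for k
  proof (cases "k \<le> p")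
    case False
    then have "s' (p + 1) \<le> s' k" by (intro monoD[OF mono_s']) simp
    then show ?thesis using that p_less_ns by (simp add: s'_def min_def)
  qed (simp add: s_low)
  from this[of i] this[of "i + 1"] show ?thesis using assms by auto
qed

lemma bspline_near_0:
  assumes "q \<le> p" "i + q + 1 \<le> ns + p"
  obtains K where "\<And>x. x \<in> {0..<L} \<Longrightarrow> \<bar>bspline s q i x - bspline s q i 0\<bar> \<le> K * x"
proof (rule bounded_linear_growth_at_left_end[of "s (p + 1)" "bspline s q i" L 1])
  have eq: "bspline s q i = bspline s' q i" using bspline_s'[OF assms(2)] by (rule ext)
  show "\<bar>bspline s q i x - bspline s q i 0\<bar> \<le> 1" for x
    unfolding eq using bspline_nonneg[OF mono_s', of q i x] bspline_le_1[OF mono_s', of q i x]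
      bspline_nonneg[OF mono_s', of q i 0] bspline_le_1[OF mono_s', of q i 0] by linarith
  show "loc_lipschitz {0..<s (p + 1)} (bspline s q i)"
  proof (cases "q = 0")
    case True
    have "loc_lipschitz {0..<s (p + 1)} (\<lambda>x. bspline s 0 i 0)"
      by (rule loc_lipschitz_const)
    then show ?thesis
      unfolding True by (rule loc_lipschitz_cong, intro bspline_0_const_near_0[symmetric])
        (use assms True in simp_all)
  next
    case False
    have "{0..<s (p + 1)} \<subseteq> {s' k..} \<or> {0..<s (p + 1)} \<subseteq> {..<s' k}" if "s' k = s' (Suc k)" for k
    proof -
      have "p + 1 \<le> k" if "\<not> k < p" using \<open>s' k = _\<close> that s'_Suc(2)[of k] p_less_ns by auto
      then show ?thesis
        using s_low[of k] monoD[OF mono_s', of "p + 1" k] p_less_ns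
        by (cases "k < p") (auto simp: s'_def min_def)
    qed
    then show ?thesis unfolding eq using False by (intro loc_lipschitz_bspline mono_s') auto
  qed
qed (use first_knot_pos in auto)

lemma Ms_0_pos: "Ms p s 0 0 > 0"
  using bspline_at_0[of "p - 1" 1] p_less_ns p_pos s_low[of 1] first_knot_pos by (simp add: Ms_def)

lemma Bs_near_0:
  assumes "i < ns"
  shows "\<exists>K. \<forall>x\<in>{0..<L}. \<bar>Bs p s i x - of_bool (i = 0)\<bar> \<le> K * x"
proof -
  have "p \<le> p" "i + p + 1 \<le> ns + p" using assms by auto
  then obtain K where "\<And>x. x \<in> {0..<L} \<Longrightarrow> \<bar>bspline s p i x - bspline s p i 0\<bar> \<le> K * x"
    by (rule bspline_near_0) blast
  then show ?thesis using bspline_at_0[of p i] assms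
    by (intro exI[of _ K]) (simp add: Bs_def of_bool_def)
qed

lemma Ms_near_0:
  assumes "i < ns - 1"
  shows "\<exists>K. \<forall>x\<in>{0..<L}. \<bar>Ms p s i x - of_bool (i = 0) * Ms p s 0 0\<bar> \<le> K * x"
proof -
  have "p - 1 \<le> p" "i + 1 + (p - 1) + 1 \<le> ns + p" using assms p_pos by auto
  then obtain K where K: "\<And>x. x \<in> {0..<L} \<Longrightarrow>
      \<bar>bspline s (p - 1) (i + 1) x - bspline s (p - 1) (i + 1) 0\<bar> \<le> K * x"
    by (rule bspline_near_0) blast
  define d where "d = real p / (s (i + p + 1) - s (i + 1))"
  have "Ms p s i 0 = of_bool (i = 0) * Ms p s 0 0"
    using bspline_at_0[of "p - 1" "i + 1"] assms p_pos by (auto simp: Ms_def)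
  moreover have "\<bar>Ms p s i x - Ms p s i 0\<bar> \<le> (\<bar>d\<bar> * K) * x" if "x \<in> {0..<L}" for x
    unfolding Ms_def d_def[symmetric] right_diff_distrib[symmetric] abs_mult mult.assoc
    using K[OF that] by (intro mult_left_mono) auto
  ultimately show ?thesis by (intro exI[of _ "\<bar>d\<bar> * K"]) simp
qed

lemma borel_measurable_Bs [measurable]: "Bs p s i \<in> borel_measurable borel"
  unfolding Bs_def[abs_def] by measurable

lemma borel_measurable_Ms [measurable]: "Ms p s i \<in> borel_measurable borel"
  unfolding Ms_def[abs_def] by measurable

lemma sum_Bs': "(\<Sum>i<ns. c i * Bs' i x) = (\<Sum>i<ns - 1. (c (i + 1) - c i) * Ms p s i x)"
proof -
  obtain m where m: "ns = Suc m" using p_less_ns by (cases ns) auto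
  have "(\<Sum>i<ns. c i * Bs' i x) =
     (\<Sum>i<Suc m. c i * (if i = 0 then 0 else Ms p s (i - 1) x)) - (\<Sum>i<Suc m. c i * Ms p s i x)"
    by (simp add: m Bs'_def right_diff_distrib sum_subtractf)
  also have "(\<Sum>i<Suc m. c i * (if i = 0 then 0 else Ms p s (i - 1) x)) =
      (\<Sum>i<m. c (i + 1) * Ms p s i x)"
    by (simp add: sum.lessThan_Suc_shift del: sum.lessThan_Suc)
  also have "(\<Sum>i<Suc m. c i * Ms p s i x) = (\<Sum>i<m. c i * Ms p s i x)"
    using s_high[of ns] s_high[of "ns + p"] m p_less_ns by (simp add: Ms_def)
  finally show ?thesis by (simp add: m left_diff_distrib sum_subtractf)
qed

lemma Ms_primitive:
  assumes "i < ns - 1" "x \<notin> breakpoints"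
  shows "((\<lambda>y. \<Sum>k<ns. of_bool (i < k) * Bs p s k y) has_real_derivative Ms p s i x) (at x)"
proof -
  have "((\<lambda>y. \<Sum>k<ns. of_bool (i < k) * Bs p s k y) has_real_derivative
      (\<Sum>k<ns. of_bool (i < k) * Bs' k x)) (at x)"
    using assms(2) by (intro DERIV_sum DERIV_cmult Bs_has_derivative) auto
  also have "(\<Sum>k<ns. of_bool (i < k) * Bs' k x) = (\<Sum>k<ns - 1. if k = i then Ms p s i x else 0)"
    unfolding sum_Bs' by (intro sum.cong) (auto simp: less_Suc_eq)
  finally show ?thesis using assms(1) by simp
qed

lemma loc_lipschitz_Bs_sum: "loc_lipschitz {0..<L} (\<lambda>x. \<Sum>i<ns. c i * Bs p s i x)"
  by (intro loc_lipschitz_sum loc_lipschitz_mult loc_lipschitz_Bs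
      loc_lipschitz_const) auto

lemma sum_near_0:
  fixes n :: nat
  assumes A: "\<And>i. i < n \<Longrightarrow> \<exists>K. \<forall>x\<in>{0..<L}. \<bar>A i x - of_bool (i = 0) * a\<bar> \<le> K * x"
    and h: "\<And>i. bounded (range (h i))" and "0 < n"
  obtains K :: real where "K \<ge> 0" "\<And>x t. x \<in> {0..<L} \<Longrightarrow>
      \<bar>(\<Sum>i<n. A i x * h i t) - a * h 0 (t :: real)\<bar> \<le> K * x"
proof -
  obtain k where k: "\<And>i x. i < n \<Longrightarrow> x \<in> {0..<L} \<Longrightarrow> \<bar>A i x - of_bool (i = 0) * a\<bar> \<le> k i * x"
    using A by metis
  have "\<exists>H. \<forall>t. \<bar>h i t\<bar> \<le> H" for i using h[of i] by (auto simp: bounded_iff)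
  then obtain H where H: "\<And>i t. \<bar>h i t\<bar> \<le> H i" by metis
  show ?thesis
  proof (rule that[of "\<Sum>i<n. \<bar>k i\<bar> * \<bar>H i\<bar>"])
    fix x t assume x: "x \<in> {0..<L}"
    have "(\<Sum>i<n. of_bool (i = 0) * (a * h i t)) = (\<Sum>i<n. if i = 0 then a * h 0 t else 0)"
      by (intro sum.cong) auto
    also have "\<dots> = a * h 0 t" using \<open>0 < n\<close> by simp
    finally have "(\<Sum>i<n. A i x * h i t) - a * h 0 t = (\<Sum>i<n. (A i x - of_bool (i = 0) * a) * h i t)"
      by (simp add: left_diff_distrib sum_subtractf mult.assoc)
    also have "\<bar>\<dots>\<bar> \<le> (\<Sum>i<n. \<bar>(A i x - of_bool (i = 0) * a) * h i t\<bar>)" by (rule sum_abs)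
    also have "\<dots> \<le> (\<Sum>i<n. (\<bar>k i\<bar> * x) * \<bar>H i\<bar>)"
    proof (rule sum_mono)
      fix i assume i: "i \<in> {..<n}"
      have "k i * x \<le> \<bar>k i\<bar> * x" using x by (intro mult_right_mono) auto
      then have "\<bar>A i x - of_bool (i = 0) * a\<bar> \<le> \<bar>k i\<bar> * x" using k[of i x] i x by simp
      moreover have "\<bar>h i t\<bar> \<le> \<bar>H i\<bar>" using H[of i t] by linarith
      ultimately show "\<bar>(A i x - of_bool (i = 0) * a) * h i t\<bar> \<le> (\<bar>k i\<bar> * x) * \<bar>H i\<bar>"
        unfolding abs_mult using x by (intro mult_mono) auto
    qed
    finally show "\<bar>(\<Sum>i<n. A i x * h i t) - a * h 0 t\<bar> \<le> (\<Sum>i<n. \<bar>k i\<bar> * \<bar>H i\<bar>) * x"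
      unfolding sum_distrib_right by (simp add: mult_ac)
  qed (intro sum_nonneg, simp)
qed

end

section \<open>Polar mappings\<close>

lemma matrix_inv_eqI:
  fixes A B :: "real^'n::finite^'n"
  assumes "A ** B = mat 1"
  shows "matrix_inv A = B"
proof -
  have "A ** B = mat 1 \<and> B ** A = mat 1" using assms matrix_left_right_inverse by blast
  then have inv: "A ** matrix_inv A = mat 1 \<and> matrix_inv A ** A = mat 1"
    unfolding matrix_inv_def by (rule someI)
  have "matrix_inv A = matrix_inv A ** (A ** B)" by (simp add: assms)
  then show ?thesis using inv by (simp only: matrix_mul_assoc matrix_mul_lid)
qed

lemma matrix_inv_2x2:
  fixes A :: "real^2^2"
  assumes "det A \<noteq> 0"
  shows "matrix_inv A =
    vector [vector [A$2$2 / det A, - A$1$2 / det A], vector [- A$2$1 / det A, A$1$1 / det A]]"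
    (is "_ = ?B")
proof (rule matrix_inv_eqI)
  define d where "d = det A"
  have d: "d \<noteq> 0" "A$1$1 * A$2$2 = d + A$1$2 * A$2$1" using assms by (simp_all add: d_def det_2)
  show "A ** ?B = mat 1"
    unfolding d_def[symmetric]
    using d by (auto simp: vec_eq_iff forall_2 matrix_matrix_mult_def sum_2 mat_def field_simps)
qed

lemma transpose_matrix_vector_mult_eq_sum_rows:
  fixes A :: "real^'n::finite^'m::finite"
  shows "transpose A *v w = (\<Sum>i\<in>UNIV. w $ i *\<^sub>R A $ i)"
  by (simp add: vec_eq_iff matrix_vector_mult_def transpose_def mult.commute
      del: transpose_matrix_vector)

locale polar_map =
  fixes L :: real and \<Omega> :: "(real^2) set" and x0 :: "real^2" and F :: "real^2 \<Rightarrow> real^2"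
  assumes polar_mapping: "polar_mapping L \<Omega> x0 F"
    and first_order: "first_order_polar_singularity L F"
begin

abbreviation "P \<equiv> polar_coords L F"
abbreviation "J \<equiv> JF L F"

definition "\<Omega>0 = \<Omega> - {x0}"

lemma L_pos: "0 < L"
  and open_\<Omega>: "open \<Omega>"
  and bounded_\<Omega>: "bounded \<Omega>"
  and x0_in: "x0 \<in> \<Omega>"
  and F_period: "z \<in> strip L \<Longrightarrow> F (z + vector [0, 2 * pi]) = F z"
  and F_C1: "C1_map_on (strip L) F"
  and F_pole: "z \<in> strip L \<Longrightarrow> z $ 1 = 0 \<Longrightarrow> F z = x0"
  and F_inner: "F ` {z \<in> strip L. z $ 1 < L} = \<Omega>"
  and F_diffeo: "polar_diffeo L F (closure \<Omega> - {x0})"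
  using polar_mapping unfolding polar_mapping_def by blast+

lemma F_strip0: "F ` strip0 L = closure \<Omega> - {x0}"
  using F_diffeo unfolding polar_diffeo_def by (elim conjE)

lemma F_inj:
  assumes "z \<in> strip0 L" "w \<in> strip0 L" "F z = F w"
  shows "z $ 1 = w $ 1 \<and> (\<exists>k::int. z $ 2 = w $ 2 + 2 * pi * of_int k)"
proof -
  have "\<forall>z\<in>strip0 L. \<forall>w\<in>strip0 L. F z = F w \<longrightarrow>
      z $ 1 = w $ 1 \<and> (\<exists>k::int. z $ 2 = w $ 2 + 2 * pi * of_int k)"
    using F_diffeo unfolding polar_diffeo_def by (elim conjE)
  then show ?thesis using assms by blast
qed

lemma F_local_inverse:
  assumes "y \<in> closure \<Omega> - {x0}"
  shows "\<exists>U G. open U \<and> y \<in> U \<and> C1_map_on (U \<inter> (closure \<Omega> - {x0})) G \<and>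
      G ` (U \<inter> (closure \<Omega> - {x0})) \<subseteq> strip0 L \<and> (\<forall>x\<in>U \<inter> (closure \<Omega> - {x0}). F (G x) = x)"
proof -
  have "\<forall>y\<in>closure \<Omega> - {x0}. \<exists>U G. open U \<and> y \<in> U \<and> C1_map_on (U \<inter> (closure \<Omega> - {x0})) G \<and>
      G ` (U \<inter> (closure \<Omega> - {x0})) \<subseteq> strip0 L \<and> (\<forall>x\<in>U \<inter> (closure \<Omega> - {x0}). F (G x) = x)"
    using F_diffeo unfolding polar_diffeo_def by (elim conjE)
  then show ?thesis using assms by (rule bspec)
qed

lemma strip0_subset: "strip0 L \<subseteq> strip L"
  by (auto simp: strip_def strip0_def)

lemma open_\<Omega>0: "open \<Omega>0"
  using open_\<Omega> by (simp add: \<Omega>0_def open_delete)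

lemma \<Omega>0_subset: "\<Omega>0 \<subseteq> closure \<Omega> - {x0}"
  using closure_subset[of \<Omega>] by (auto simp: \<Omega>0_def)

lemma F_shift:
  assumes z: "z \<in> strip L"
  shows "F (z + vector [0, 2 * pi * of_int k]) = F z"
proof -
  have strip: "z + vector [0, t] \<in> strip L" for t using z by (simp add: strip_def)
  have step: "F (z + vector [0, 2 * pi * of_int (i + 1)]) = F (z + vector [0, 2 * pi * of_int i])"
    for i
  proof -
    have "z + vector [0, 2 * pi * of_int (i + 1)] =
        (z + vector [0, 2 * pi * of_int i]) + vector [0, 2 * pi]"
      by (simp add: vec_eq_iff forall_2 algebra_simps)
    then show ?thesis by (simp only: F_period[OF strip])
  qed
  show ?thesis
  proof (induction k rule: int_induct[of _ 0])
    case base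
    have "vector [0, 2 * pi * of_int 0] = (0::real^2)" by (simp add: vec_eq_iff forall_2)
    then show ?case by simp
  next
    case (step1 i)
    then show ?case using step[of i] by simp
  next
    case (step2 i)
    then show ?case using step[of "i - 1"] by simp
  qed
qed

lemma F_onto_fundamental_strip:
  assumes "x \<in> closure \<Omega> - {x0}"
  shows "x \<in> F ` {z \<in> strip0 L. 0 \<le> z $ 2 \<and> z $ 2 < 2 * pi}"
proof -
  obtain z where z: "z \<in> strip0 L" "F z = x" using assms F_strip0 by (metis imageE)
  obtain k :: int where k: "0 \<le> z $ 2 + 2 * pi * of_int k" "z $ 2 + 2 * pi * of_int k < 2 * pi"
    by (rule shift_into_period)
  let ?w = "z + vector [0, 2 * pi * of_int k]"
  have "?w \<in> {z \<in> strip0 L. 0 \<le> z $ 2 \<and> z $ 2 < 2 * pi}" using z(1) k by (simp add: strip0_def)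
  moreover have "F ?w = x" using F_shift z strip0_subset by blast
  ultimately show ?thesis by blast
qed

lemma polar_coords:
  assumes "x \<in> closure \<Omega> - {x0}"
  shows "P x \<in> strip0 L" "0 \<le> P x $ 2" "P x $ 2 < 2 * pi" "F (P x) = x"
proof -
  note x = F_onto_fundamental_strip[OF assms]
  show "P x \<in> strip0 L" "0 \<le> P x $ 2" "P x $ 2 < 2 * pi"
    using inv_into_into[OF x] unfolding polar_coords_def by simp_all
  show "F (P x) = x" unfolding polar_coords_def by (rule f_inv_into_f[OF x])
qed

definition ring :: "(real^2) set" where
  "ring = {z. 0 < z $ 1 \<and> z $ 1 < L}"

lemma open_ring: "open ring"
  unfolding ring_def by (intro open_Collect_conj open_Collect_less continuous_intros)

lemma ring_subset: "ring \<subseteq> strip0 L"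
  by (auto simp: ring_def strip0_def)

lemma ring_strip: "z \<in> ring \<Longrightarrow> z \<in> strip L"
  using ring_subset strip0_subset by blast

lemma F_ring:
  assumes "z \<in> ring"
  shows "F z \<in> \<Omega>0"
proof -
  have "F z \<in> \<Omega>" using assms F_inner by (force simp: ring_def strip_def)
  moreover have "F z \<noteq> x0" using assms ring_subset F_strip0 by blast
  ultimately show ?thesis by (simp add: \<Omega>0_def)
qed

lemma polar_coords_F:
  assumes "z \<in> ring"
  shows "P (F z) $ 1 = z $ 1" "\<exists>k::int. z $ 2 = P (F z) $ 2 + 2 * pi * of_int k"
proof -
  have x: "F z \<in> closure \<Omega> - {x0}" using F_ring[OF assms] \<Omega>0_subset by blast
  have "z \<in> strip0 L" using assms ring_subset by blast
  from F_inj[OF this polar_coords(1)[OF x]] polar_coords(4)[OF x]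
  show "P (F z) $ 1 = z $ 1" "\<exists>k::int. z $ 2 = P (F z) $ 2 + 2 * pi * of_int k" by auto
qed

lemma polar_coords_F_eq:
  assumes "z \<in> ring" "0 \<le> z $ 2" "z $ 2 < 2 * pi"
  shows "P (F z) = z"
proof -
  obtain k :: int where k: "z $ 2 = P (F z) $ 2 + 2 * pi * of_int k"
    using polar_coords_F(2)[OF assms(1)] by blast
  have "0 \<le> P (F z) $ 2" "P (F z) $ 2 < 2 * pi"
    using polar_coords(2,3) F_ring[OF assms(1)] \<Omega>0_subset by blast+
  then have "2 * pi * of_int k < 2 * pi * 1" "2 * pi * (- 1) < 2 * pi * of_int k"
    using k assms by linarith+
  then have "real_of_int k < 1" "- 1 < real_of_int k"
    by (simp_all only: mult_less_cancel_left_pos pi_gt_zero zero_less_mult_iff zero_less_numeral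
        simp_thms)
  then have "k = 0" by linarith
  then show ?thesis using k polar_coords_F(1)[OF assms(1)] by (simp add: vec_eq_iff forall_2)
qed

lemma polar_coords_inner:
  assumes "x \<in> \<Omega>0"
  shows "P x \<in> ring" "0 \<le> P x $ 2" "P x $ 2 < 2 * pi" "F (P x) = x"
proof -
  note pc = polar_coords[OF subsetD[OF \<Omega>0_subset assms]]
  obtain z where z: "z \<in> strip L" "z $ 1 < L" "F z = x" using assms F_inner by (auto simp: \<Omega>0_def)
  have "z $ 1 \<noteq> 0" using F_pole[OF z(1)] z(3) assms by (auto simp: \<Omega>0_def)
  then have "z \<in> ring" using z by (auto simp: ring_def strip_def)
  then show "P x \<in> ring"
    using pc(1) polar_coords_F(1)[of z] z(3) by (auto simp: ring_def strip0_def)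
qed (use polar_coords[OF subsetD[OF \<Omega>0_subset assms]] in auto)

lemma radius_bounds: "x \<in> \<Omega>0 \<Longrightarrow> 0 < P x $ 1" "x \<in> \<Omega>0 \<Longrightarrow> P x $ 1 < L"
  using polar_coords_inner(1) by (auto simp: ring_def)

definition O_radius :: "(real^2 \<Rightarrow> real) \<Rightarrow> bool" where
  "O_radius f \<longleftrightarrow> (\<exists>K>0. \<forall>x\<in>\<Omega>0. \<bar>f x\<bar> \<le> K * P x $ 1)"

lemma O_radiusE:
  assumes "O_radius f"
  obtains K where "K > 0" "\<And>x. x \<in> \<Omega>0 \<Longrightarrow> \<bar>f x\<bar> \<le> K * P x $ 1"
  using assms unfolding O_radius_def by blast

lemma O_radiusI:
  assumes "\<And>x. x \<in> \<Omega>0 \<Longrightarrow> \<bar>f x\<bar> \<le> K * P x $ 1"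
  shows "O_radius f"
  unfolding O_radius_def
proof (intro exI[of _ "\<bar>K\<bar> + 1"] conjI ballI)
  fix x assume x: "x \<in> \<Omega>0"
  have "K * P x $ 1 \<le> (\<bar>K\<bar> + 1) * P x $ 1" using radius_bounds[OF x] by (intro mult_right_mono) auto
  then show "\<bar>f x\<bar> \<le> (\<bar>K\<bar> + 1) * P x $ 1" using assms[OF x] by linarith
qed simp

lemma O_radius_le:
  assumes "O_radius f" "\<And>x. x \<in> \<Omega>0 \<Longrightarrow> \<bar>g x\<bar> \<le> C * \<bar>f x\<bar>" "0 \<le> C"
  shows "O_radius g"
proof -
  obtain K where K: "\<And>x. x \<in> \<Omega>0 \<Longrightarrow> \<bar>f x\<bar> \<le> K * P x $ 1" using assms(1) by (rule O_radiusE) blast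
  show ?thesis
  proof (rule O_radiusI)
    fix x assume x: "x \<in> \<Omega>0"
    have "\<bar>g x\<bar> \<le> C * \<bar>f x\<bar>" by (rule assms(2)[OF x])
    also have "\<dots> \<le> C * (K * P x $ 1)" by (rule mult_left_mono[OF K[OF x] assms(3)])
    finally show "\<bar>g x\<bar> \<le> (C * K) * P x $ 1" by (simp only: mult.assoc)
  qed
qed

lemma O_radius_diff:
  assumes "O_radius f" "O_radius g"
  shows "O_radius (\<lambda>x. f x - g x)"
proof -
  obtain K where K: "\<And>x. x \<in> \<Omega>0 \<Longrightarrow> \<bar>f x\<bar> \<le> K * P x $ 1" using assms(1) by (rule O_radiusE) blast
  obtain K' where K': "\<And>x. x \<in> \<Omega>0 \<Longrightarrow> \<bar>g x\<bar> \<le> K' * P x $ 1" using assms(2) by (rule O_radiusE) blast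
  show ?thesis
  proof (rule O_radiusI)
    show "\<bar>f x - g x\<bar> \<le> (K + K') * P x $ 1" if "x \<in> \<Omega>0" for x
      using K[OF that] K'[OF that] by (simp add: distrib_right)
  qed
qed

lemma bounded_if_O_radius_diff:
  assumes "O_radius (\<lambda>x. f x - g x)" "bounded (g ` \<Omega>0)"
  shows "bounded (f ` \<Omega>0)"
proof -
  obtain K where K: "K > 0" "\<And>x. x \<in> \<Omega>0 \<Longrightarrow> \<bar>f x - g x\<bar> \<le> K * P x $ 1"
    using assms(1) by (rule O_radiusE) blast
  have "norm (f x - g x) \<le> K * L" if "x \<in> \<Omega>0" for x
    using K(2)[OF that] radius_bounds(2)[OF that] K(1) by (auto intro: order_trans mult_left_mono)
  then have "bounded ((\<lambda>x. f x - g x) ` \<Omega>0)" by (auto simp: bounded_iff)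
  from bounded_plus_comp[OF this assms(2)] show ?thesis by simp
qed

lemma F_derivative_matrix:
  obtains A where "\<And>z. z \<in> ring \<Longrightarrow> (F has_derivative (\<lambda>h. A z *v h)) (at z)"
    "\<And>z. z \<in> ring \<Longrightarrow> J z = A z" "continuous_on ring A"
proof -
  obtain A where A: "\<And>x. x \<in> strip L \<Longrightarrow> (F has_derivative (\<lambda>h. A x *v h)) (at x within strip L)"
    and cont: "continuous_on (strip L) A" using F_C1 unfolding C1_map_on_def by blast
  have sub: "ring \<subseteq> strip L" using ring_strip by blast
  have at: "at z within strip L = at z" if "z \<in> ring" for z
    using interior_maximal[OF sub open_ring] that by (intro at_within_interior) blast
  have D: "(F has_derivative (\<lambda>h. A z *v h)) (at z)" if "z \<in> ring" for z
    using A[of z] that sub at[OF that] by auto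
  show ?thesis
  proof (rule that[OF D _ continuous_on_subset[OF cont sub]])
    show "J z = A z" if "z \<in> ring" for z
      using frechet_derivative_at[OF D[OF that]] unfolding JF_def jacobian_def at[OF that]
      by (metis matrix_of_matrix_vector_mul)
  qed
qed

lemma F_has_derivative: "z \<in> ring \<Longrightarrow> (F has_derivative (\<lambda>h. J z *v h)) (at z)"
  by (rule F_derivative_matrix) simp

lemma continuous_on_J: "continuous_on ring J"
  by (rule F_derivative_matrix) (simp cong: continuous_on_cong)

lemma continuous_F: "continuous_on (strip L) F"
  using F_C1 unfolding C1_map_on_def continuous_on_eq_continuous_within
  by (blast intro: has_derivative_continuous)

lemma J_shift:
  assumes z: "z \<in> ring"
  shows "J (z + vector [0, 2 * pi * of_int k]) = J z"
proof -
  let ?v = "vector [0, 2 * pi * of_int k] :: real^2"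
  have shift: "z + ?v \<in> ring" if "z \<in> ring" for z using that by (simp add: ring_def)
  have "((\<lambda>w. w + ?v) has_derivative (\<lambda>h. h)) (at z)" by (auto intro!: derivative_eq_intros)
  then have "((\<lambda>w. F (w + ?v)) has_derivative (\<lambda>h. J (z + ?v) *v h)) (at z)"
    by (rule has_derivative_compose) (rule F_has_derivative[OF shift[OF z]])
  then have "(F has_derivative (\<lambda>h. J (z + ?v) *v h)) (at z)"
    by (rule has_derivative_transform_within_open[OF _ open_ring z])
      (use F_shift ring_strip in blast)
  then have "(\<lambda>h. J (z + ?v) *v h) = (\<lambda>h. J z *v h)"
    by (rule has_derivative_unique[OF _ F_has_derivative[OF z]])
  then show ?thesis by (metis matrix_of_matrix_vector_mul)
qed

lemma J_row_asymptotics: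
  "\<exists>f f' r r'. continuous_on UNIV f \<and> continuous_on UNIV f' \<and> Os L r \<and> Os L r' \<and>
    (\<forall>z\<in>strip L. J z $ i $ 1 = f (z $ 2) + r z \<and> J z $ i $ 2 = z $ 1 * (f' (z $ 2) + r' z))"
proof -
  obtain C C' S S' r11 r12 r21 r22 where per: "C1_periodic C C'" "C1_periodic S S'"
    and Os: "Os L r11" "Os L r12" "Os L r21" "Os L r22"
    and J: "\<forall>z\<in>strip L. J z =
              vector [vector [C (z $ 2) + r11 z, z $ 1 * (C' (z $ 2) + r12 z)],
                      vector [S (z $ 2) + r21 z, z $ 1 * (S' (z $ 2) + r22 z)]]"
    using first_order unfolding first_order_polar_singularity_def
    by (elim exE conjE) (rule that, assumption+)
  have cont: "continuous_on UNIV C" "continuous_on UNIV C'" "continuous_on UNIV S"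
    "continuous_on UNIV S'"
    using per unfolding C1_periodic_def
    by (auto intro: continuous_at_imp_continuous_on DERIV_isCont)
  show ?thesis
  proof (cases "i = 1")
    case True
    then show ?thesis
      using cont Os J by (intro exI[of _ C] exI[of _ C'] exI[of _ r11] exI[of _ r12]) simp
  next
    case False
    then have "i = 2" using exhaust_2 by blast
    then show ?thesis
      using cont Os J by (intro exI[of _ S] exI[of _ S'] exI[of _ r21] exI[of _ r22]) simp
  qed
qed

lemma bounded_asymptotics:
  assumes f: "continuous_on UNIV f" and r: "Os L r"
  obtains K where "\<And>z. z \<in> ring \<Longrightarrow> 0 \<le> z $ 2 \<Longrightarrow> z $ 2 < 2 * pi \<Longrightarrow> \<bar>f (z $ 2) + r z\<bar> \<le> K"
proof -
  have "bounded (f ` {0..2 * pi})"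
    using f by (intro compact_imp_bounded compact_continuous_image)
      (auto intro: continuous_on_subset)
  then obtain B where B: "\<forall>t\<in>{0..2 * pi}. \<bar>f t\<bar> \<le> B" unfolding bounded_iff by auto
  obtain c where c: "c > 0" "\<And>z. z \<in> strip L \<Longrightarrow> \<bar>r z\<bar> \<le> c * z $ 1" using r unfolding Os_def by blast
  show ?thesis
  proof (rule that)
    fix z assume z: "z \<in> ring" "0 \<le> z $ 2" "z $ 2 < 2 * pi"
    have "\<bar>r z\<bar> \<le> c * z $ 1" by (rule c(2)[OF ring_strip[OF z(1)]])
    also have "\<dots> \<le> c * L" using c(1) z by (intro mult_left_mono) (auto simp: ring_def)
    finally show "\<bar>f (z $ 2) + r z\<bar> \<le> B + c * L" using B[rule_format, of "z $ 2"] z by simp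
  qed
qed

lemma J_row_bounds:
  obtains K where "\<And>x. x \<in> \<Omega>0 \<Longrightarrow> \<bar>J (P x) $ i $ 1\<bar> \<le> K"
    "\<And>x. x \<in> \<Omega>0 \<Longrightarrow> \<bar>J (P x) $ i $ 2\<bar> \<le> K * P x $ 1"
proof -
  obtain f f' r r' where cont: "continuous_on UNIV f" "continuous_on UNIV f'"
    and Os: "Os L r" "Os L r'"
    and J: "\<forall>z\<in>strip L. J z $ i $ 1 = f (z $ 2) + r z \<and> J z $ i $ 2 = z $ 1 * (f' (z $ 2) + r' z)"
    using J_row_asymptotics[of i] by (elim exE conjE) (rule that)
  obtain K where K: "\<And>z. z \<in> ring \<Longrightarrow> 0 \<le> z $ 2 \<Longrightarrow> z $ 2 < 2 * pi \<Longrightarrow> \<bar>f (z $ 2) + r z\<bar> \<le> K"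
    using bounded_asymptotics[OF cont(1) Os(1)] by blast
  obtain K' where K': "\<And>z. z \<in> ring \<Longrightarrow> 0 \<le> z $ 2 \<Longrightarrow> z $ 2 < 2 * pi \<Longrightarrow> \<bar>f' (z $ 2) + r' z\<bar> \<le> K'"
    using bounded_asymptotics[OF cont(2) Os(2)] by blast
  show ?thesis
  proof (rule that[of "max K K'"])
    fix x assume x: "x \<in> \<Omega>0"
    note pc = polar_coords_inner[OF x]
    have strip: "P x \<in> strip L" by (rule ring_strip[OF pc(1)])
    show "\<bar>J (P x) $ i $ 1\<bar> \<le> max K K'" using K[OF pc(1-3)] by (simp add: bspec[OF J strip])
    have "\<bar>J (P x) $ i $ 2\<bar> = P x $ 1 * \<bar>f' (P x $ 2) + r' (P x)\<bar>"
      using radius_bounds[OF x] by (simp add: bspec[OF J strip] abs_mult)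
    also have "\<dots> \<le> P x $ 1 * max K K'"
      using K'[OF pc(1-3)] radius_bounds[OF x] by (intro mult_left_mono) auto
    finally show "\<bar>J (P x) $ i $ 2\<bar> \<le> max K K' * P x $ 1" by (simp add: mult.commute)
  qed
qed

lemma J_bounds:
  obtains K where "K > 0" "\<And>x i. x \<in> \<Omega>0 \<Longrightarrow> \<bar>J (P x) $ i $ 1\<bar> \<le> K"
    "\<And>x i. x \<in> \<Omega>0 \<Longrightarrow> \<bar>J (P x) $ i $ 2\<bar> \<le> K * P x $ 1"
proof -
  obtain K1 where K1: "\<And>x. x \<in> \<Omega>0 \<Longrightarrow> \<bar>J (P x) $ 1 $ 1\<bar> \<le> K1"
    "\<And>x. x \<in> \<Omega>0 \<Longrightarrow> \<bar>J (P x) $ 1 $ 2\<bar> \<le> K1 * P x $ 1"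
    using J_row_bounds[of 1] by blast
  obtain K2 where K2: "\<And>x. x \<in> \<Omega>0 \<Longrightarrow> \<bar>J (P x) $ 2 $ 1\<bar> \<le> K2"
    "\<And>x. x \<in> \<Omega>0 \<Longrightarrow> \<bar>J (P x) $ 2 $ 2\<bar> \<le> K2 * P x $ 1"
    using J_row_bounds[of 2] by blast
  define K where "K = max 1 (max K1 K2)"
  have K: "K > 0" "K1 \<le> K" "K2 \<le> K" by (auto simp: K_def)
  show ?thesis
  proof (rule that[OF K(1)])
    fix x and i :: 2 assume x: "x \<in> \<Omega>0"
    have "K1 * P x $ 1 \<le> K * P x $ 1" "K2 * P x $ 1 \<le> K * P x $ 1"
      using K radius_bounds[OF x] by (auto intro!: mult_right_mono)
    then show "\<bar>J (P x) $ i $ 1\<bar> \<le> K" "\<bar>J (P x) $ i $ 2\<bar> \<le> K * P x $ 1"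
      using K1[OF x] K2[OF x] K exhaust_2[of i] by (auto intro: order_trans)
  qed
qed

lemma det_J_lower_bound:
  obtains c where "c > 0" "\<And>z. z \<in> strip L \<Longrightarrow> c * z $ 1 \<le> det (J z)"
proof -
  obtain c where "c > 0" "\<forall>z\<in>strip L. z $ 1 * c \<le> det (J z)"
    using first_order unfolding first_order_polar_singularity_def by (elim exE conjE) (rule that)
  then show ?thesis using that[of c] by (simp add: mult.commute)
qed

lemma det_J_pos:
  assumes "z \<in> ring"
  shows "det (J z) > 0"
proof -
  obtain c where "c > 0" "\<And>z. z \<in> strip L \<Longrightarrow> c * z $ 1 \<le> det (J z)" by (rule det_J_lower_bound) blast
  then show ?thesis
    using assms ring_strip by (force simp: ring_def intro: less_le_trans[of _ "c * z $ 1"])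
qed

text \<open>The gradients of the polar coordinates \<open>s\<close> and \<open>\<theta>\<close>.\<close>

definition polar_grad :: "2 \<Rightarrow> real^2 \<Rightarrow> real^2" where
  "polar_grad i x = matrix_inv (J (P x)) $ i"

lemma polar_grad_eq:
  assumes "x \<in> \<Omega>0"
  shows "polar_grad 1 x =
      vector [J (P x) $ 2 $ 2 / det (J (P x)), - J (P x) $ 1 $ 2 / det (J (P x))]"
    and "polar_grad 2 x =
      vector [- J (P x) $ 2 $ 1 / det (J (P x)), J (P x) $ 1 $ 1 / det (J (P x))]"
  using det_J_pos[OF polar_coords_inner(1)[OF assms]]
  by (simp_all add: polar_grad_def matrix_inv_2x2)

lemma rot_polar_grad_inner:
  assumes "x \<in> \<Omega>0"
  shows "rot (polar_grad 2 x) \<bullet> polar_grad 1 x = inverse (det (J (P x)))"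
proof -
  define d where "d = det (J (P x))"
  have d: "d \<noteq> 0" using det_J_pos[OF polar_coords_inner(1)[OF assms]] by (simp add: d_def)
  have "rot (polar_grad 2 x) \<bullet> polar_grad 1 x =
      (J (P x) $ 1 $ 1 * J (P x) $ 2 $ 2 - J (P x) $ 1 $ 2 * J (P x) $ 2 $ 1) / (d * d)"
    by (simp add: rot_inner polar_grad_eq[OF assms] d_def[symmetric] diff_divide_distrib
        mult.commute)
  also have "\<dots> = inverse d"
    using d unfolding det_2[symmetric] d_def[symmetric] by (simp add: inverse_eq_divide)
  finally show ?thesis by (simp add: d_def)
qed

lemma polar_grad_inner_rot:
  assumes "x \<in> \<Omega>0"
  shows "polar_grad 1 x \<bullet> rot (polar_grad 2 x) = inverse (det (J (P x)))"
    and "polar_grad 2 x \<bullet> rot (polar_grad 1 x) = - inverse (det (J (P x)))"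
  using rot_polar_grad_inner[OF assms] rot_inner_swap[of "polar_grad 2 x" "polar_grad 1 x"]
    inner_commute[of "polar_grad 1 x" "rot (polar_grad 2 x)"] by linarith+

lemma pullback_matrix:
  "transpose (matrix_inv (J (P x))) *v vector [u, v] = u *\<^sub>R polar_grad 1 x + v *\<^sub>R polar_grad 2 x"
  by (simp add: transpose_matrix_vector_mult_eq_sum_rows sum_2 polar_grad_def
      del: transpose_matrix_vector)

lemma polar_grad_bounds:
  obtains K where "K > 0" "\<And>x. x \<in> \<Omega>0 \<Longrightarrow> norm (polar_grad 1 x) \<le> K"
    "\<And>x. x \<in> \<Omega>0 \<Longrightarrow> norm (polar_grad 2 x) \<le> K / P x $ 1"
proof -
  obtain K where K: "K > 0" "\<And>x i. x \<in> \<Omega>0 \<Longrightarrow> \<bar>J (P x) $ i $ 1\<bar> \<le> K"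
    "\<And>x i. x \<in> \<Omega>0 \<Longrightarrow> \<bar>J (P x) $ i $ 2\<bar> \<le> K * P x $ 1" by (rule J_bounds) blast
  obtain c where c: "c > 0" "\<And>z. z \<in> strip L \<Longrightarrow> c * z $ 1 \<le> det (J z)"
    by (rule det_J_lower_bound) blast
  have quot: "\<bar>j / det (J (P x))\<bar> \<le> M / (c * P x $ 1)" if x: "x \<in> \<Omega>0" and j: "\<bar>j\<bar> \<le> M" for x j M
  proof -
    note pc = polar_coords_inner[OF x]
    have "c * P x $ 1 \<le> det (J (P x))" by (rule c(2)[OF ring_strip[OF pc(1)]])
    then have "\<bar>j\<bar> / det (J (P x)) \<le> M / (c * P x $ 1)"
      using j c(1) radius_bounds[OF x] by (intro frac_le) auto
    then show ?thesis using det_J_pos[OF pc(1)] by (simp add: abs_divide)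
  qed
  have norm2: "norm (v::real^2) \<le> \<bar>v $ 1\<bar> + \<bar>v $ 2\<bar>" for v
    using norm_le_l1_cart[of v] by (simp add: sum_2)
  show ?thesis
  proof (rule that[of "2 * K / c"])
    show "2 * K / c > 0" using K c by simp
    fix x assume x: "x \<in> \<Omega>0"
    show "norm (polar_grad 1 x) \<le> 2 * K / c"
      using norm2[of "polar_grad 1 x"] quot[OF x K(3)[OF x, of 1]] quot[OF x K(3)[OF x, of 2]]
          radius_bounds[OF x]
      by (simp add: polar_grad_eq[OF x])
    show "norm (polar_grad 2 x) \<le> 2 * K / c / P x $ 1"
      using norm2[of "polar_grad 2 x"] quot[OF x K(2)[OF x, of 1]] quot[OF x K(2)[OF x, of 2]]
      by (simp add: polar_grad_eq[OF x])
  qed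
qed

lemma polar_grad_angular_lower_bound:
  obtains K where "K > 0" "\<And>x. x \<in> \<Omega>0 \<Longrightarrow> 1 \<le> K * P x $ 1 * norm (polar_grad 2 x)"
proof -
  obtain K where K: "K > 0" "\<And>x i. x \<in> \<Omega>0 \<Longrightarrow> \<bar>J (P x) $ i $ 2\<bar> \<le> K * P x $ 1"
    by (rule J_bounds) blast
  show ?thesis
  proof (rule that[of "2 * K"])
    show "2 * K > 0" using K by simp
    fix x assume x: "x \<in> \<Omega>0"
    let ?v = "vector [J (P x) $ 1 $ 2, J (P x) $ 2 $ 2] :: real^2"
    have d: "det (J (P x)) \<noteq> 0" using det_J_pos[OF polar_coords_inner(1)[OF x]] by simp
    have "polar_grad 2 x \<bullet> ?v =
        (J (P x) $ 1 $ 1 * J (P x) $ 2 $ 2 - J (P x) $ 1 $ 2 * J (P x) $ 2 $ 1) / det (J (P x))"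
      by (simp add: polar_grad_eq[OF x] inner_vec_def sum_2 diff_divide_distrib mult.commute)
    also have "\<dots> = 1" using d unfolding det_2[symmetric] by simp
    finally have "1 \<le> norm (polar_grad 2 x) * norm ?v"
      using norm_cauchy_schwarz[of "polar_grad 2 x" ?v] by simp
    moreover have "norm ?v \<le> 2 * K * P x $ 1"
      using norm_le_l1_cart[of ?v] K(2)[OF x, of 1] K(2)[OF x, of 2] by (simp add: sum_2)
    then have "norm (polar_grad 2 x) * norm ?v \<le> norm (polar_grad 2 x) * (2 * K * P x $ 1)"
      by (rule mult_left_mono) simp
    ultimately show "1 \<le> 2 * K * P x $ 1 * norm (polar_grad 2 x)" by (simp add: mult_ac)
  qed
qed

lemma det_J_upper_bound:
  obtains K where "K > 0" "\<And>x. x \<in> \<Omega>0 \<Longrightarrow> det (J (P x)) \<le> K * P x $ 1"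
proof -
  obtain K where K: "K > 0" "\<And>x i. x \<in> \<Omega>0 \<Longrightarrow> \<bar>J (P x) $ i $ 1\<bar> \<le> K"
    "\<And>x i. x \<in> \<Omega>0 \<Longrightarrow> \<bar>J (P x) $ i $ 2\<bar> \<le> K * P x $ 1" by (rule J_bounds) blast
  show ?thesis
  proof (rule that[of "2 * K * K"])
    show "2 * K * K > 0" using K by simp
    fix x assume x: "x \<in> \<Omega>0"
    have "\<bar>J (P x) $ i $ 1 * J (P x) $ k $ 2\<bar> \<le> K * (K * P x $ 1)" for i k
      unfolding abs_mult using K x by (intro mult_mono) auto
    from this[of 1 2] this[of 2 1]
    have "\<bar>J (P x) $ 1 $ 1 * J (P x) $ 2 $ 2\<bar> \<le> K * (K * P x $ 1)"
      "\<bar>J (P x) $ 1 $ 2 * J (P x) $ 2 $ 1\<bar> \<le> K * (K * P x $ 1)"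
      by (simp_all only: mult.commute[of "J (P x) $ 1 $ 2"])
    moreover have "2 * K * K * P x $ 1 = K * (K * P x $ 1) + K * (K * P x $ 1)" by simp
    ultimately show "det (J (P x)) \<le> 2 * K * K * P x $ 1" unfolding det_2 by linarith
  qed
qed

lemma ray_in_ring: "\<forall>\<^sub>F \<sigma> in at_right 0. vector [\<sigma>, t] \<in> ring"
  using eventually_at_right_less[of 0] eventually_at_right[of 0 L] L_pos
  by (auto simp: ring_def eventually_at_right_field)

lemma F_ray_filterlim: "filterlim (\<lambda>\<sigma>. F (vector [\<sigma>, t])) (at x0) (at_right 0)"
proof -
  have "continuous_on {0..L} (\<lambda>\<sigma>. F (vector [\<sigma>, t]))"
  proof (rule continuous_on_compose2[OF continuous_F])
    have "vector [\<sigma>, t] = (\<sigma> *\<^sub>R axis 1 1 + axis 2 t :: real^2)" for \<sigma>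
      by (auto simp: vec_eq_iff forall_2 axis_def)
    then show "continuous_on {0..L} (\<lambda>\<sigma>. vector [\<sigma>, t] :: real^2)" by (simp add: continuous_intros)
  qed (auto simp: strip_def)
  then have "((\<lambda>\<sigma>. F (vector [\<sigma>, t])) \<longlongrightarrow> F (vector [0, t])) (at 0 within {0..L})"
    using L_pos by (auto simp: continuous_on_def)
  moreover have "F (vector [0, t]) = x0" using L_pos by (intro F_pole) (auto simp: strip_def)
  moreover have "at 0 within {0..L} = at_right (0::real)"
    using L_pos by (rule at_within_Icc_at_right)
  moreover have "\<forall>\<^sub>F \<sigma> in at_right 0. F (vector [\<sigma>, t]) \<noteq> x0"
    using ray_in_ring[of t]
  proof eventually_elim
    case (elim \<sigma>)
    show ?case using F_ring[OF elim] by (auto simp: \<Omega>0_def)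
  qed
  ultimately show ?thesis by (simp add: filterlim_at)
qed

lemma right_inverse_derivative_matrix:
  assumes W: "open W" "x \<in> W" "W \<subseteq> \<Omega>0" and FG: "\<And>x. x \<in> W \<Longrightarrow> F (G x) = x"
    and D: "(G has_derivative (\<lambda>h. A *v h)) (at x)"
    and G: "G x $ 1 = P x $ 1" "\<exists>k::int. G x $ 2 = P x $ 2 + 2 * pi * of_int k"
  shows "A = matrix_inv (J (P x))"
proof -
  obtain k :: int where "G x = P x + vector [0, 2 * pi * of_int k]"
    using G by (auto simp: vec_eq_iff forall_2)
  moreover have ring: "P x \<in> ring" using polar_coords_inner(1) W(2,3) by blast
  ultimately have J: "J (G x) = J (P x)" and "G x \<in> ring"
    by (simp_all add: J_shift) (simp add: ring_def)
  then have "((\<lambda>x. F (G x)) has_derivative (\<lambda>h. J (P x) *v (A *v h))) (at x)"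
    using has_derivative_compose[OF D F_has_derivative] by metis
  moreover have "((\<lambda>x. F (G x)) has_derivative (\<lambda>h. h)) (at x)"
    by (rule has_derivative_transform_within_open[OF has_derivative_ident W(1,2)])
      (rule FG[symmetric])
  ultimately have "(\<lambda>h. J (P x) *v (A *v h)) = (\<lambda>h. h)" by (rule has_derivative_unique)
  then have "(J (P x) ** A) *v h = mat 1 *v h" for h
    by (simp add: matrix_vector_mul_assoc fun_eq_iff)
  then have "J (P x) ** A = mat 1" by (simp add: matrix_eq)
  then show ?thesis by (rule matrix_inv_eqI[symmetric])
qed

lemma local_lift:
  assumes y: "y \<in> \<Omega>0"
  obtains W G where "open W" "y \<in> W" "W \<subseteq> \<Omega>0"
    "\<forall>x\<in>W. G x $ 1 = P x $ 1 \<and> (\<exists>k::int. G x $ 2 = P x $ 2 + 2 * pi * of_int k)"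
    "\<forall>x\<in>W. (G has_derivative (\<lambda>h. matrix_inv (J (P x)) *v h)) (at x)"
    "continuous_on W (\<lambda>x. matrix_inv (J (P x)))"
proof -
  let ?Y = "closure \<Omega> - {x0}"
  obtain U G where U: "open U" "y \<in> U" and C1: "C1_map_on (U \<inter> ?Y) G"
    and strip: "G ` (U \<inter> ?Y) \<subseteq> strip0 L"
    and FG: "\<forall>x\<in>U \<inter> ?Y. F (G x) = x"
    using F_local_inverse[OF subsetD[OF \<Omega>0_subset y]] by (elim exE conjE) (rule that)
  obtain A where A: "\<forall>x\<in>U \<inter> ?Y. (G has_derivative (\<lambda>h. A x *v h)) (at x within U \<inter> ?Y)"
    and cont: "continuous_on (U \<inter> ?Y) A" using C1 unfolding C1_map_on_def by blast
  define W where "W = U \<inter> \<Omega>0"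
  have W: "open W" "y \<in> W" "W \<subseteq> \<Omega>0" "W \<subseteq> U \<inter> ?Y"
    using U y open_\<Omega>0 \<Omega>0_subset by (auto simp: W_def)
  have D: "(G has_derivative (\<lambda>h. A x *v h)) (at x)" if "x \<in> W" for x
    using has_derivative_subset[OF bspec[OF A] W(4)] W(4) that
    by (metis at_within_open[OF that W(1)] subsetD)
  have G: "G x $ 1 = P x $ 1" "\<exists>k::int. G x $ 2 = P x $ 2 + 2 * pi * of_int k" if "x \<in> W" for x
  proof -
    have x: "x \<in> U \<inter> ?Y" using that W by blast
    then have "G x \<in> strip0 L" "P x \<in> strip0 L" "F (G x) = F (P x)"
      using strip FG polar_coords(1,4)[of x] by auto
    then show "G x $ 1 = P x $ 1" "\<exists>k::int. G x $ 2 = P x $ 2 + 2 * pi * of_int k"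
      using F_inj by blast+
  qed
  have inv: "A x = matrix_inv (J (P x))" if x: "x \<in> W" for x
    using FG W(4) by (intro right_inverse_derivative_matrix[OF W(1) x W(3) _ D[OF x] G[OF x]]) blast
  show thesis
  proof (rule that[where G = G, OF W(1-3)])
    show "continuous_on W (\<lambda>x. matrix_inv (J (P x)))"
      using continuous_on_subset[OF cont W(4)] by (rule continuous_on_eq) (rule inv)
  qed (use G D inv in auto)
qed

definition coordinate_range :: "2 \<Rightarrow> real set" where
  "coordinate_range i = (if i = 1 then {0..<L} else UNIV)"

text \<open>The angle \<open>P x $ 2\<close> jumps across a ray, but \<open>2\<pi>\<close>-periodic functions of it may be evaluated at a
  local lift \<open>g\<close> instead.\<close>

lemma local_coordinate:
  assumes "y \<in> \<Omega>0"
  obtains W g where "open W" "y \<in> W" "W \<subseteq> \<Omega>0" "loc_lipschitz W g" "g ` W \<subseteq> coordinate_range i"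
    "\<And>x. x \<in> W \<Longrightarrow> GDERIV g x :> polar_grad i x"
    "\<And>x. x \<in> W \<Longrightarrow> g x = P x $ i \<or> i = 2 \<and> (\<exists>k::int. g x = P x $ i + 2 * pi * of_int k)"
proof -
  obtain W G where W: "open W" "y \<in> W" "W \<subseteq> \<Omega>0"
    and G: "\<forall>x\<in>W. G x $ 1 = P x $ 1 \<and> (\<exists>k::int. G x $ 2 = P x $ 2 + 2 * pi * of_int k)"
    and D: "\<forall>x\<in>W. (G has_derivative (\<lambda>h. matrix_inv (J (P x)) *v h)) (at x)"
    and cont: "continuous_on W (\<lambda>x. matrix_inv (J (P x)))"
    by (rule local_lift[OF assms])
  have grad: "GDERIV (\<lambda>x. G x $ i) x :> polar_grad i x" if "x \<in> W" for x
    using bounded_linear.has_derivative[OF bounded_linear_vec_nth bspec[OF D that], of i]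
    by (simp add: gderiv_def polar_grad_def matrix_vector_mul_component inner_commute)
  show thesis
  proof (rule that[OF W])
    show "loc_lipschitz W (\<lambda>x. G x $ i)"
      by (rule C1_imp_loc_lipschitz[OF W(1) grad])
        (simp_all add: polar_grad_def continuous_on_component cont)
    show "(\<lambda>x. G x $ i) ` W \<subseteq> coordinate_range i"
    proof (rule image_subsetI)
      fix x assume x: "x \<in> W"
      then have "G x $ 1 = P x $ 1" "0 < P x $ 1" "P x $ 1 < L" using G W(3) radius_bounds by auto
      then show "G x $ i \<in> coordinate_range i" by (simp add: coordinate_range_def)
    qed
    show "G x $ i = P x $ i \<or> i = 2 \<and> (\<exists>k::int. G x $ i = P x $ i + 2 * pi * of_int k)" if "x \<in> W"
      for x
      using G that exhaust_2[of i] by auto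
  qed (rule grad)
qed

lemma continuous_on_polar_grad: "continuous_on \<Omega>0 (polar_grad i)"
proof (rule continuous_at_imp_continuous_on, rule ballI)
  fix y assume "y \<in> \<Omega>0"
  then obtain W G where W: "open W" "y \<in> W" and "continuous_on W (\<lambda>x. matrix_inv (J (P x)))"
    by (rule local_lift)
  then have "continuous_on W (polar_grad i)" by (simp add: polar_grad_def continuous_on_component)
  then show "isCont (polar_grad i) y" using W continuous_on_eq_continuous_at by blast
qed

lemma loc_lipschitz_coordinate:
  assumes f: "loc_lipschitz (coordinate_range i) f"
    and per: "\<And>t (k::int). i = 2 \<Longrightarrow> f (t + 2 * pi * of_int k) = f t"
  shows "loc_lipschitz \<Omega>0 (\<lambda>x. f (P x $ i))"
proof (rule loc_lipschitz_locallyI)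
  fix y assume "y \<in> \<Omega>0"
  then obtain W g where W: "open W" "y \<in> W" and g: "loc_lipschitz W g" "g ` W \<subseteq> coordinate_range i"
    and eq: "\<And>x. x \<in> W \<Longrightarrow> g x = P x $ i \<or> i = 2 \<and> (\<exists>k::int. g x = P x $ i + 2 * pi * of_int k)"
    by (rule local_coordinate[of _ i]) (rule that; assumption)
  have "loc_lipschitz W (\<lambda>x. f (P x $ i))"
  proof (rule loc_lipschitz_cong[OF loc_lipschitz_compose[OF g(1) f g(2)]])
    show "f (g x) = f (P x $ i)" if "x \<in> W" for x using eq[OF that] per by auto
  qed
  then show "\<exists>W. open W \<and> y \<in> W \<and> loc_lipschitz W (\<lambda>x. f (P x $ i))" using W by blast
qed

lemma GDERIV_coordinate:
  assumes y: "y \<in> \<Omega>0" and f: "(f has_real_derivative D) (at (P y $ i))"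
    and per: "\<And>t (k::int). i = 2 \<Longrightarrow> f (t + 2 * pi * of_int k) = f t"
  shows "GDERIV (\<lambda>x. f (P x $ i)) y :> D *\<^sub>R polar_grad i y"
proof -
  obtain W g where W: "open W" "y \<in> W" and g: "\<And>x. x \<in> W \<Longrightarrow> GDERIV g x :> polar_grad i x"
    and eq: "\<And>x. x \<in> W \<Longrightarrow> g x = P x $ i \<or> i = 2 \<and> (\<exists>k::int. g x = P x $ i + 2 * pi * of_int k)"
    using y by (rule local_coordinate[of _ i]) (rule that; assumption)
  have "(f has_real_derivative D) (at (g y))"
    using eq[OF W(2)] f per DERIV_shift[of f D "P y $ i"] by auto
  then have "GDERIV (\<lambda>x. f (g x)) y :> D *\<^sub>R polar_grad i y"
    by (rule GDERIV_DERIV_compose[OF g[OF W(2)]])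
  moreover have "f (g x) = f (P x $ i)" if "x \<in> W" for x using eq[OF that] per by auto
  ultimately show ?thesis by (rule GDERIV_transform_open[OF _ W])
qed

lemma negligible_coordinate:
  assumes "countable N"
  shows "negligible {x \<in> \<Omega>0. P x $ i \<in> N}"
proof -
  let ?Z = "ring \<inter> {z. z $ i \<in> N}"
  have "negligible {z::real^2. z $ i = c}" for c
  proof -
    have "negligible {z::real^2. axis i 1 \<bullet> z = c}"
      by (rule negligible_hyperplane) (simp add: axis_eq_0_iff)
    then show ?thesis by (simp add: inner_axis')
  qed
  then have "negligible (\<Union>((\<lambda>c. {z::real^2. z $ i = c}) ` N))"
    using assms by (intro negligible_countable_Union) auto
  then have "negligible ?Z" by (rule negligible_subset) auto
  moreover have "F differentiable_on ?Z"
    unfolding differentiable_on_def using F_has_derivative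
    by (auto simp: differentiable_def intro: has_derivative_at_withinI)
  ultimately have "negligible (F ` ?Z)" by (intro negligible_differentiable_image_negligible) auto
  moreover have "{x \<in> \<Omega>0. P x $ i \<in> N} \<subseteq> F ` ?Z"
    using polar_coords_inner(1,4) by (auto intro!: image_eqI[of _ _ "P x" for x])
  ultimately show ?thesis by (rule negligible_subset)
qed

lemma has_ae_gradient_coordinate:
  assumes "loc_lipschitz (coordinate_range i) f"
    and per: "\<And>t (k::int). i = 2 \<Longrightarrow> f (t + 2 * pi * of_int k) = f t"
    and "countable N" and f': "\<And>t. t \<notin> N \<Longrightarrow> (f has_real_derivative f' t) (at t)"
  shows "has_ae_gradient \<Omega>0 (\<lambda>x. f (P x $ i)) (\<lambda>x. f' (P x $ i) *\<^sub>R polar_grad i x)"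
  unfolding has_ae_gradient_def
proof
  show "loc_lipschitz \<Omega>0 (\<lambda>x. f (P x $ i))" by (rule loc_lipschitz_coordinate[OF assms(1,2)])
  have "AE x in lebesgue. x \<in> \<Omega>0 \<longrightarrow> GDERIV (\<lambda>x. f (P x $ i)) x :> f' (P x $ i) *\<^sub>R polar_grad i x"
    using AE_not_negligible[OF negligible_coordinate[OF assms(3), of i]]
    by eventually_elim (auto intro: GDERIV_coordinate f' per)
  then show "AE x in lebesgue_on \<Omega>0. GDERIV (\<lambda>x. f (P x $ i)) x :> f' (P x $ i) *\<^sub>R polar_grad i x"
    using open_\<Omega>0 by (simp add: lebesgue_on_AE_iff)
qed

lemma punctured_\<Omega>:
  "\<Omega>0 \<in> sets lebesgue" "\<Omega> \<in> sets lebesgue" "\<Omega>0 \<subseteq> \<Omega>" "negligible (\<Omega> - \<Omega>0)"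
  using punctured_domain(2,4,5)[OF open_\<Omega>, of x0] open_\<Omega> by (simp_all add: \<Omega>0_def)

lemma borel_measurable_off_pole:
  fixes f :: "real^2 \<Rightarrow> 'b::euclidean_space"
  shows "f \<in> borel_measurable (lebesgue_on \<Omega>0) \<longleftrightarrow> f \<in> borel_measurable (lebesgue_on \<Omega>)"
  by (rule lebesgue_on_negligible_measurable[OF punctured_\<Omega>])

lemma borel_measurable_polar_coords: "P \<in> borel_measurable (lebesgue_on \<Omega>)"
  unfolding borel_measurable_off_pole[symmetric]
proof (rule measurableI)
  fix A :: "(real^2) set" assume A: "A \<in> sets borel"
  let ?S = "A \<inter> ring \<inter> {z. 0 \<le> z $ 2 \<and> z $ 2 < 2 * pi}"
  have "{z::real^2. 0 \<le> z $ 2 \<and> z $ 2 < 2 * pi} \<in> sets borel"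
    by (simp add: Collect_conj_eq borel_closed borel_open closed_Collect_le open_Collect_less
        continuous_on_component
        continuous_on_const continuous_on_id sets.Int)
  then have "?S \<in> sets borel" using A open_ring by (intro sets.Int) auto
  then have S: "?S \<in> sets lebesgue" by simp
  have "F differentiable_on ?S"
    unfolding differentiable_on_def using F_has_derivative
    by (auto simp: differentiable_def intro: has_derivative_at_withinI)
  then have "F ` ?S \<in> sets lebesgue" using S by (intro differentiable_image_in_sets_lebesgue) auto
  moreover have "P -` A \<inter> \<Omega>0 = F ` ?S"
  proof (intro equalityI subsetI)
    fix x assume "x \<in> P -` A \<inter> \<Omega>0"
    then show "x \<in> F ` ?S" using polar_coords_inner[of x] by (intro image_eqI[of _ _ "P x"]) auto
  next
    fix x assume "x \<in> F ` ?S"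
    then show "x \<in> P -` A \<inter> \<Omega>0" using polar_coords_F_eq F_ring by auto
  qed
  ultimately show "P -` A \<inter> space (lebesgue_on \<Omega>0) \<in> sets (lebesgue_on \<Omega>0)"
    using open_\<Omega>0 by (simp add: sets_restrict_space_iff image_subset_iff F_ring)
qed simp

lemma borel_measurable_coordinate:
  assumes "f \<in> borel_measurable borel"
  shows "(\<lambda>x. f (P x $ i)) \<in> borel_measurable (lebesgue_on \<Omega>)"
proof -
  have "(\<lambda>z::real^2. z $ i) \<in> borel_measurable borel"
    by (intro borel_measurable_continuous_onI continuous_intros)
  then have "(\<lambda>z::real^2. f (z $ i)) \<in> borel_measurable borel" using assms by measurable
  then show ?thesis by (rule measurable_compose[OF borel_measurable_polar_coords])
qed

lemma borel_measurable_polar_grad: "polar_grad i \<in> borel_measurable (lebesgue_on \<Omega>)"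
  unfolding borel_measurable_off_pole[symmetric]
  using continuous_on_polar_grad open_\<Omega>0 by (intro continuous_imp_measurable_on_sets_lebesgue) auto

lemma borel_measurable_inverse_det_J:
  "(\<lambda>x. inverse (det (J (P x)))) \<in> borel_measurable (lebesgue_on \<Omega>)"
proof -
  have "(\<lambda>x. rot (polar_grad 2 x) \<bullet> polar_grad 1 x) \<in> borel_measurable (lebesgue_on \<Omega>0)"
    using open_\<Omega>0 continuous_on_polar_grad
    by (intro continuous_imp_measurable_on_sets_lebesgue continuous_on_inner)
      (auto intro: continuous_on_compose2[OF linear_continuous_on[OF linear_conv_bounded_linear[THEN
          iffD1, OF linear_rot]]])
  then have "(\<lambda>x. inverse (det (J (P x)))) \<in> borel_measurable (lebesgue_on \<Omega>0)"
    by (rule measurable_cong[THEN iffD1, rotated]) (simp add: rot_polar_grad_inner)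
  then show ?thesis by (simp add: borel_measurable_off_pole)
qed

lemma eventually_at_pole: "\<forall>\<^sub>F x in at x0. x \<in> \<Omega>0"
  unfolding \<Omega>0_def by (rule eventually_at_in_open[OF open_\<Omega> x0_in])

lemma radius_tendsto_0: "((\<lambda>x. P x $ 1) \<longlongrightarrow> 0) (at x0)"
proof (rule tendstoI)
  fix e :: real assume e: "0 < e"
  let ?B = "cbox (vector [e, 0]) (vector [L, 2 * pi]) :: (real^2) set"
  have B: "?B \<subseteq> strip0 L" using e by (auto simp: strip0_def mem_box_cart forall_2)
  then have "compact (F ` ?B)"
    using strip0_subset continuous_F
    by (intro compact_continuous_image) (auto intro: continuous_on_subset)
  moreover have "x0 \<notin> F ` ?B" using B F_strip0 by blast
  ultimately have "\<forall>\<^sub>F x in at x0. x \<in> - F ` ?B - {x0}"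
    by (intro eventually_at_in_open) (auto simp: open_Compl compact_imp_closed)
  then show "\<forall>\<^sub>F x in at x0. dist (P x $ 1) 0 < e"
    using eventually_at_pole
  proof eventually_elim
    case (elim x)
    then have "P x \<notin> ?B" using polar_coords_inner(4)[of x] by force
    then show ?case
      using polar_coords_inner(1-3)[OF elim(2)]
      by (auto simp: mem_box_cart forall_2 ring_def dist_real_def)
  qed
qed

lemma O_radius_tendsto_0:
  assumes "O_radius f"
  shows "(f \<longlongrightarrow> 0) (at x0)"
proof -
  obtain K where K: "\<And>x. x \<in> \<Omega>0 \<Longrightarrow> \<bar>f x\<bar> \<le> K * P x $ 1" using assms by (rule O_radiusE) blast
  show ?thesis
  proof (rule Lim_null_comparison)
    show "\<forall>\<^sub>F x in at x0. norm (f x) \<le> K * P x $ 1"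
      using eventually_at_pole by eventually_elim (simp add: K)
    show "((\<lambda>x. K * P x $ 1) \<longlongrightarrow> 0) (at x0)" by (rule tendsto_mult_right_zero[OF radius_tendsto_0])
  qed
qed

lemma continuous_on_extend_pole:
  assumes f: "continuous_on \<Omega>0 f" and "O_radius (\<lambda>x. f x - \<gamma>)"
  shows "continuous_on \<Omega> (f(x0 := \<gamma>))"
proof (rule continuous_at_imp_continuous_on, rule ballI)
  fix y assume y: "y \<in> \<Omega>"
  show "isCont (f(x0 := \<gamma>)) y"
  proof (cases "y = x0")
    case True
    have "(f \<longlongrightarrow> \<gamma>) (at x0)" using O_radius_tendsto_0[OF assms(2)] by (simp add: LIM_zero_iff)
    moreover have "\<forall>\<^sub>F x in at x0. f x = (f(x0 := \<gamma>)) x"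
      using eventually_neq_at_within[of x0 x0 UNIV] by eventually_elim simp
    ultimately show ?thesis
      unfolding True continuous_at fun_upd_same by (rule Lim_transform_eventually)
  next
    case False
    then have "isCont f y" using f y open_\<Omega>0 continuous_on_eq_continuous_at by (auto simp: \<Omega>0_def)
    moreover have "\<forall>\<^sub>F x in nhds y. f x = (f(x0 := \<gamma>)) x"
      using t1_space_nhds[OF False] by eventually_elim simp
    ultimately show ?thesis using isCont_cong by blast
  qed
qed

lemma has_ae_gradient_angle:
  shows "has_ae_gradient \<Omega>0 (\<lambda>x. cos (P x $ 2)) (\<lambda>x. - sin (P x $ 2) *\<^sub>R polar_grad 2 x)"
    and "has_ae_gradient \<Omega>0 (\<lambda>x. sin (P x $ 2)) (\<lambda>x. cos (P x $ 2) *\<^sub>R polar_grad 2 x)"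
proof -
  have lip: "loc_lipschitz (coordinate_range 2) (f :: real \<Rightarrow> real)"
    if "\<And>t. (f has_real_derivative f' t) (at t)" "continuous_on UNIV f'" for f f'
  proof (rule loc_lipschitz_subset[OF C1_imp_loc_lipschitz[OF open_UNIV _ that(2)] subset_UNIV])
    show "GDERIV f t :> f' t" for t using that(1) by simp
  qed
  have shift: "cos (t + 2 * pi * of_int k) = cos t" "sin (t + 2 * pi * of_int k) = sin t"
    for t and k :: int
    by (simp_all only: sin_add cos_add cos_int_2pin sin_int_2pin mult_1_right mult_zero_right
        diff_zero add_0_right)
  show "has_ae_gradient \<Omega>0 (\<lambda>x. cos (P x $ 2)) (\<lambda>x. - sin (P x $ 2) *\<^sub>R polar_grad 2 x)"
    by (rule has_ae_gradient_coordinate[OF lip shift(1) countable_empty])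
      (auto intro: DERIV_cos intro!: continuous_on_minus continuous_on_sin continuous_on_id)
  show "has_ae_gradient \<Omega>0 (\<lambda>x. sin (P x $ 2)) (\<lambda>x. cos (P x $ 2) *\<^sub>R polar_grad 2 x)"
    by (rule has_ae_gradient_coordinate[OF lip shift(2) countable_empty])
      (auto intro: DERIV_sin intro!: continuous_on_cos continuous_on_id)
qed

text \<open>The angle itself is multivalued, but \<open>d\<theta> = cos \<theta> d(sin \<theta>) - sin \<theta> d(cos \<theta>)\<close>.\<close>

lemma weak_div_rot_angle:
  assumes f: "has_ae_gradient \<Omega>0 f f'"
  shows "weak_div \<Omega>0 (\<lambda>x. rot (f x *\<^sub>R polar_grad 2 x)) (\<lambda>x. f' x \<bullet> rot (polar_grad 2 x))"
proof -
  let ?c = "\<lambda>x. cos (P x $ 2)" and ?s = "\<lambda>x. sin (P x $ 2)" and ?g = "polar_grad 2"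
  let ?dc = "\<lambda>x. - ?s x *\<^sub>R ?g x" and ?ds = "\<lambda>x. ?c x *\<^sub>R ?g x"
  note cos = has_ae_gradient_angle(1) and sin = has_ae_gradient_angle(2)
  have "weak_div \<Omega>0 (\<lambda>x. rot ((f x * ?c x) *\<^sub>R ?ds x) + rot ((f x * ?s x) *\<^sub>R (- 1 *\<^sub>R ?dc x)))
     (\<lambda>x. (f x *\<^sub>R ?dc x + ?c x *\<^sub>R f' x) \<bullet> rot (?ds x)
       + (f x *\<^sub>R ?ds x + ?s x *\<^sub>R f' x) \<bullet> rot (- 1 *\<^sub>R ?dc x))"
    by (rule weak_div_add[OF
          weak_div_rot_gradient[OF open_\<Omega>0 has_ae_gradient_mult[OF f cos] sin]
          weak_div_rot_gradient[OF open_\<Omega>0 has_ae_gradient_mult[OF f sin]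
              has_ae_gradient_cmult[OF cos]]])
  moreover have "rot ((f x * ?c x) *\<^sub>R ?ds x) + rot ((f x * ?s x) *\<^sub>R (- 1 *\<^sub>R ?dc x)) =
      rot (f x *\<^sub>R ?g x)" for x
  proof -
    have "(f x * ?c x) *\<^sub>R ?ds x + (f x * ?s x) *\<^sub>R (- 1 *\<^sub>R ?dc x)
      = (f x * (?c x * ?c x) + f x * (?s x * ?s x)) *\<^sub>R ?g x"
      by (simp add: scaleR_add_left mult.assoc)
    then show ?thesis
      unfolding linear_add[OF linear_rot, symmetric]
      by (simp only: distrib_left[symmetric] sin_cos_squared_add3 mult_1_right)
  qed
  moreover have "(f x *\<^sub>R ?dc x + ?c x *\<^sub>R f' x) \<bullet> rot (?ds x)
      + (f x *\<^sub>R ?ds x + ?s x *\<^sub>R f' x) \<bullet> rot (- 1 *\<^sub>R ?dc x) = f' x \<bullet> rot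
        (?g x)" (is "?lhs = _") for x
  proof -
    have "?lhs = (?c x * ?c x + ?s x * ?s x) * (f' x \<bullet> rot (?g x))"
      by (simp only: linear_scale[OF linear_rot] inner_add_left inner_scaleR_left
          inner_scaleR_right)
        (simp add: algebra_simps del: sin_cos_squared_add3)
    then show ?thesis by (simp only: sin_cos_squared_add3 mult_1_left)
  qed
  ultimately show ?thesis by (simp only:)
qed

lemma weak_div_rot_angular:
  assumes f: "has_ae_gradient \<Omega>0 f f'"
    and b: "loc_lipschitz UNIV b" "\<And>t (k::int). b (t + 2 * pi * of_int k) = b t"
    and "countable N" "\<And>t. t \<notin> N \<Longrightarrow> (b has_real_derivative e t - m) (at t)"
  shows "weak_div \<Omega>0 (\<lambda>x. rot ((f x * e (P x $ 2)) *\<^sub>R polar_grad 2 x))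
    (\<lambda>x. e (P x $ 2) * (f' x \<bullet> rot (polar_grad 2 x)))"
proof -
  let ?e = "\<lambda>x. e (P x $ 2)" and ?g = "polar_grad 2"
  have "has_ae_gradient \<Omega>0 (\<lambda>x. b (P x $ 2)) (\<lambda>x. (?e x - m) *\<^sub>R ?g x)"
    using assms by (intro has_ae_gradient_coordinate loc_lipschitz_subset[OF b(1)]) auto
  then have "weak_div \<Omega>0 (\<lambda>x. rot (f x *\<^sub>R ((?e x - m) *\<^sub>R ?g x)) + rot ((m * f x) *\<^sub>R ?g x))
      (\<lambda>x. f' x \<bullet> rot ((?e x - m) *\<^sub>R ?g x) + (m *\<^sub>R f' x) \<bullet> rot (?g x))"
    by (intro weak_div_add weak_div_rot_gradient[OF open_\<Omega>0 f] weak_div_rot_angle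
        has_ae_gradient_cmult f)
  moreover have "rot (f x *\<^sub>R ((?e x - m) *\<^sub>R ?g x)) + rot ((m * f x) *\<^sub>R ?g x) =
      rot ((f x * ?e x) *\<^sub>R ?g x)" for x
    unfolding linear_add[OF linear_rot, symmetric] by (simp add: algebra_simps)
  moreover have "f' x \<bullet> rot ((?e x - m) *\<^sub>R ?g x) + (m *\<^sub>R f' x) \<bullet> rot (?g x) =
      ?e x * (f' x \<bullet> rot (?g x))" for x
    by (simp only: linear_scale[OF linear_rot] inner_scaleR_left inner_scaleR_right)
      (simp add: algebra_simps)
  ultimately show ?thesis by (simp only:)
qed

context
  fixes a b t1 t2 :: real
  assumes a: "0 < a" "a \<le> b" "b < L" and t: "0 \<le> t1" "t1 \<le> t2" "t2 < 2 * pi"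
begin

lemma polar_box_in_ring:
  assumes "z \<in> cbox (vector [a, t1]) (vector [b, t2])"
  shows "z \<in> ring" "P (F z) = z" "a \<le> z $ 1"
proof -
  show "z \<in> ring" "a \<le> z $ 1" using assms a by (auto simp: ring_def mem_box_cart forall_2)
  then show "P (F z) = z"
    using assms t by (intro polar_coords_F_eq) (auto simp: mem_box_cart forall_2)
qed

lemma polar_box_lmeasurable: "F ` cbox (vector [a, t1]) (vector [b, t2]) \<in> lmeasurable"
proof (rule lmeasurable_compact, rule compact_continuous_image)
  show "continuous_on (cbox (vector [a, t1]) (vector [b, t2])) F"
    using continuous_F polar_box_in_ring(1) ring_strip by (blast intro: continuous_on_subset)
qed simp

lemma measure_polar_box_ge:
  assumes c: "0 < c" "\<And>z. z \<in> strip L \<Longrightarrow> c * z $ 1 \<le> det (J z)"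
  shows "c * a * ((b - a) * (t2 - t1)) \<le>
      measure lebesgue (F ` cbox (vector [a, t1]) (vector [b, t2]))"
proof -
  let ?S = "cbox (vector [a, t1]) (vector [b, t2]) :: (real^2) set"
  have "continuous_on ?S J"
    using continuous_on_J polar_box_in_ring(1) by (blast intro: continuous_on_subset)
  then have int: "(\<lambda>z. \<bar>det (J z)\<bar>) integrable_on ?S"
    unfolding det_2 by (intro integrable_continuous continuous_intros)
  have "c * a * ((b - a) * (t2 - t1)) = integral ?S (\<lambda>z. c * a)"
    using a t content_cbox_cart[of "vector [a, t1] :: real^2" "vector [b, t2]"]
    by (simp add: interval_eq_empty_cart not_less forall_2 UNIV_2)
  also have "\<dots> \<le> integral ?S (\<lambda>z. \<bar>det (J z)\<bar>)"
  proof (rule integral_le[OF integrable_const int])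
    fix z assume z: "z \<in> ?S"
    then have "z \<in> strip L" using polar_box_in_ring(1) ring_strip by blast
    moreover have "c * a \<le> c * z $ 1" using c(1) polar_box_in_ring(3)[OF z] by simp
    ultimately show "c * a \<le> \<bar>det (J z)\<bar>" using c(2)[of z] by linarith
  qed
  also have "\<dots> = measure lebesgue (F ` ?S)"
  proof -
    have "measure lebesgue (F ` ?S) = integral ?S (\<lambda>z. \<bar>det (matrix (\<lambda>h. J z *v h))\<bar>)"
    proof (rule measure_differentiable_image_eq)
      show "(F has_derivative (\<lambda>h. J z *v h)) (at z within ?S)" if "z \<in> ?S" for z
        using F_has_derivative[OF polar_box_in_ring(1)[OF that]] by (rule has_derivative_at_withinI)
      show "inj_on F ?S" using polar_box_in_ring(2) by (metis inj_onI)
    qed (use int in simp_all)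
    then show ?thesis by simp
  qed
  finally show ?thesis .
qed

lemma L2_polar_box_lower_bound:
  fixes f :: "real^2 \<Rightarrow> 'b::euclidean_space"
  assumes c: "0 < c" "\<And>z. z \<in> strip L \<Longrightarrow> c * z $ 1 \<le> det (J z)" and f: "f \<in> L2 \<Omega>" and \<kappa>: "0 \<le> \<kappa>"
    and bound: "\<And>x. x \<in> F ` cbox (vector [a, t1]) (vector [b, t2]) \<Longrightarrow> \<kappa> \<le> norm (f x)"
  shows "\<kappa>\<^sup>2 * (c * a * ((b - a) * (t2 - t1))) \<le>
    (LINT x|lebesgue_on \<Omega>. indicator (F ` cbox (vector [a, t1]) (vector [b, t2])) x *
        (norm (f x))\<^sup>2)"
proof -
  let ?Q = "F ` cbox (vector [a, t1]) (vector [b, t2])"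
  have sub: "?Q \<subseteq> \<Omega>" using polar_box_in_ring(1) F_ring punctured_\<Omega>(3) by blast
  have sets: "?Q \<in> sets (lebesgue_on \<Omega>)"
    using polar_box_lmeasurable sub punctured_\<Omega>(2)
    by (auto simp: sets_restrict_space_iff fmeasurableD)
  have int: "integrable (lebesgue_on \<Omega>) (\<lambda>x. (norm (f x))\<^sup>2)" using f by (simp add: L2_def)
  have "emeasure (lebesgue_on \<Omega>) ?Q < \<infinity>"
    using fmeasurableD2[OF polar_box_lmeasurable] sub punctured_\<Omega>(2)
    by (simp add: emeasure_restrict_space less_top)
  then have ind: "integrable (lebesgue_on \<Omega>) (\<lambda>x. \<kappa>\<^sup>2 * indicator ?Q x)"
    using sets by (intro integrable_mult_right integrable_real_indicator)
  have "\<kappa>\<^sup>2 * (c * a * ((b - a) * (t2 - t1))) \<le> \<kappa>\<^sup>2 * measure lebesgue ?Q"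
    by (intro mult_left_mono measure_polar_box_ge c) auto
  also have "\<dots> = (LINT x|lebesgue_on \<Omega>. \<kappa>\<^sup>2 * indicator ?Q x)"
    using sub punctured_\<Omega>(2) by (simp add: measure_restrict_space Int_absorb2)
  also have "\<dots> \<le> (LINT x|lebesgue_on \<Omega>. indicator ?Q x * (norm (f x))\<^sup>2)"
  proof (rule integral_mono[OF ind])
    show "integrable (lebesgue_on \<Omega>) (\<lambda>x. indicator ?Q x * (norm (f x))\<^sup>2)"
      using integrable_mult_indicator[OF sets int] by simp
    show "\<kappa>\<^sup>2 * indicator ?Q x \<le> indicator ?Q x * (norm (f x))\<^sup>2" for x
      using bound[of x] \<kappa> by (cases "x \<in> ?Q") (simp_all add: power_mono)
  qed
  finally show ?thesis .
qed

end

lemma L2_dyadic_polar_box_lower_bound: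
  fixes f :: "real^2 \<Rightarrow> 'b::euclidean_space" and \<sigma> t \<delta> :: real
  defines "Q \<equiv> F ` cbox (vector [\<sigma> / 2, t - \<delta>]) (vector [\<sigma>, t + \<delta>])"
  assumes \<sigma>: "0 < \<sigma>" "\<sigma> < L" and sector: "0 \<le> t - \<delta>" "t + \<delta> < 2 * pi" "0 < \<delta>"
    and c: "0 < c" "\<And>z. z \<in> strip L \<Longrightarrow> c * z $ 1 \<le> det (J z)" and f: "f \<in> L2 \<Omega>" and \<kappa>: "0 \<le> \<kappa>"
    and growth: "\<And>x. x \<in> Q \<Longrightarrow> \<kappa> \<le> P x $ 1 * norm (f x)" "\<And>x. x \<in> Q \<Longrightarrow> P x $ 1 \<le> \<sigma>"
  shows "\<kappa>\<^sup>2 * (c * \<delta>) / 2 \<le> (LINT x|lebesgue_on \<Omega>. indicator Q x * (norm (f x))\<^sup>2)"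
proof -
  have "\<kappa> / \<sigma> \<le> norm (f x)" if x: "x \<in> Q" for x
  proof -
    have "\<kappa> \<le> P x $ 1 * norm (f x)" by (rule growth(1)[OF x])
    also have "\<dots> \<le> \<sigma> * norm (f x)" using growth(2)[OF x] by (rule mult_right_mono) simp
    finally show ?thesis using \<sigma>(1) by (simp add: field_simps)
  qed
  then have "(\<kappa> / \<sigma>)\<^sup>2 * (c * (\<sigma> / 2) * ((\<sigma> - \<sigma> / 2) * ((t + \<delta>) - (t - \<delta>))))
      \<le> (LINT x|lebesgue_on \<Omega>. indicator Q x * (norm (f x))\<^sup>2)"
    unfolding Q_def using \<kappa> \<sigma> sector by (intro L2_polar_box_lower_bound[OF _ _ _ _ _ _ c f]) auto
  moreover have "(\<kappa> / \<sigma>)\<^sup>2 * (c * (\<sigma> / 2) * ((\<sigma> - \<sigma> / 2) * ((t + \<delta>) - (t - \<delta>)))) =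
      \<kappa>\<^sup>2 * (c * \<delta>) / 2"
    using \<sigma>(1) by (simp add: power2_eq_square field_simps)
  ultimately show ?thesis by (simp only:)
qed

lemma integral_shrinking_to_pole_tendsto_0:
  fixes f :: "real^2 \<Rightarrow> real"
  assumes int: "integrable (lebesgue_on \<Omega>) f" and "\<sigma> \<longlonglongrightarrow> 0"
    and Q: "\<And>n. Q n \<in> sets (lebesgue_on \<Omega>)" "\<And>n x. x \<in> Q n \<Longrightarrow> x \<in> \<Omega>0 \<and> P x $ 1 \<le> \<sigma> n"
  shows "(\<lambda>n. LINT x|lebesgue_on \<Omega>. indicator (Q n) x * f x) \<longlonglongrightarrow> 0"
proof -
  have "(\<lambda>n. LINT x|lebesgue_on \<Omega>. indicator (Q n) x * f x) \<longlonglongrightarrow> (LINT x|lebesgue_on \<Omega>. 0)"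
  proof (rule integral_dominated_convergence[OF _ _ integrable_norm[OF int]])
    show "(\<lambda>x. indicator (Q n) x * f x) \<in> borel_measurable (lebesgue_on \<Omega>)" for n
      using Q(1) int by (intro borel_measurable_times borel_measurable_indicator) auto
    show "AE x in lebesgue_on \<Omega>. (\<lambda>n. indicator (Q n) x * f x) \<longlonglongrightarrow> 0"
    proof (rule AE_I2, rule tendsto_eventually)
      fix x
      have "\<forall>\<^sub>F n in sequentially. x \<notin> Q n"
      proof (cases "x \<in> \<Omega>0")
        case True
        then have "\<forall>\<^sub>F n in sequentially. \<sigma> n < P x $ 1"
          using assms(2) radius_bounds by (intro order_tendstoD(2))
        then show ?thesis by eventually_elim (use Q(2) in force)
      next
        case False
        then have "x \<notin> Q n" for n using Q(2) by blast
        then show ?thesis by simp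
      qed
      then show "\<forall>\<^sub>F n in sequentially. indicator (Q n) x * f x = 0" by eventually_elim simp
    qed
  qed (auto intro!: AE_I2 simp: indicator_def)
  then show ?thesis by simp
qed

text \<open>In polar coordinates \<open>1/s\<^sup>2\<close> has the same positive integral over each polar box
  \<open>\<sigma>/2 \<le> s \<le> \<sigma>\<close>, up to constants, although these boxes shrink to the pole.\<close>

lemma not_L2_if_reciprocal_growth:
  fixes f :: "real^2 \<Rightarrow> 'b::euclidean_space"
  assumes sector: "0 \<le> t - \<delta>" "t + \<delta> < 2 * pi" "0 < \<delta>" and \<kappa>: "0 < \<kappa>" and r: "0 < r"
    and growth: "\<And>x. x \<in> \<Omega>0 \<Longrightarrow> P x $ 1 \<le> r \<Longrightarrow> \<bar>P x $ 2 - t\<bar> \<le> \<delta> \<Longrightarrow> \<kappa> \<le> P x $ 1 * norm (f x)"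
  shows "f \<notin> L2 \<Omega>"
proof
  assume f: "f \<in> L2 \<Omega>"
  obtain c where c: "c > 0" "\<And>z. z \<in> strip L \<Longrightarrow> c * z $ 1 \<le> det (J z)"
    by (rule det_J_lower_bound) blast
  define \<rho> where "\<rho> = min r (L / 2)"
  define \<sigma> where "\<sigma> n = \<rho> / real (Suc n)" for n
  define Q where "Q n = F ` cbox (vector [\<sigma> n / 2, t - \<delta>]) (vector [\<sigma> n, t + \<delta>])" for n
  have \<rho>: "0 < \<rho>" "\<rho> \<le> r" "\<rho> < L" using r L_pos by (auto simp: \<rho>_def)
  have \<sigma>: "0 < \<sigma> n" "\<sigma> n \<le> \<rho>" for n
    using \<rho>(1) divide_left_mono[of 1 "real (Suc n)" \<rho>] by (simp_all add: \<sigma>_def)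
  have box: "0 < \<sigma> n / 2" "\<sigma> n / 2 \<le> \<sigma> n" "\<sigma> n < L" "0 \<le> t - \<delta>" "t - \<delta> \<le> t + \<delta>" "t + \<delta> < 2 * pi"
    for n
    using \<sigma>[of n] \<rho>(3) sector by auto
  have coords: "x \<in> \<Omega>0" "P x $ 1 \<le> \<sigma> n" "\<bar>P x $ 2 - t\<bar> \<le> \<delta>" if "x \<in> Q n" for x n
    using that polar_box_in_ring(1,2)[OF box, of _ n] F_ring
    by (auto simp: Q_def mem_box_cart forall_2)
  have "(\<lambda>n. LINT x|lebesgue_on \<Omega>. indicator (Q n) x * (norm (f x))\<^sup>2) \<longlonglongrightarrow> 0"
  proof (rule integral_shrinking_to_pole_tendsto_0)
    show "integrable (lebesgue_on \<Omega>) (\<lambda>x. (norm (f x))\<^sup>2)" using f by (simp add: L2_def)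
    show "\<sigma> \<longlonglongrightarrow> 0" unfolding \<sigma>_def[abs_def] using LIMSEQ_Suc[OF lim_const_over_n[of \<rho>]] by simp
    show "Q n \<in> sets (lebesgue_on \<Omega>)" for n
      using polar_box_lmeasurable[OF box] coords(1) punctured_\<Omega>
      by (auto simp: Q_def[symmetric] sets_restrict_space_iff fmeasurableD)
  qed (use coords in blast)
  moreover have "\<kappa>\<^sup>2 * (c * \<delta>) / 2 \<le> (LINT x|lebesgue_on \<Omega>. indicator (Q n) x * (norm (f x))\<^sup>2)"
    for n
    unfolding Q_def
  proof (rule L2_dyadic_polar_box_lower_bound[OF \<sigma>(1) box(3) sector c f])
    show "\<kappa> \<le> P x $ 1 * norm (f x)" "P x $ 1 \<le> \<sigma> n"
      if "x \<in> F ` cbox (vector [\<sigma> n / 2, t - \<delta>]) (vector [\<sigma> n, t + \<delta>])" for x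
      using coords[of x n] that \<sigma>(2)[of n] \<rho>(2) growth[of x] unfolding Q_def by linarith+
  qed (use \<kappa> in auto)
  ultimately have "\<kappa>\<^sup>2 * (c * \<delta>) / 2 \<le> 0"
    by (intro LIMSEQ_le_const[where a = "\<kappa>\<^sup>2 * (c * \<delta>) / 2"]) auto
  then show False using \<kappa> c sector by (simp add: mult_le_0_iff)
qed

end

section \<open>Polar splines\<close>

locale polar_splines = polar_map L \<Omega> x0 F + radial_knots L p ns s + angular_splines nt p
  for L \<Omega> x0 F p ns s nt
begin

abbreviation "B \<equiv> Bs p s"
abbreviation "M \<equiv> Ms p s"
abbreviation "spline0 \<equiv> comb0 L F p ns s nt"
abbreviation "spline1 \<equiv> comb1 L F p ns s nt"
abbreviation "spline2 \<equiv> comb2 L F p ns s nt"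

definition radial_component :: "(nat \<Rightarrow> nat \<Rightarrow> real) \<Rightarrow> real^2 \<Rightarrow> real" where
  "radial_component cs x = (\<Sum>i<ns - 1. M i (P x $ 1) * bt (cs i) (P x $ 2))"

definition angular_component :: "(nat \<Rightarrow> nat \<Rightarrow> real) \<Rightarrow> real^2 \<Rightarrow> real" where
  "angular_component ct x = (\<Sum>i<ns. B i (P x $ 1) * mt (ct i) (P x $ 2))"

definition polar_density :: "(nat \<Rightarrow> nat \<Rightarrow> real) \<Rightarrow> real^2 \<Rightarrow> real" where
  "polar_density c x = (\<Sum>i<ns - 1. M i (P x $ 1) * mt (c i) (P x $ 2))"

lemma spline0_eq: "spline0 c x = (\<Sum>i<ns. B i (P x $ 1) * bt (c i) (P x $ 2))"
  by (simp add: comb0_def T0_def bt_def Let_def sum_distrib_left mult_ac)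

lemma spline1_eq:
  "spline1 cs ct x = radial_component cs x *\<^sub>R polar_grad 1 x +
      angular_component ct x *\<^sub>R polar_grad 2 x"
  by (simp add: comb1_def T1s_def T1t_def radial_component_def angular_component_def bt_def mt_def
      Let_def
      pullback_matrix scaleR_sum_left sum_distrib_left mult_ac del: transpose_matrix_vector)

lemma spline2_eq: "spline2 c x = inverse (det (J (P x))) * polar_density c x"
  by (simp add: comb2_def T2_def polar_density_def mt_def Let_def sum_distrib_left mult_ac)

lemma borel_measurable_splines:
  shows "spline0 c \<in> borel_measurable (lebesgue_on \<Omega>)"
    and "spline1 cs ct \<in> borel_measurable (lebesgue_on \<Omega>)"
    and "spline2 c \<in> borel_measurable (lebesgue_on \<Omega>)"
  unfolding spline0_eq[abs_def] spline1_eq[abs_def] spline2_eq[abs_def]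
    radial_component_def angular_component_def polar_density_def
  by (intro borel_measurable_add borel_measurable_scaleR borel_measurable_times borel_measurable_sum
      borel_measurable_coordinate borel_measurable_polar_grad borel_measurable_inverse_det_J
      borel_measurable_Bs borel_measurable_Ms borel_measurable_bt borel_measurable_mt)+

subsection \<open>Weak derivatives away from the pole\<close>

lemma has_ae_gradient_radial:
  assumes "loc_lipschitz {0..<L} f" "\<And>t. t \<notin> breakpoints \<Longrightarrow> (f has_real_derivative f' t) (at t)"
  shows "has_ae_gradient \<Omega>0 (\<lambda>x. f (P x $ 1)) (\<lambda>x. f' (P x $ 1) *\<^sub>R polar_grad 1 x)"
  using assms finite_breakpoints
  by (intro has_ae_gradient_coordinate[of 1 f breakpoints])
    (auto simp: coordinate_range_def countable_finite)

lemma has_ae_gradient_bt: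
  "has_ae_gradient \<Omega>0 (\<lambda>x. bt e (P x $ 2)) (\<lambda>x. mt (cyc_diff e) (P x $ 2) *\<^sub>R polar_grad 2 x)"
  by (intro has_ae_gradient_coordinate[of 2 "bt e" knots] loc_lipschitz_subset[OF loc_lipschitz_bt]
      bt_shift countable_knots bt_has_derivative) auto

lemma has_ae_gradient_spline0:
  "has_ae_gradient \<Omega>0 (spline0 c) (spline1 (\<lambda>i j. c (i + 1) j - c i j) (\<lambda>i. cyc_diff (c i)))"
proof -
  let ?v = "spline1 (\<lambda>i j. c (i + 1) j - c i j) (\<lambda>i. cyc_diff (c i))"
  let ?grad = "\<lambda>x. \<Sum>i<ns. B i (P x $ 1) *\<^sub>R (mt (cyc_diff (c i)) (P x $ 2) *\<^sub>R polar_grad 2 x)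
      + bt (c i) (P x $ 2) *\<^sub>R (Bs' i (P x $ 1) *\<^sub>R polar_grad 1 x)"
  have "has_ae_gradient \<Omega>0 (spline0 c) ?grad"
    unfolding spline0_eq[abs_def]
    by (intro has_ae_gradient_sum has_ae_gradient_mult has_ae_gradient_radial has_ae_gradient_bt
        loc_lipschitz_Bs Bs_has_derivative) auto
  moreover have "?grad x = ?v x" for x
  proof -
    have "(\<Sum>i<ns. bt (c i) (P x $ 2) * Bs' i (P x $ 1)) =
        radial_component (\<lambda>i j. c (i + 1) j - c i j) x"
      unfolding sum_Bs' radial_component_def by (simp add: bt_diff mult.commute)
    then show ?thesis
      unfolding spline1_eq angular_component_def
      by (simp add: sum.distrib scaleR_sum_left[symmetric] add.commute)
  qed
  ultimately show ?thesis by simp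
qed

definition curl_coeff :: "(nat \<Rightarrow> nat \<Rightarrow> real) \<Rightarrow> (nat \<Rightarrow> nat \<Rightarrow> real) \<Rightarrow> nat \<Rightarrow> nat \<Rightarrow> real" where
  "curl_coeff cs ct i j = (ct (i + 1) j - ct i j) - cyc_diff (cs i) j"

lemma weak_div_rot_radial:
  assumes "i < ns - 1"
  shows "weak_div \<Omega>0 (\<lambda>x. rot ((M i (P x $ 1) * bt e (P x $ 2)) *\<^sub>R polar_grad 1 x))
     (\<lambda>x. (M i (P x $ 1) * mt (cyc_diff e) (P x $ 2)) * (polar_grad 2 x \<bullet> rot (polar_grad 1 x)))"
proof -
  have "has_ae_gradient \<Omega>0 (\<lambda>x. \<Sum>k<ns. of_bool (i < k) * B k (P x $ 1))
      (\<lambda>x. M i (P x $ 1) *\<^sub>R polar_grad 1 x)"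
    by (rule has_ae_gradient_radial[OF loc_lipschitz_Bs_sum Ms_primitive[OF assms]])
  from weak_div_rot_gradient[OF open_\<Omega>0 has_ae_gradient_bt this]
  show ?thesis by (simp add: linear_scale[OF linear_rot] mult_ac)
qed

lemma weak_div_rot_angular_spline:
  assumes "i < ns"
  shows "weak_div \<Omega>0 (\<lambda>x. rot ((B i (P x $ 1) * mt e (P x $ 2)) *\<^sub>R polar_grad 2 x))
     (\<lambda>x. (mt e (P x $ 2) * Bs' i (P x $ 1)) * (polar_grad 1 x \<bullet> rot (polar_grad 2 x)))"
proof -
  obtain b where b: "\<And>t. t \<notin> knots \<Longrightarrow>
      (bt b has_real_derivative mt e t - (\<Sum>j<nt. e j) / (2 * pi)) (at t)"
    by (rule mt_primitive) blast
  have "has_ae_gradient \<Omega>0 (\<lambda>x. B i (P x $ 1)) (\<lambda>x. Bs' i (P x $ 1) *\<^sub>R polar_grad 1 x)"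
    using assms by (intro has_ae_gradient_radial loc_lipschitz_Bs Bs_has_derivative)
  from weak_div_rot_angular[OF this loc_lipschitz_bt bt_shift countable_knots b]
  show ?thesis by (simp add: mult.assoc)
qed

lemma weak_div_rot_spline1: "weak_div \<Omega>0 (\<lambda>x. rot (spline1 cs ct x)) (spline2 (curl_coeff cs ct))"
proof -
  let ?rs = "\<lambda>x. \<Sum>i<ns - 1. rot ((M i (P x $ 1) * bt (cs i) (P x $ 2)) *\<^sub>R polar_grad 1 x)"
  let ?rt = "\<lambda>x. \<Sum>i<ns. rot ((B i (P x $ 1) * mt (ct i) (P x $ 2)) *\<^sub>R polar_grad 2 x)"
  let ?ws = "\<lambda>x. \<Sum>i<ns - 1. (M i (P x $ 1) * mt (cyc_diff (cs i)) (P x $ 2)) *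
    (polar_grad 2 x \<bullet> rot (polar_grad 1 x))"
  let ?wt = "\<lambda>x. \<Sum>i<ns. (mt (ct i) (P x $ 2) * Bs' i (P x $ 1)) *
    (polar_grad 1 x \<bullet> rot (polar_grad 2 x))"
  have "weak_div \<Omega>0 (\<lambda>x. ?rs x + ?rt x) (\<lambda>x. ?ws x + ?wt x)"
    by (intro weak_div_add weak_div_sum weak_div_rot_radial weak_div_rot_angular_spline) auto
  then show ?thesis
  proof (rule weak_div_cong_AE[OF punctured_\<Omega>(1)]; intro AE_I2)
    fix x assume "x \<in> space (lebesgue_on \<Omega>0)"
    then have x: "x \<in> \<Omega>0" by simp
    show "?rs x + ?rt x = rot (spline1 cs ct x)"
      by (simp add: spline1_eq radial_component_def angular_component_def linear_add[OF linear_rot]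
          linear_sum[OF linear_rot, symmetric] scaleR_sum_left)
    have mt_curl: "mt (curl_coeff cs ct i) t =
        mt (ct (i + 1)) t - mt (ct i) t - mt (cyc_diff (cs i)) t" for i t
      unfolding curl_coeff_def[abs_def] by (simp only: mt_diff)
    show "?ws x + ?wt x = spline2 (curl_coeff cs ct) x"
      unfolding spline2_eq polar_density_def polar_grad_inner_rot[OF x] sum_distrib_right[symmetric]
          sum_Bs' mt_curl
      by (simp add: algebra_simps sum_subtractf sum.distrib)
  qed
qed

subsection \<open>Behaviour at the pole\<close>

lemma O_radius_B_sum:
  assumes h: "\<And>i. bounded (range (h i))"
  shows "O_radius (\<lambda>x. (\<Sum>i<ns. B i (P x $ 1) * h i (P x $ 2)) - h 0 (P x $ 2))"
proof (rule sum_near_0[OF _ h])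
  show "\<exists>K. \<forall>x\<in>{0..<L}. \<bar>B i x - of_bool (i = 0) * 1\<bar> \<le> K * x" if "i < ns" for i
    unfolding mult_1_right by (rule Bs_near_0[OF that])
  show "0 < ns" using p_less_ns by simp
  fix K :: real
  assume "\<And>x t. x \<in> {0..<L} \<Longrightarrow> \<bar>(\<Sum>i<ns. B i x * h i t) - 1 * h 0 t\<bar> \<le> K * x"
  then show ?thesis using radius_bounds by (intro O_radiusI[of _ K]) force
qed

lemma O_radius_M_sum:
  assumes h: "\<And>i. bounded (range (h i))"
  shows "O_radius (\<lambda>x. (\<Sum>i<ns - 1. M i (P x $ 1) * h i (P x $ 2)) - M 0 0 * h 0 (P x $ 2))"
proof (rule sum_near_0[OF _ h])
  show "\<exists>K. \<forall>x\<in>{0..<L}. \<bar>M i x - of_bool (i = 0) * M 0 0\<bar> \<le> K * x" if "i < ns - 1" for i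
    by (rule Ms_near_0[OF that])
  show "0 < ns - 1" using p_less_ns p_pos by simp
  fix K :: real
  assume "\<And>x t. x \<in> {0..<L} \<Longrightarrow> \<bar>(\<Sum>i<ns - 1. M i x * h i t) - M 0 0 * h 0 t\<bar> \<le> K * x"
  then show ?thesis using radius_bounds by (intro O_radiusI[of _ K]) force
qed

lemma spline0_near_pole: "O_radius (\<lambda>x. spline0 c x - bt (c 0) (P x $ 2))"
  unfolding spline0_eq by (rule O_radius_B_sum[OF bounded_bt])

lemma radial_component_near_pole:
  "O_radius (\<lambda>x. radial_component cs x - M 0 0 * bt (cs 0) (P x $ 2))"
  unfolding radial_component_def by (rule O_radius_M_sum[OF bounded_bt])

lemma angular_component_near_pole: "O_radius (\<lambda>x. angular_component ct x - mt (ct 0) (P x $ 2))"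
  unfolding angular_component_def by (rule O_radius_B_sum[OF bounded_mt])

lemma polar_density_near_pole: "O_radius (\<lambda>x. polar_density c x - M 0 0 * mt (c 0) (P x $ 2))"
  unfolding polar_density_def by (rule O_radius_M_sum[OF bounded_mt])

lemma bounded_bt_angle: "bounded ((\<lambda>x. bt e (P x $ 2)) ` X)"
  by (rule bounded_subset[OF bounded_bt[of e]]) auto

lemma bounded_spline0: "bounded (spline0 c ` \<Omega>0)"
  by (rule bounded_if_O_radius_diff[OF spline0_near_pole bounded_bt_angle])

lemma bounded_radial_component: "bounded (radial_component cs ` \<Omega>0)"
proof (rule bounded_if_O_radius_diff[OF radial_component_near_pole])
  show "bounded ((\<lambda>x. M 0 0 * bt (cs 0) (P x $ 2)) ` \<Omega>0)"
    using bounded_scaling[OF bounded_bt_angle[of "cs 0" \<Omega>0], of "M 0 0"] by (simp add: image_image)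
qed

lemma bounded_spline1:
  assumes "\<forall>j<nt. ct 0 j = 0"
  shows "bounded (spline1 cs ct ` \<Omega>0)"
proof -
  obtain C where C: "C > 0" "\<And>x. x \<in> \<Omega>0 \<Longrightarrow> \<bar>radial_component cs x\<bar> \<le> C"
    using bounded_radial_component[of cs] unfolding bounded_pos by auto
  have "mt (ct 0) t = 0" for t using assms by (intro mt_zero) blast
  then have "O_radius (angular_component ct)" using angular_component_near_pole[of ct] by simp
  then obtain D where D: "D > 0" "\<And>x. x \<in> \<Omega>0 \<Longrightarrow> \<bar>angular_component ct x\<bar> \<le> D * P x $ 1"
    by (rule O_radiusE) blast
  obtain K where K: "K > 0" "\<And>x. x \<in> \<Omega>0 \<Longrightarrow> norm (polar_grad 1 x) \<le> K"
    "\<And>x. x \<in> \<Omega>0 \<Longrightarrow> norm (polar_grad 2 x) \<le> K / P x $ 1" by (rule polar_grad_bounds) blast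
  have "norm (spline1 cs ct x) \<le> C * K + D * K" if x: "x \<in> \<Omega>0" for x
  proof -
    have "norm (spline1 cs ct x)
        \<le> \<bar>radial_component cs x\<bar> * norm (polar_grad 1 x) + \<bar>angular_component ct x\<bar> * norm
          (polar_grad 2 x)"
      unfolding spline1_eq by (rule norm_triangle_le) simp
    also have "\<dots> \<le> C * K + (D * P x $ 1) * (K / P x $ 1)"
      using C D K x radius_bounds[OF x] by (intro add_mono mult_mono) auto
    also have "\<dots> = C * K + D * K" using radius_bounds[OF x] by simp
    finally show ?thesis .
  qed
  then show ?thesis by (auto simp: bounded_iff)
qed

lemma bounded_spline2:
  assumes "\<forall>j<nt. c 0 j = 0"
  shows "bounded (spline2 c ` \<Omega>0)"
proof -
  have "mt (c 0) t = 0" for t using assms by (intro mt_zero) blast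
  then have "O_radius (polar_density c)" using polar_density_near_pole[of c] by simp
  then obtain K where K: "K > 0" "\<And>x. x \<in> \<Omega>0 \<Longrightarrow> \<bar>polar_density c x\<bar> \<le> K * P x $ 1"
    by (rule O_radiusE) blast
  obtain d where d: "d > 0" "\<And>z. z \<in> strip L \<Longrightarrow> d * z $ 1 \<le> det (J z)"
    by (rule det_J_lower_bound) blast
  have "norm (spline2 c x) \<le> K / d" if x: "x \<in> \<Omega>0" for x
  proof -
    note ring = polar_coords_inner(1)[OF x] and r = radius_bounds(1)[OF x]
    have "norm (spline2 c x) = \<bar>polar_density c x\<bar> / det (J (P x))"
      using det_J_pos[OF ring] by (simp add: spline2_eq abs_mult divide_inverse mult.commute)
    also have "\<dots> \<le> (K * P x $ 1) / (d * P x $ 1)"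
      using K x d(1) r d(2)[OF ring_strip[OF ring]] by (intro frac_le) auto
    also have "\<dots> = K / d" using r by simp
    finally show ?thesis .
  qed
  then show ?thesis by (auto simp: bounded_iff)
qed

lemma L2_imp_leading_coeffs_zero:
  fixes f :: "real^2 \<Rightarrow> 'b::euclidean_space"
  assumes "f \<in> L2 \<Omega>" and growth: "O_radius (\<lambda>x. mt e (P x $ 2) / (norm (f x) + 1))" and "j < nt"
  shows "e j = 0"
proof (rule ccontr)
  assume "e j \<noteq> 0"
  with \<open>j < nt\<close> obtain t \<delta> \<eta> where sector: "0 \<le> t - \<delta>" "t + \<delta> < 2 * pi" "0 < \<delta>" and \<eta>: "0 < \<eta>"
    and low: "\<And>u. \<bar>u - t\<bar> \<le> \<delta> \<Longrightarrow> \<eta> \<le> \<bar>mt e u\<bar>" by (rule mt_nonzero_sector) blast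
  obtain K where K: "K > 0" "\<And>x. x \<in> \<Omega>0 \<Longrightarrow> \<bar>mt e (P x $ 2) / (norm (f x) + 1)\<bar> \<le> K * P x $ 1"
    using growth by (rule O_radiusE) blast
  have "\<eta> / (2 * K) \<le> P x $ 1 * norm (f x)"
    if x: "x \<in> \<Omega>0" "P x $ 1 \<le> \<eta> / (2 * K)" "\<bar>P x $ 2 - t\<bar> \<le> \<delta>" for x
  proof -
    have "norm (f x) + 1 > 0" by (simp add: add_nonneg_pos)
    then have "\<bar>mt e (P x $ 2)\<bar> \<le> K * P x $ 1 * (norm (f x) + 1)"
      using K(2)[OF x(1)] by (simp add: pos_divide_le_eq)
    then have "\<eta> \<le> K * P x $ 1 * (norm (f x) + 1)" using low[OF x(3)] by linarith
    then have "\<eta> / K \<le> P x $ 1 * norm (f x) + P x $ 1" using K(1) by (simp add: field_simps)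
    moreover have "\<eta> / K = \<eta> / (2 * K) + \<eta> / (2 * K)" by simp
    ultimately show ?thesis using x(2) by linarith
  qed
  then have "f \<notin> L2 \<Omega>"
    using \<eta> K(1)
    by (intro not_L2_if_reciprocal_growth[OF sector, of "\<eta> / (2 * K)" "\<eta> / (2 * K)"]) auto
  then show False using assms(1) by simp
qed

lemma O_radius_divide_norm_transfer:
  fixes v :: "real^2 \<Rightarrow> 'b::real_normed_vector"
  assumes "O_radius (\<lambda>x. f x / (norm (v x) + 1))" "O_radius (\<lambda>x. f x - g x)"
  shows "O_radius (\<lambda>x. g x / (norm (v x) + 1))"
proof -
  have "O_radius (\<lambda>x. (f x - g x) / (norm (v x) + 1))"
  proof (rule O_radius_le[OF assms(2), of _ 1])
    fix x
    have "\<bar>f x - g x\<bar> / (norm (v x) + 1) \<le> \<bar>f x - g x\<bar> / 1"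
      by (intro divide_left_mono) (auto simp: add_nonneg_pos)
    then show "\<bar>(f x - g x) / (norm (v x) + 1)\<bar> \<le> 1 * \<bar>f x - g x\<bar>" by (simp add: abs_divide)
  qed simp
  from O_radius_diff[OF assms(1) this] show ?thesis by (simp add: diff_divide_distrib[symmetric])
qed

lemma angular_component_growth:
  "O_radius (\<lambda>x. angular_component ct x / (norm (spline1 cs ct x) + 1))"
proof -
  obtain C where C: "C > 0" "\<And>x. x \<in> \<Omega>0 \<Longrightarrow> \<bar>radial_component cs x\<bar> \<le> C"
    using bounded_radial_component[of cs] unfolding bounded_pos by auto
  obtain K where K: "K > 0" "\<And>x. x \<in> \<Omega>0 \<Longrightarrow> norm (polar_grad 1 x) \<le> K"
    by (rule polar_grad_bounds) blast
  obtain D where D: "D > 0" "\<And>x. x \<in> \<Omega>0 \<Longrightarrow> 1 \<le> D * P x $ 1 * norm (polar_grad 2 x)"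
    by (rule polar_grad_angular_lower_bound) blast
  show ?thesis
  proof (rule O_radiusI)
    fix x assume x: "x \<in> \<Omega>0"
    define N a where "N = norm (spline1 cs ct x)" and "a = \<bar>angular_component ct x\<bar>"
    have N: "0 \<le> N" and a: "0 \<le> a" by (simp_all add: N_def a_def)
    have "angular_component ct x *\<^sub>R polar_grad 2 x =
        spline1 cs ct x - radial_component cs x *\<^sub>R polar_grad 1 x"
      by (simp add: spline1_eq)
    then have "a * norm (polar_grad 2 x) \<le> N + \<bar>radial_component cs x\<bar> * norm (polar_grad 1 x)"
      unfolding N_def a_def by (metis norm_scaleR norm_triangle_ineq4)
    also have "\<dots> \<le> N + C * K" using C K x by (intro add_left_mono mult_mono) auto
    also have "\<dots> \<le> (1 + C * K) * (N + 1)" using N C(1) K(1) by (simp add: algebra_simps)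
    finally have grad: "a * norm (polar_grad 2 x) \<le> (1 + C * K) * (N + 1)" .
    have "a * 1 \<le> a * (D * P x $ 1 * norm (polar_grad 2 x))" by (intro mult_left_mono D(2)[OF x] a)
    also have "\<dots> = (D * P x $ 1) * (a * norm (polar_grad 2 x))" by (simp only: mult_ac)
    also have "\<dots> \<le> (D * P x $ 1) * ((1 + C * K) * (N + 1))"
      using D(1) radius_bounds[OF x] by (intro mult_left_mono grad) auto
    finally have "a \<le> (D * (1 + C * K)) * P x $ 1 * (N + 1)" by (simp only: mult_ac mult_1)
    then show "\<bar>angular_component ct x / (norm (spline1 cs ct x) + 1)\<bar> \<le>
        (D * (1 + C * K)) * P x $ 1"
      using N unfolding N_def a_def by (simp add: abs_divide pos_divide_le_eq add_nonneg_pos)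
  qed
qed

lemma spline1_in_L2_imp:
  assumes "spline1 cs ct \<in> L2 \<Omega>" "j < nt"
  shows "ct 0 j = 0"
proof (rule L2_imp_leading_coeffs_zero[OF assms(1) _ assms(2)])
  show "O_radius (\<lambda>x. mt (ct 0) (P x $ 2) / (norm (spline1 cs ct x) + 1))"
    by (rule O_radius_divide_norm_transfer[OF angular_component_growth angular_component_near_pole])
qed

lemma polar_density_growth: "O_radius (\<lambda>x. polar_density c x / (norm (spline2 c x) + 1))"
proof -
  obtain D where D: "D > 0" "\<And>x. x \<in> \<Omega>0 \<Longrightarrow> det (J (P x)) \<le> D * P x $ 1"
    by (rule det_J_upper_bound) blast
  show ?thesis
  proof (rule O_radiusI)
    fix x assume x: "x \<in> \<Omega>0"
    let ?d = "det (J (P x))" and ?N = "norm (spline2 c x)"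
    have d: "0 < ?d" "?d \<le> D * P x $ 1"
      using det_J_pos[OF polar_coords_inner(1)[OF x]] D(2)[OF x] by simp_all
    have "\<bar>polar_density c x\<bar> = ?d * ?N" using d(1) by (simp add: spline2_eq abs_mult)
    also have "\<dots> \<le> (D * P x $ 1) * (?N + 1)" using d by (intro mult_mono) auto
    finally show "\<bar>polar_density c x / (?N + 1)\<bar> \<le> D * P x $ 1"
      by (simp add: abs_divide pos_divide_le_eq add_nonneg_pos)
  qed
qed

lemma spline2_in_L2_imp:
  assumes "spline2 c \<in> L2 \<Omega>" "j < nt"
  shows "c 0 j = 0"
proof (rule L2_imp_leading_coeffs_zero[OF assms(1) _ assms(2)])
  have "O_radius (\<lambda>x. M 0 0 * mt (c 0) (P x $ 2) / (norm (spline2 c x) + 1))"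
    by (rule O_radius_divide_norm_transfer[OF polar_density_growth polar_density_near_pole])
  then show "O_radius (\<lambda>x. mt (c 0) (P x $ 2) / (norm (spline2 c x) + 1))"
    by (rule O_radius_le[of _ _ "1 / M 0 0"]) (use Ms_0_pos in \<open>simp_all add: abs_mult\<close>)
qed

subsection \<open>The conforming spaces\<close>

lemma spline0_in_H1_iff: "spline0 c \<in> H1 \<Omega> \<longleftrightarrow> (\<exists>\<gamma>. \<forall>j<nt. c 0 j = \<gamma>)"
  unfolding cyc_diff_eq_0_iff_const[symmetric]
proof
  let ?v = "spline1 (\<lambda>i j. c (i + 1) j - c i j) (\<lambda>i. cyc_diff (c i))"
  note grad = has_ae_gradient_spline0[of c]
  show "\<forall>j<nt. cyc_diff (c 0) j = 0" if u: "spline0 c \<in> H1 \<Omega>"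
  proof -
    have "?v \<in> L2 \<Omega>"
      using u by (intro H1_imp_gradient_L2[OF open_\<Omega>0 open_\<Omega> punctured_\<Omega>(3,4) _ grad]) simp_all
    then show ?thesis using spline1_in_L2_imp by blast
  qed
  show "spline0 c \<in> H1 \<Omega>" if "\<forall>j<nt. cyc_diff (c 0) j = 0"
    using that
    by (intro H1_punctured[OF open_\<Omega> bounded_\<Omega> _ grad[unfolded \<Omega>0_def]] borel_measurable_splines
        bounded_spline0[unfolded \<Omega>0_def] bounded_spline1[unfolded \<Omega>0_def]) simp_all
qed

lemma spline1_in_Hcurl_iff:
  "spline1 cs ct \<in> Hcurl \<Omega> \<longleftrightarrow> (\<forall>j<nt. ct 0 j = 0 \<and> curl_coeff cs ct 0 j = 0)"
proof
  show "\<forall>j<nt. ct 0 j = 0 \<and> curl_coeff cs ct 0 j = 0" if v: "spline1 cs ct \<in> Hcurl \<Omega>"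
  proof -
    have "spline1 cs ct \<in> L2 \<Omega>" using v by (simp add: Hcurl_def)
    moreover have "spline2 (curl_coeff cs ct) \<in> L2 \<Omega>"
      by (rule Hcurl_imp_curl_L2[OF open_\<Omega>0 open_\<Omega> punctured_\<Omega>(3,4) weak_div_rot_spline1 v])
    ultimately show ?thesis using spline1_in_L2_imp spline2_in_L2_imp by blast
  qed
  show "spline1 cs ct \<in> Hcurl \<Omega>" if "\<forall>j<nt. ct 0 j = 0 \<and> curl_coeff cs ct 0 j = 0"
    using that
    by (intro Hcurl_punctured[OF open_\<Omega> bounded_\<Omega> weak_div_rot_spline1[unfolded \<Omega>0_def]]
        borel_measurable_splines
        bounded_spline1[unfolded \<Omega>0_def] bounded_spline2[unfolded \<Omega>0_def]) blast+
qed

lemma spline2_in_L2_iff: "spline2 c \<in> L2 \<Omega> \<longleftrightarrow> (\<forall>j<nt. c 0 j = 0)"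
proof
  show "spline2 c \<in> L2 \<Omega>" if "\<forall>j<nt. c 0 j = 0"
    using bounded_spline2[of c] that
    by (intro L2_bounded_punctured[OF open_\<Omega> bounded_\<Omega> borel_measurable_splines(3)])
      (simp add: \<Omega>0_def)
qed (use spline2_in_L2_imp in blast)

lemma continuous_on_spline0: "continuous_on \<Omega>0 (spline0 c)"
  by (rule loc_lipschitz_continuous_on[OF has_ae_gradientD(1)[OF has_ae_gradient_spline0]])

lemma spline0_continuous_representative:
  assumes "\<forall>j<nt. c 0 j = \<gamma>"
  shows "\<exists>g. continuous_representative \<Omega> (spline0 c) g \<and> g x0 = \<gamma>"
proof -
  let ?g = "(spline0 c)(x0 := \<gamma>)"
  have "O_radius (\<lambda>x. spline0 c x - \<gamma>)"
    using spline0_near_pole[of c] bt_const[of "c 0" \<gamma>] assms by simp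
  then have "continuous_on \<Omega> ?g" by (rule continuous_on_extend_pole[OF continuous_on_spline0])
  moreover have "AE x in lebesgue_on \<Omega>. spline0 c x = ?g x"
    using AE_in_punctured_domain[OF open_\<Omega>, of x0] by eventually_elim simp
  ultimately have "continuous_representative \<Omega> (spline0 c) ?g"
    by (simp only: continuous_representative_def)
  then show ?thesis by (intro exI[of _ ?g]) simp
qed

lemma continuous_representative_eq_off_pole:
  assumes g: "continuous_representative \<Omega> (spline0 c) g" and x: "x \<in> \<Omega>0"
  shows "spline0 c x = g x"
proof (rule ccontr)
  let ?D = "\<Omega>0 \<inter> (\<lambda>x. spline0 c x - g x) -` (- {0})"
  have cont: "continuous_on \<Omega>0 (\<lambda>x. spline0 c x - g x)"
    using g continuous_on_spline0 punctured_\<Omega>(3) unfolding continuous_representative_def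
    by (blast intro: continuous_on_diff continuous_on_subset)
  have "open ?D" by (intro continuous_open_preimage cont open_\<Omega>0 open_Compl) simp
  moreover have "AE x in lebesgue. x \<notin> ?D"
    using g open_\<Omega> punctured_\<Omega>(3) unfolding continuous_representative_def
    by (auto simp: lebesgue_on_AE_iff elim!: eventually_mono)
  then have "negligible ?D" by (simp add: negligible_iff_null_sets completion.null_sets_iff_AE)
  moreover assume "spline0 c x \<noteq> g x"
  then have "?D \<noteq> {}" using x by auto
  ultimately show False using open_not_negligible by blast
qed

lemma continuous_representative_at_pole:
  assumes g: "continuous_representative \<Omega> (spline0 c) g"
  shows "bt (c 0) t = g x0"
proof -
  obtain k :: int where k: "0 \<le> t + 2 * pi * of_int k" "t + 2 * pi * of_int k < 2 * pi"
    by (rule shift_into_period)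
  define u where "u = t + 2 * pi * of_int k"
  let ?ray = "\<lambda>\<sigma>. F (vector [\<sigma>, u])"
  have "((\<lambda>\<sigma>. spline0 c (?ray \<sigma>) - bt (c 0) (P (?ray \<sigma>) $ 2)) \<longlongrightarrow> 0) (at_right 0)"
    by (rule filterlim_compose[OF O_radius_tendsto_0[OF spline0_near_pole] F_ray_filterlim])
  moreover have "\<forall>\<^sub>F \<sigma> in at_right 0.
      spline0 c (?ray \<sigma>) - bt (c 0) (P (?ray \<sigma>) $ 2) = g (?ray \<sigma>) - bt (c 0) t"
    using ray_in_ring[of u]
  proof eventually_elim
    case (elim \<sigma>)
    have "P (?ray \<sigma>) = vector [\<sigma>, u]" using elim k by (intro polar_coords_F_eq) (auto simp: u_def)
    then show ?case
      using continuous_representative_eq_off_pole[OF g F_ring[OF elim]] bt_shift[of "c 0" t k]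
      by (simp add: u_def)
  qed
  ultimately have "((\<lambda>\<sigma>. g (?ray \<sigma>) - bt (c 0) t) \<longlongrightarrow> 0) (at_right 0)"
    by (rule Lim_transform_eventually)
  then have "((\<lambda>\<sigma>. g (?ray \<sigma>)) \<longlongrightarrow> bt (c 0) t) (at_right 0)" by (simp add: LIM_zero_iff)
  moreover have "(g \<longlongrightarrow> g x0) (at x0)"
    using g open_\<Omega> x0_in continuous_on_eq_continuous_at
    unfolding continuous_representative_def continuous_at by blast
  then have "((\<lambda>\<sigma>. g (?ray \<sigma>)) \<longlongrightarrow> g x0) (at_right 0)"
    by (rule filterlim_compose[OF _ F_ray_filterlim])
  ultimately show ?thesis using tendsto_unique[OF trivial_limit_at_right_real] by blast
qed

lemma spline0_in_C0_iff: "spline0 c \<in> C0 \<Omega> \<longleftrightarrow> (\<exists>\<gamma>. \<forall>j<nt. c 0 j = \<gamma>)"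
proof
  assume "spline0 c \<in> C0 \<Omega>"
  then obtain g where g: "continuous_representative \<Omega> (spline0 c) g" by (auto simp: C0_def)
  have "bt (\<lambda>j. c 0 j - g x0) t = 0" for t
    using continuous_representative_at_pole[OF g, of t] by (simp add: bt_diff bt_const)
  then show "\<exists>\<gamma>. \<forall>j<nt. c 0 j = \<gamma>"
    using bt_eq_0_imp[of "\<lambda>j. c 0 j - g x0"] by (intro exI[of _ "g x0"]) auto
next
  assume "\<exists>\<gamma>. \<forall>j<nt. c 0 j = \<gamma>"
  then show "spline0 c \<in> C0 \<Omega>"
    using spline0_continuous_representative unfolding C0_def by blast
qed

lemma V0_eq: "V0 L \<Omega> F p ns s nt = {spline0 c | c. \<exists>\<gamma>0. \<forall>j<nt. c 0 j = \<gamma>0}"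
  unfolding V0_def W0_def using spline0_in_H1_iff by blast

lemma V1_eq: "V1 L \<Omega> F p ns s nt =
   {spline1 vs vt | vs vt. \<forall>j<nt. vt 0 j = 0 \<and> vt 1 j = vs 0 ((j + 1) mod nt) - vs 0 j}"
proof -
  have "spline1 vs vt \<in> Hcurl \<Omega> \<longleftrightarrow>
      (\<forall>j<nt. vt 0 j = 0 \<and> vt 1 j = vs 0 ((j + 1) mod nt) - vs 0 j)" for vs vt
    unfolding spline1_in_Hcurl_iff by (auto simp: curl_coeff_def cyc_diff_def)
  then show ?thesis unfolding V1_def W1_def by blast
qed

lemma V2_eq: "V2 L \<Omega> F p ns s nt = {spline2 c | c. \<forall>j<nt. c 0 j = 0}"
  unfolding V2_def W2_def using spline2_in_L2_iff by blast

lemma V0_eq_C0: "V0 L \<Omega> F p ns s nt = W0 L F p ns s nt \<inter> C0 \<Omega>"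
  unfolding V0_eq W0_def using spline0_in_C0_iff by blast

end

theorem theorem3p1:
  fixes L :: real and \<Omega> :: "(real^2) set" and x0 :: "real^2" and F :: "real^2 \<Rightarrow> real^2"
    and p ns nt :: nat and s :: "nat \<Rightarrow> real"
  assumes "polar_mapping L \<Omega> x0 F"
    and "first_order_polar_singularity L F"
    and "1 \<le> p"
    and "open_knots L p ns s"
    and "p + 1 \<le> nt"
  shows "V0 L \<Omega> F p ns s nt =
           {comb0 L F p ns s nt c | c. \<exists>\<gamma>0. \<forall>j<nt. c 0 j = \<gamma>0} \<and>
         V1 L \<Omega> F p ns s nt =
           {comb1 L F p ns s nt vs vt | vs vt.
              \<forall>j<nt. vt 0 j = 0 \<and> vt 1 j = vs 0 ((j + 1) mod nt) - vs 0 j} \<and>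
         V2 L \<Omega> F p ns s nt =
           {comb2 L F p ns s nt c | c. \<forall>j<nt. c 0 j = 0} \<and>
         (\<forall>c \<gamma>0. (\<forall>j<nt. c 0 j = \<gamma>0) \<longrightarrow>
           (\<exists>g. continuous_representative \<Omega> (comb0 L F p ns s nt c) g \<and> g x0 = \<gamma>0)) \<and>
         V0 L \<Omega> F p ns s nt = W0 L F p ns s nt \<inter> C0 \<Omega>"
proof -
  interpret polar_splines L \<Omega> x0 F p ns s nt
    by unfold_locales (use assms in auto)
  show ?thesis
    using V0_eq V1_eq V2_eq spline0_continuous_representative V0_eq_C0 by blast
qed

end
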